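(* Let $\mu$ be a measure on a locally compact space $X$ with $L^2(X,d\mu)$ separable. Let $L_0$ be a selfadjoint operator, bounded from below, on $L^2(X,d\mu)$ such that for some $s>0$, $e^{-sL_0}$ maps $L^2(X,d\mu)$ to $L^\infty(X,d\mu)$. Suppose $V$ is a nonnegative multiplication operator (multiplication by a measurable function $V\geq 0$ on $X$) such that $$\mu(\{x\in X\mid 0\leq V(x)<M\})<\infty$$ for all $M$. Then $L=L_0+V$ has purely discrete spectrum.
   Context: $L=L_0+V$ denotes the operator obtained by applying the monotone convergence theorem for quadratic forms to $L_0+\min(V(x),k)$ as $k\to\infty$. That is, $L$ is the selfadjoint operator associated with the closed quadratic form $u\mapsto q_{L_0}(u)+\int V|u|^2\,d\mu$ with form domain $\{u\in Q(L_0)\mid \int V|u|^2\,d\mu<\infty\}$, where $q_{L_0}$ and $Q(L_0)$ are the quadratic form and form domain of $L_0$. If this form domain is not dense, $L$ is understood as a selfadjoint operator on the closure of the form domain, and $e^{-tL}$ is set to $0$ on the orthogonal complement. A selfadjoint operator has purely discrete spectrum if its essential spectrum is empty; for an operator bounded from below as here, this is equivalent to compactness of $e^{-tL}$ for any (and so all) $t>0$. *)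

theory Defs
  imports "HOL-Analysis.Analysis"
begin

(* Elements of L^2 and L^infinity are represented by functions; two functions that agree
   almost everywhere are the same element.  Accordingly operators are graphs that are
   saturated under, and single-valued up to, equality almost everywhere. *)

definition L2 :: "'a measure \<Rightarrow> ('a \<Rightarrow> complex) set" where
  "L2 M = {f \<in> borel_measurable M. integrable M (\<lambda>x. (norm (f x))\<^sup>2)}"

definition Linf :: "'a measure \<Rightarrow> ('a \<Rightarrow> complex) set" where
  "Linf M = {f \<in> borel_measurable M. \<exists>C. AE x in M. norm (f x) \<le> C}"

definition l2_inner :: "'a measure \<Rightarrow> ('a \<Rightarrow> complex) \<Rightarrow> ('a \<Rightarrow> complex) \<Rightarrow> complex" where
  "l2_inner M f g = (LINT x|M. cnj (f x) * g x)"

definition l2_norm :: "'a measure \<Rightarrow> ('a \<Rightarrow> complex) \<Rightarrow> real" where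
  "l2_norm M f = sqrt (LINT x|M. (norm (f x))\<^sup>2)"

definition l2_closure :: "'a measure \<Rightarrow> ('a \<Rightarrow> complex) set \<Rightarrow> ('a \<Rightarrow> complex) set" where
  "l2_closure M S = {f \<in> L2 M. \<forall>e>0. \<exists>g\<in>S. l2_norm M (\<lambda>x. f x - g x) < e}"

definition l2_separable :: "'a measure \<Rightarrow> bool" where
  "l2_separable M \<longleftrightarrow> (\<exists>D. countable D \<and> D \<subseteq> L2 M \<and> l2_closure M D = L2 M)"

type_synonym 'a l2_op = "(('a \<Rightarrow> complex) \<times> ('a \<Rightarrow> complex)) set"

definition linear_op :: "'a measure \<Rightarrow> 'a l2_op \<Rightarrow> bool" where
  "linear_op M A \<longleftrightarrow>
     A \<subseteq> L2 M \<times> L2 M \<and>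
     (\<forall>(f, g)\<in>A. \<forall>(f', g')\<in>A. ((\<lambda>x. f x + f' x), (\<lambda>x. g x + g' x)) \<in> A) \<and>
     (\<forall>(f, g)\<in>A. \<forall>c. ((\<lambda>x. c * f x), (\<lambda>x. c * g x)) \<in> A) \<and>
     (\<forall>(f, g)\<in>A. \<forall>f'\<in>L2 M. \<forall>g'\<in>L2 M.
        (AE x in M. f' x = f x) \<longrightarrow> (AE x in M. g' x = g x) \<longrightarrow> (f', g') \<in> A) \<and>
     (\<forall>(f, g)\<in>A. \<forall>(f', g')\<in>A. (AE x in M. f x = f' x) \<longrightarrow> (AE x in M. g x = g' x))"

definition adjoint_op :: "'a measure \<Rightarrow> 'a l2_op \<Rightarrow> 'a l2_op" where
  "adjoint_op M A =
     {(h, k) \<in> L2 M \<times> L2 M. \<forall>(f, g)\<in>A. l2_inner M h g = l2_inner M k f}"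

definition selfadjoint :: "'a measure \<Rightarrow> 'a l2_op \<Rightarrow> bool" where
  "selfadjoint M A \<longleftrightarrow>
     linear_op M A \<and> l2_closure M (Domain A) = L2 M \<and> adjoint_op M A = A"

definition bounded_from_below :: "'a measure \<Rightarrow> 'a l2_op \<Rightarrow> bool" where
  "bounded_from_below M A \<longleftrightarrow>
     (\<exists>c::real. \<forall>(f, g)\<in>A. c * (l2_norm M f)\<^sup>2 \<le> Re (l2_inner M f g))"

(* Linearity of E S, and its compatibility with equality almost everywhere, follow from
   symmetry. *)
definition projection_valued_measure ::
    "'a measure \<Rightarrow> (real set \<Rightarrow> ('a \<Rightarrow> complex) \<Rightarrow> ('a \<Rightarrow> complex)) \<Rightarrow> bool" where
  "projection_valued_measure M E \<longleftrightarrow>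
     (\<forall>S\<in>sets borel. \<forall>f\<in>L2 M. E S f \<in> L2 M) \<and>
     (\<forall>S\<in>sets borel. \<forall>f\<in>L2 M. \<forall>g\<in>L2 M. l2_inner M f (E S g) = l2_inner M (E S f) g) \<and>
     (\<forall>S\<in>sets borel. \<forall>T\<in>sets borel. \<forall>f\<in>L2 M. AE x in M. E S (E T f) x = E (S \<inter> T) f x) \<and>
     (\<forall>f\<in>L2 M. AE x in M. E UNIV f x = f x) \<and>
     (\<forall>f\<in>L2 M. \<forall>S::nat \<Rightarrow> real set. range S \<subseteq> sets borel \<longrightarrow> disjoint_family S \<longrightarrow>
        (\<lambda>n. l2_norm M (\<lambda>x. E (\<Union>i. S i) f x - (\<Sum>i<n. E (S i) f x))) \<longlonglongrightarrow> 0)"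

(* The finite Borel measure  S |-> <f, E(S) f>. *)
definition spectral_dist ::
    "'a measure \<Rightarrow> (real set \<Rightarrow> ('a \<Rightarrow> complex) \<Rightarrow> ('a \<Rightarrow> complex)) \<Rightarrow>
     ('a \<Rightarrow> complex) \<Rightarrow> real measure" where
  "spectral_dist M E f =
     measure_of UNIV (sets borel) (\<lambda>S. ennreal (Re (l2_inner M f (E S f))))"

(* The sesquilinear form, conjugate-linear in its first argument, of a quadratic form q. *)
definition polarize ::
    "(('a \<Rightarrow> complex) \<Rightarrow> real) \<Rightarrow> ('a \<Rightarrow> complex) \<Rightarrow> ('a \<Rightarrow> complex) \<Rightarrow> complex" where
  "polarize q h f =
     (\<Sum>k<4::nat. cnj (\<i> ^ k) * complex_of_real (q (\<lambda>x. h x + \<i> ^ k * f x))) / 4"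

definition spectral_integral_dom ::
    "'a measure \<Rightarrow> (real set \<Rightarrow> ('a \<Rightarrow> complex) \<Rightarrow> ('a \<Rightarrow> complex)) \<Rightarrow>
     (real \<Rightarrow> real) \<Rightarrow> ('a \<Rightarrow> complex) set" where
  "spectral_integral_dom M E \<phi> = {f \<in> L2 M. integrable (spectral_dist M E f) (\<lambda>t. (\<phi> t)\<^sup>2)}"

(* The operator G = (integral of phi dE): <f, G f> is the integral of phi with respect to
   <f, E(.) f>, and polarization determines G, its domain being dense. *)
definition spectral_integral ::
    "'a measure \<Rightarrow> (real set \<Rightarrow> ('a \<Rightarrow> complex) \<Rightarrow> ('a \<Rightarrow> complex)) \<Rightarrow>
     (real \<Rightarrow> real) \<Rightarrow> 'a l2_op" where
  "spectral_integral M E \<phi> =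
     {(f, g). f \<in> spectral_integral_dom M E \<phi> \<and> g \<in> L2 M \<and>
        (\<forall>h\<in>spectral_integral_dom M E \<phi>.
           l2_inner M h g = polarize (\<lambda>u. LINT t|spectral_dist M E u. \<phi> t) h f)}"

definition is_spectral_measure ::
    "'a measure \<Rightarrow> 'a l2_op \<Rightarrow> (real set \<Rightarrow> ('a \<Rightarrow> complex) \<Rightarrow> ('a \<Rightarrow> complex)) \<Rightarrow> bool" where
  "is_spectral_measure M A E \<longleftrightarrow>
     projection_valued_measure M E \<and> A = spectral_integral M E (\<lambda>t. t)"

(* By the spectral theorem a selfadjoint operator has a spectral measure, unique up to
   equality almost everywhere of the functions E S f. *)
definition spectral_measure ::
    "'a measure \<Rightarrow> 'a l2_op \<Rightarrow> real set \<Rightarrow> ('a \<Rightarrow> complex) \<Rightarrow> ('a \<Rightarrow> complex)" where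
  "spectral_measure M A = (SOME E. is_spectral_measure M A E)"

(* phi(A).  If A has no spectral measure, the value of SOME above is meaningless and phi(A)
   is the empty graph. *)
definition functional_calculus :: "'a measure \<Rightarrow> 'a l2_op \<Rightarrow> (real \<Rightarrow> real) \<Rightarrow> 'a l2_op" where
  "functional_calculus M A \<phi> =
     {(f, g). is_spectral_measure M A (spectral_measure M A) \<and>
        (f, g) \<in> spectral_integral M (spectral_measure M A) \<phi>}"

(* e^{-sA} *)
definition exp_op :: "'a measure \<Rightarrow> real \<Rightarrow> 'a l2_op \<Rightarrow> 'a l2_op" where
  "exp_op M s A = functional_calculus M A (\<lambda>t. exp (- s * t))"

definition maps_L2_to_Linf :: "'a measure \<Rightarrow> 'a l2_op \<Rightarrow> bool" where
  "maps_L2_to_Linf M T \<longleftrightarrow> L2 M \<subseteq> Domain T \<and> Range T \<subseteq> Linf M"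

(* Form domain Q(A) = D(|A|^(1/2)) and form q_A of a selfadjoint operator A. *)
definition op_form_dom :: "'a measure \<Rightarrow> 'a l2_op \<Rightarrow> ('a \<Rightarrow> complex) set" where
  "op_form_dom M A = Domain (functional_calculus M A (\<lambda>t. sqrt \<bar>t\<bar>))"

definition op_form :: "'a measure \<Rightarrow> 'a l2_op \<Rightarrow> ('a \<Rightarrow> complex) \<Rightarrow> real" where
  "op_form M A f = (LINT t|spectral_dist M (spectral_measure M A) f. t)"

(* The operator associated with a closed quadratic form q on Q; it acts in the closure of Q. *)
definition form_operator ::
    "'a measure \<Rightarrow> ('a \<Rightarrow> complex) set \<Rightarrow> (('a \<Rightarrow> complex) \<Rightarrow> real) \<Rightarrow> 'a l2_op" where
  "form_operator M Q q =
     {(f, g). f \<in> Q \<and> g \<in> l2_closure M Q \<and> (\<forall>h\<in>Q. polarize q h f = l2_inner M h g)}"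

definition form_sum_dom :: "'a measure \<Rightarrow> 'a l2_op \<Rightarrow> ('a \<Rightarrow> real) \<Rightarrow> ('a \<Rightarrow> complex) set" where
  "form_sum_dom M A V = {f \<in> op_form_dom M A. integrable M (\<lambda>x. V x * (norm (f x))\<^sup>2)}"

definition form_sum_form ::
    "'a measure \<Rightarrow> 'a l2_op \<Rightarrow> ('a \<Rightarrow> real) \<Rightarrow> ('a \<Rightarrow> complex) \<Rightarrow> real" where
  "form_sum_form M A V f = op_form M A f + (LINT x|M. V x * (norm (f x))\<^sup>2)"

(* A + V, an operator in the closed subspace form_sum_space M A V, which may be proper. *)
definition form_sum :: "'a measure \<Rightarrow> 'a l2_op \<Rightarrow> ('a \<Rightarrow> real) \<Rightarrow> 'a l2_op" where
  "form_sum M A V = form_operator M (form_sum_dom M A V) (form_sum_form M A V)"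

definition form_sum_space :: "'a measure \<Rightarrow> 'a l2_op \<Rightarrow> ('a \<Rightarrow> real) \<Rightarrow> ('a \<Rightarrow> complex) set" where
  "form_sum_space M A V = l2_closure M (form_sum_dom M A V)"

(* Below, K is the closed subspace of L^2 that serves as the Hilbert space of A. *)

definition shift_op :: "'a l2_op \<Rightarrow> complex \<Rightarrow> 'a l2_op" where
  "shift_op A z = {(f, \<lambda>x. g x - z * f x) | f g. (f, g) \<in> A}"

(* A - z is onto K, and the lower bound says that it is injective with bounded inverse. *)
definition resolvent_set :: "'a measure \<Rightarrow> ('a \<Rightarrow> complex) set \<Rightarrow> 'a l2_op \<Rightarrow> complex set" where
  "resolvent_set M K A =
     {z. K \<subseteq> Range (shift_op A z) \<and>
         (\<exists>C. \<forall>(f, k)\<in>shift_op A z. l2_norm M f \<le> C * l2_norm M k)}"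

definition spectrum :: "'a measure \<Rightarrow> ('a \<Rightarrow> complex) set \<Rightarrow> 'a l2_op \<Rightarrow> complex set" where
  "spectrum M K A = - resolvent_set M K A"

definition eigenspace :: "'a l2_op \<Rightarrow> complex \<Rightarrow> ('a \<Rightarrow> complex) set" where
  "eigenspace A z = {f. (f, \<lambda>x. z * f x) \<in> A}"

definition finite_dim :: "'a measure \<Rightarrow> ('a \<Rightarrow> complex) set \<Rightarrow> bool" where
  "finite_dim M W \<longleftrightarrow>
     (\<exists>B. finite B \<and> B \<subseteq> L2 M \<and> (\<forall>f\<in>W. \<exists>c. AE x in M. f x = (\<Sum>b\<in>B. c b * b x)))"

definition discrete_spectrum :: "'a measure \<Rightarrow> ('a \<Rightarrow> complex) set \<Rightarrow> 'a l2_op \<Rightarrow> complex set" where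
  "discrete_spectrum M K A =
     {z. z isolated_in spectrum M K A \<and>
         (\<exists>f\<in>eigenspace A z. \<not> (AE x in M. f x = 0)) \<and> finite_dim M (eigenspace A z)}"

definition essential_spectrum :: "'a measure \<Rightarrow> ('a \<Rightarrow> complex) set \<Rightarrow> 'a l2_op \<Rightarrow> complex set" where
  "essential_spectrum M K A = spectrum M K A - discrete_spectrum M K A"

definition purely_discrete_spectrum :: "'a measure \<Rightarrow> ('a \<Rightarrow> complex) set \<Rightarrow> 'a l2_op \<Rightarrow> bool" where
  "purely_discrete_spectrum M K A \<longleftrightarrow> essential_spectrum M K A = {}"

end

theory Submission
  imports Defs "HOL-Library.Function_Algebras"
begin

text \<open>
  Why the spectrum of \<open>L = L\<^sub>0 + V\<close> is purely discrete. Let \<open>q\<close> be the form of \<open>L\<close>, \<open>Q\<close> its domain and \<open>c\<close>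
  a lower bound of \<open>L\<^sub>0\<close>. The heart of the matter is that \<open>Q\<close> is compactly embedded in \<open>L\<^sup>2\<close>, in this form
  (lemma \<open>compact_embedding\<close>): for every \<open>\<mu>\<close> there are finitely many \<open>s \<in> L\<^sup>2\<close> and a constant \<open>C\<close> with
  \<open>\<mu> \<parallel>f\<parallel>\<^sup>2 \<le> q f + C \<Sum>s. |\<langle>s, f\<rangle>|\<^sup>2\<close> on \<open>Q\<close>.

  To see this, split \<open>f\<close> three times. Where \<open>V \<ge> R\<close>, the potential energy controls \<open>\<parallel>f\<parallel>\<^sup>2\<close> with the small
  factor \<open>1 / R\<close>. Spectral components of \<open>L\<^sub>0\<close> above a level \<open>\<Lambda>\<close> are controlled by the energy of \<open>L\<^sub>0\<close> with the
  small factor \<open>1 / (\<Lambda> - c)\<close>. What remains is \<open>1\<^sub>F P f\<close>, where \<open>F = {V < R}\<close> has finite measure and \<open>P\<close> is the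
  spectral projection for \<open>t \<le> \<Lambda>\<close>. Since \<open>exp (s t)\<close> is bounded for \<open>t \<le> \<Lambda>\<close>, the range of \<open>P\<close> is
  contained in the range of \<open>exp (- s L\<^sub>0)\<close>, hence in \<open>L\<^sup>\<infinity>\<close> (\<open>heat_range\<close>); by a Baire argument
  \<open>\<parallel>P f\<parallel>\<^sub>\<infinity> \<le> C \<parallel>f\<parallel>\<close> (\<open>Phi_Linf_bounded\<close>). Therefore \<open>\<Sum>e. |P e x|\<^sup>2 \<le> C\<^sup>2\<close> almost everywhere for orthonormal
  vectors \<open>e\<close> (\<open>pointwise_Bessel\<close>), and integration over \<open>F\<close> shows that \<open>1\<^sub>F P\<close> is a Hilbert-Schmidt operator,
  so up to a small error it depends on finitely many coefficients only (\<open>compact_cutoff\<close>).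

  The passage from the embedding to the spectrum is classical (\<open>discrete_form\<close>). Orthonormal eigenvectors
  with bounded eigenvalues cannot form an infinite sequence, so eigenvalues are isolated with finite
  multiplicity. At a point that is no eigenvalue, \<open>L - z\<close> is bounded below by compactness, and onto
  because a vector orthogonal to its range would be an eigenvector (\<open>solves_surj\<close>). This takes place
  in the closure of \<open>Q\<close>, and equations for \<open>L\<close> are read weakly, against test vectors in \<open>Q\<close>.

  The spectral measure of \<open>L\<^sub>0\<close> is used through the positive measures \<open>\<nu> f = \<langle>f, E(\<cdot>) f\<rangle>\<close>. For simple
  functions \<open>\<sigma>\<close> the operators \<open>\<integral> \<sigma> dE\<close> are finite sums, \<open>\<sigma> \<mapsto> (\<integral> \<sigma> dE) f\<close> is isometric from \<open>L\<^sup>2(\<nu> f)\<close>, and all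
  other functions are reached by dominated convergence.
\<close>


section \<open>Semi-inner product spaces\<close>

text \<open>Functions that agree almost everywhere are not identified, so \<open>L\<^sup>2\<close> is a vector space with an
  inner product that may vanish on nonzero vectors. Two spaces of this kind are needed: subspaces
  of \<open>L\<^sup>2\<close>, and a form domain with its form inner product; hence the explicit carrier. Limits are
  unique only up to vectors of norm zero.\<close>
locale semi_inner_space = vector_space scale
  for scale :: "complex \<Rightarrow> 'v::ab_group_add \<Rightarrow> 'v" (infixr "*s" 75) +
  fixes H :: "'v set" and ip :: "'v \<Rightarrow> 'v \<Rightarrow> complex"
  assumes subspace_H: "subspace H"
    and ip_add_right: "x \<in> H \<Longrightarrow> y \<in> H \<Longrightarrow> z \<in> H \<Longrightarrow> ip x (y + z) = ip x y + ip x z"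
    and ip_scale_right: "x \<in> H \<Longrightarrow> y \<in> H \<Longrightarrow> ip x (c *s y) = c * ip x y"
    and ip_commute: "x \<in> H \<Longrightarrow> y \<in> H \<Longrightarrow> ip y x = cnj (ip x y)"
    and ip_self_nonneg: "x \<in> H \<Longrightarrow> 0 \<le> Re (ip x x)"
begin

definition nrm :: "'v \<Rightarrow> real" where
  "nrm x = sqrt (Re (ip x x))"

definition converges_to :: "(nat \<Rightarrow> 'v) \<Rightarrow> 'v \<Rightarrow> bool" where
  "converges_to f l \<longleftrightarrow> (\<lambda>n. nrm (f n - l)) \<longlonglongrightarrow> 0"

definition cauchy_seq :: "(nat \<Rightarrow> 'v) \<Rightarrow> bool" where
  "cauchy_seq f \<longleftrightarrow> (\<forall>e>0. \<exists>N. \<forall>m\<ge>N. \<forall>n\<ge>N. nrm (f m - f n) < e)"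

lemma H_closed [simp, intro]:
  "0 \<in> H" "x \<in> H \<Longrightarrow> y \<in> H \<Longrightarrow> x + y \<in> H" "x \<in> H \<Longrightarrow> c *s x \<in> H"
  "x \<in> H \<Longrightarrow> y \<in> H \<Longrightarrow> x - y \<in> H" "x \<in> H \<Longrightarrow> - x \<in> H"
  using subspace_H by (auto simp: subspace_0 subspace_add subspace_scale subspace_diff subspace_neg)

lemma H_sum [intro]: "(\<And>i. i \<in> I \<Longrightarrow> f i \<in> H) \<Longrightarrow> sum f I \<in> H"
  using subspace_H by (rule subspace_sum)

lemma ip_add_left: "x \<in> H \<Longrightarrow> y \<in> H \<Longrightarrow> z \<in> H \<Longrightarrow> ip (x + y) z = ip x z + ip y z"
  by (metis H_closed(2) complex_cnj_add ip_add_right ip_commute)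

lemma ip_scale_left: "x \<in> H \<Longrightarrow> y \<in> H \<Longrightarrow> ip (c *s x) y = cnj c * ip x y"
  by (metis H_closed(3) complex_cnj_mult ip_scale_right ip_commute)

lemma ip_minus_right: "x \<in> H \<Longrightarrow> y \<in> H \<Longrightarrow> ip x (- y) = - ip x y"
  using ip_scale_right[of x y "-1"] by (simp add: scale_minus_left)

lemma ip_minus_left: "x \<in> H \<Longrightarrow> y \<in> H \<Longrightarrow> ip (- x) y = - ip x y"
  using ip_scale_left[of x y "-1"] by (simp add: scale_minus_left)

lemma ip_diff_right: "x \<in> H \<Longrightarrow> y \<in> H \<Longrightarrow> z \<in> H \<Longrightarrow> ip x (y - z) = ip x y - ip x z"
  using ip_add_right[of x y "-z"] by (simp add: ip_minus_right)

lemma ip_diff_left: "x \<in> H \<Longrightarrow> y \<in> H \<Longrightarrow> z \<in> H \<Longrightarrow> ip (x - y) z = ip x z - ip y z"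
  using ip_add_left[of x "-y" z] by (simp add: ip_minus_left)

lemma ip_zero [simp]: "x \<in> H \<Longrightarrow> ip x 0 = 0"
  using ip_scale_right[of x 0 0] by simp

lemma ip_sum_right: "x \<in> H \<Longrightarrow> (\<And>i. i \<in> I \<Longrightarrow> f i \<in> H) \<Longrightarrow> ip x (sum f I) = (\<Sum>i\<in>I. ip x (f i))"
proof (induction I rule: infinite_finite_induct)
  case (insert i I)
  then have "sum f I \<in> H" by (intro H_sum) auto
  with insert show ?case by (simp add: ip_add_right)
qed simp_all

lemma ip_sum_left: "x \<in> H \<Longrightarrow> (\<And>i. i \<in> I \<Longrightarrow> f i \<in> H) \<Longrightarrow> ip (sum f I) x = (\<Sum>i\<in>I. ip (f i) x)"
  using ip_sum_right[of x I f] ip_commute[of x "sum f I"] H_sum[of I f] ip_commute[of x]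
  by simp

lemma ip_self_real: "x \<in> H \<Longrightarrow> ip x x = complex_of_real (Re (ip x x))"
  using ip_commute[of x x] by (simp add: complex_eq_iff)

lemma nrm_nonneg [simp]: "x \<in> H \<Longrightarrow> 0 \<le> nrm x"
  by (simp add: nrm_def ip_self_nonneg)

lemma nrm_sq: "x \<in> H \<Longrightarrow> (nrm x)\<^sup>2 = Re (ip x x)"
  by (simp add: nrm_def ip_self_nonneg)

lemma ip_self: "x \<in> H \<Longrightarrow> ip x x = complex_of_real ((nrm x)\<^sup>2)"
  using ip_self_real nrm_sq by metis

lemma nrm_zero [simp]: "nrm 0 = 0"
  by (simp add: nrm_def)

lemma nrm_sq_add:
  "x \<in> H \<Longrightarrow> y \<in> H \<Longrightarrow> (nrm (x + y))\<^sup>2 = (nrm x)\<^sup>2 + 2 * Re (ip x y) + (nrm y)\<^sup>2"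
  by (simp add: nrm_sq ip_add_left ip_add_right ip_commute[of x y])

lemma nrm_sq_diff:
  "x \<in> H \<Longrightarrow> y \<in> H \<Longrightarrow> (nrm (x - y))\<^sup>2 = (nrm x)\<^sup>2 - 2 * Re (ip x y) + (nrm y)\<^sup>2"
  by (simp add: nrm_sq ip_diff_left ip_diff_right ip_commute[of x y])

lemma nrm_scale: "x \<in> H \<Longrightarrow> nrm (c *s x) = cmod c * nrm x"
proof -
  assume x: "x \<in> H"
  have "ip (c *s x) (c *s x) = complex_of_real ((cmod c)\<^sup>2 * (nrm x)\<^sup>2)"
    using x ip_self[OF x] by (simp add: ip_scale_left ip_scale_right complex_norm_square mult_ac del: of_real_power)
  then have "Re (ip (c *s x) (c *s x)) = (cmod c * nrm x)\<^sup>2"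
    by (metis Re_complex_of_real power_mult_distrib)
  then show ?thesis
    using x by (simp add: nrm_def[of "c *s x"])
qed

lemma nrm_minus: "x \<in> H \<Longrightarrow> nrm (- x) = nrm x"
  using nrm_scale[of x "-1"] by (simp add: scale_minus_left)

lemma nrm_diff_commute: "x \<in> H \<Longrightarrow> y \<in> H \<Longrightarrow> nrm (x - y) = nrm (y - x)"
  using nrm_minus[of "x - y"] by simp

lemma parallelogram:
  "x \<in> H \<Longrightarrow> y \<in> H \<Longrightarrow> (nrm (x + y))\<^sup>2 + (nrm (x - y))\<^sup>2 = 2 * (nrm x)\<^sup>2 + 2 * (nrm y)\<^sup>2"
  by (simp add: nrm_sq_add nrm_sq_diff)

text \<open>The form may be degenerate, so the usual choice of the multiplier, which divides by the norm
  of \<open>y\<close>, is only available when that norm is positive; otherwise an arbitrarily large multiplier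
  forces the inner product to vanish.\<close>
lemma Cauchy_Schwarz:
  assumes x: "x \<in> H" and y: "y \<in> H"
  shows "cmod (ip x y) \<le> nrm x * nrm y"
proof -
  define b where "b = ip x y"
  have key: "0 \<le> (nrm x)\<^sup>2 - 2 * s * (cmod b)\<^sup>2 + s\<^sup>2 * (cmod b)\<^sup>2 * (nrm y)\<^sup>2" for s :: real
  proof -
    define t where "t = - complex_of_real s * cnj b"
    have "0 \<le> (nrm (x + t *s y))\<^sup>2" by simp
    also have "\<dots> = (nrm x)\<^sup>2 + 2 * Re (t * b) + (cmod t * nrm y)\<^sup>2"
      using x y by (simp add: nrm_sq_add nrm_scale ip_scale_right b_def)
    also have "Re (t * b) = - s * (cmod b)\<^sup>2"
    proof -
      have "t * b = - complex_of_real (s * (cmod b)\<^sup>2)"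
        by (simp add: t_def complex_norm_square mult_ac del: of_real_power)
      then show ?thesis by (metis Re_complex_of_real mult_minus_left of_real_minus)
    qed
    also have "(cmod t * nrm y)\<^sup>2 = s\<^sup>2 * (cmod b)\<^sup>2 * (nrm y)\<^sup>2"
      by (simp add: t_def norm_mult power_mult_distrib)
    finally show ?thesis by simp
  qed
  have "(cmod b)\<^sup>2 \<le> (nrm x)\<^sup>2 * (nrm y)\<^sup>2"
  proof (cases "nrm y = 0")
    case True
    have "cmod b = 0"
    proof (rule ccontr)
      assume "cmod b \<noteq> 0"
      then show False
        using key[of "((nrm x)\<^sup>2 + 1) / (2 * (cmod b)\<^sup>2)"] True by (simp add: field_simps)
    qed
    then show ?thesis by simp
  next
    case False
    then have pos: "(nrm y)\<^sup>2 > 0" by simp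
    have "2 * (1 / (nrm y)\<^sup>2) * (cmod b)\<^sup>2 - (1 / (nrm y)\<^sup>2)\<^sup>2 * (cmod b)\<^sup>2 * (nrm y)\<^sup>2 = (cmod b)\<^sup>2 / (nrm y)\<^sup>2"
      using False by (simp add: field_simps power2_eq_square)
    then have "(cmod b)\<^sup>2 / (nrm y)\<^sup>2 \<le> (nrm x)\<^sup>2"
      using key[of "1 / (nrm y)\<^sup>2"] by simp
    then show ?thesis using pos by (simp add: pos_divide_le_eq)
  qed
  then show ?thesis
    using x y by (auto intro: power2_le_imp_le[of "cmod b" "nrm x * nrm y"] simp: power_mult_distrib simp flip: b_def)
qed

lemma nrm_triangle: "x \<in> H \<Longrightarrow> y \<in> H \<Longrightarrow> nrm (x + y) \<le> nrm x + nrm y"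
proof (rule power2_le_imp_le)
  assume x: "x \<in> H" and y: "y \<in> H"
  have "Re (ip x y) \<le> nrm x * nrm y"
    using Cauchy_Schwarz[OF x y] complex_Re_le_cmod order_trans by blast
  then show "(nrm (x + y))\<^sup>2 \<le> (nrm x + nrm y)\<^sup>2"
    using x y by (simp add: nrm_sq_add power2_sum)
qed simp

lemma nrm_triangle_diff: "x \<in> H \<Longrightarrow> y \<in> H \<Longrightarrow> nrm (x - y) \<le> nrm x + nrm y"
  using nrm_triangle[of x "- y"] by (simp add: nrm_minus)

lemma nrm_triangle3: "x \<in> H \<Longrightarrow> y \<in> H \<Longrightarrow> z \<in> H \<Longrightarrow> nrm (x - z) \<le> nrm (x - y) + nrm (y - z)"
  using nrm_triangle[of "x - y" "y - z"] by simp

lemma nrm_diff_abs: "x \<in> H \<Longrightarrow> y \<in> H \<Longrightarrow> \<bar>nrm x - nrm y\<bar> \<le> nrm (x - y)"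
  using nrm_triangle[of "x - y" y] nrm_triangle[of "y - x" x] nrm_diff_commute[of x y] by simp

lemma nrm_tendsto:
  assumes "\<And>n. f n \<in> H" "l \<in> H" "converges_to f l"
  shows "(\<lambda>n. nrm (f n)) \<longlonglongrightarrow> nrm l"
proof (rule Lim_null[THEN iffD2], rule Lim_null_comparison)
  show "\<forall>\<^sub>F n in sequentially. norm (nrm (f n) - nrm l) \<le> nrm (f n - l)"
    using nrm_diff_abs assms(1,2) by (intro always_eventually) simp
qed (use assms(3) in \<open>simp add: converges_to_def\<close>)

lemma ip_tendsto_right:
  assumes "\<And>n. f n \<in> H" "l \<in> H" "h \<in> H" "converges_to f l"
  shows "(\<lambda>n. ip h (f n)) \<longlonglongrightarrow> ip h l"
proof (rule Lim_null[THEN iffD2], rule Lim_null_comparison)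
  show "\<forall>\<^sub>F n in sequentially. norm (ip h (f n) - ip h l) \<le> nrm h * nrm (f n - l)"
  proof (intro always_eventually allI)
    fix n
    show "norm (ip h (f n) - ip h l) \<le> nrm h * nrm (f n - l)"
      using Cauchy_Schwarz[of h "f n - l"] assms(1)[of n] assms(2,3) by (simp add: ip_diff_right)
  qed
  show "(\<lambda>n. nrm h * nrm (f n - l)) \<longlonglongrightarrow> 0"
    using assms(4) unfolding converges_to_def by (rule tendsto_mult_right_zero)
qed


text \<open>Estimates of this shape come from the parallelogram identity and from isometries: the square of
  the distance of two members is bounded by the sum of their separate errors.\<close>
lemma cauchy_seqI:
  assumes f: "\<And>n. f n \<in> H" and le: "\<And>m n. (nrm (f m - f n))\<^sup>2 \<le> \<eta> m + \<eta> n" and \<eta>: "\<eta> \<longlonglongrightarrow> 0"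
  shows "cauchy_seq f"
  unfolding cauchy_seq_def
proof safe
  fix e :: real assume e: "e > 0"
  obtain N where N: "\<And>n. n \<ge> N \<Longrightarrow> \<bar>\<eta> n\<bar> < e\<^sup>2 / 2"
    using LIMSEQ_D[OF \<eta>, of "e\<^sup>2 / 2"] e by auto
  have "nrm (f m - f n) < e" if "m \<ge> N" "n \<ge> N" for m n
  proof -
    have "(nrm (f m - f n))\<^sup>2 < e\<^sup>2"
      using le[of m n] N[OF that(1)] N[OF that(2)] by linarith
    then show ?thesis using e by (auto intro: power_less_imp_less_base)
  qed
  then show "\<exists>N. \<forall>m\<ge>N. \<forall>n\<ge>N. nrm (f m - f n) < e" by blast
qed

lemma converges_to_imp_cauchy_seq:
  assumes "\<And>n. f n \<in> H" "l \<in> H" "converges_to f l"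
  shows "cauchy_seq f"
proof (rule cauchy_seqI[OF assms(1)])
  fix m n
  show "(nrm (f m - f n))\<^sup>2 \<le> 2 * (nrm (f m - l))\<^sup>2 + 2 * (nrm (f n - l))\<^sup>2"
    using parallelogram[OF H_closed(4)[OF assms(1,2)] H_closed(4)[OF assms(1,2)], of m n]
      zero_le_power2[of "nrm ((f m - l) + (f n - l))"]
    unfolding diff_diff_eq2 diff_add_cancel by linarith
next
  show "(\<lambda>n. 2 * (nrm (f n - l))\<^sup>2) \<longlonglongrightarrow> 0"
    using assms(3) unfolding converges_to_def
    by (intro tendsto_mult_right_zero tendsto_null_power) simp_all
qed

lemma ip_all_zero_imp_nrm_zero: "x \<in> H \<Longrightarrow> (\<And>h. h \<in> H \<Longrightarrow> ip h x = 0) \<Longrightarrow> nrm x = 0"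
  by (simp add: nrm_def)

lemma nrm_sq_sum_orthonormal:
  assumes "finite I" "\<And>i. i \<in> I \<Longrightarrow> e i \<in> H"
    "\<And>i j. i \<in> I \<Longrightarrow> j \<in> I \<Longrightarrow> ip (e i) (e j) = (if i = j then 1 else 0)"
  shows "(nrm (\<Sum>i\<in>I. c i *s e i))\<^sup>2 = (\<Sum>i\<in>I. (cmod (c i))\<^sup>2)"
proof -
  have "ip (\<Sum>i\<in>I. c i *s e i) (\<Sum>j\<in>I. c j *s e j) = (\<Sum>i\<in>I. \<Sum>j\<in>I. cnj (c i) * (c j * ip (e i) (e j)))"
    using assms(2)
    by (subst ip_sum_left) (auto simp: ip_sum_right ip_scale_left ip_scale_right H_sum sum_distrib_left intro!: sum.cong)
  also have "\<dots> = (\<Sum>i\<in>I. complex_of_real ((cmod (c i))\<^sup>2))"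
  proof (rule sum.cong[OF refl])
    fix i assume i: "i \<in> I"
    have "(\<Sum>j\<in>I. cnj (c i) * (c j * ip (e i) (e j))) = (\<Sum>j\<in>I. if i = j then cnj (c i) * c j else 0)"
      using assms(3) i by (intro sum.cong) auto
    also have "\<dots> = complex_of_real ((cmod (c i))\<^sup>2)"
      using i assms(1) by (simp add: complex_norm_square mult.commute del: of_real_power)
    finally show "(\<Sum>j\<in>I. cnj (c i) * (c j * ip (e i) (e j))) = complex_of_real ((cmod (c i))\<^sup>2)" .
  qed
  finally have "Re (ip (\<Sum>i\<in>I. c i *s e i) (\<Sum>j\<in>I. c j *s e j)) = (\<Sum>i\<in>I. (cmod (c i))\<^sup>2)"
    by simp
  then show ?thesis using assms(2) by (simp add: nrm_sq H_sum)
qed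

lemma ip_sum_orthonormal:
  assumes "finite I" "\<And>i. i \<in> I \<Longrightarrow> e i \<in> H" "j \<in> I"
    "\<And>i j. i \<in> I \<Longrightarrow> j \<in> I \<Longrightarrow> ip (e i) (e j) = (if i = j then 1 else 0)"
  shows "ip (e j) (\<Sum>i\<in>I. c i *s e i) = c j"
proof -
  have "ip (e j) (\<Sum>i\<in>I. c i *s e i) = (\<Sum>i\<in>I. c i * ip (e j) (e i))"
    using assms(2,3) by (simp add: ip_sum_right ip_scale_right)
  also have "\<dots> = (\<Sum>i\<in>I. if j = i then c i else 0)"
    using assms(3,4) by (intro sum.cong) auto
  finally show ?thesis using assms(1,3) by simp
qed

end

locale semi_hilbert_space = semi_inner_space +
  assumes complete_H: "(\<And>n. f n \<in> H) \<Longrightarrow> cauchy_seq f \<Longrightarrow> \<exists>l\<in>H. converges_to f l"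
begin

text \<open>The representing vector minimizes \<open>J x = \<parallel>x\<parallel>\<^sup>2 - 2 Re (F x)\<close>: the parallelogram law makes minimizing
  sequences Cauchy, and the first variation of \<open>J\<close> at the minimum is the claim. Applied to a closed
  subspace of a larger space, the lemma yields the orthogonal projection.\<close>
lemma Riesz_representation:
  assumes add: "\<And>x y. x \<in> H \<Longrightarrow> y \<in> H \<Longrightarrow> F (x + y) = F x + F y"
    and sc: "\<And>c x. x \<in> H \<Longrightarrow> F (c *s x) = cnj c * F x"
    and bd: "\<And>x. x \<in> H \<Longrightarrow> cmod (F x) \<le> C * nrm x"
  shows "\<exists>f\<in>H. \<forall>h\<in>H. F h = ip h f"
proof -
  define J where "J x = (nrm x)\<^sup>2 - 2 * Re (F x)" for x
  have F_le: "\<bar>Re (F x)\<bar> \<le> C * nrm x" if "x \<in> H" for x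
    using bd[OF that] abs_Re_le_cmod order_trans by blast
  have J_ge: "- C\<^sup>2 \<le> J x" if "x \<in> H" for x
  proof -
    have "0 \<le> (nrm x - C)\<^sup>2" by simp
    also have "\<dots> = (nrm x)\<^sup>2 - 2 * (C * nrm x) + C\<^sup>2" by (simp add: power2_diff)
    also have "\<dots> \<le> J x + C\<^sup>2" using F_le[OF that] by (simp add: J_def)
    finally show ?thesis by simp
  qed
  have bb: "bdd_below (J ` H)" using J_ge by (intro bdd_belowI2) auto
  define m where "m = Inf (J ` H)"
  have m_le: "m \<le> J x" if "x \<in> H" for x
    unfolding m_def using bb that by (simp add: cInf_lower)
  have "\<exists>x\<in>H. J x < m + 1 / Suc n" for n
    using cInf_lessD[of "J ` H" "m + 1 / Suc n"] H_closed(1) unfolding m_def by force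
  then obtain f where f: "\<And>n. f n \<in> H" and Jf: "\<And>n. J (f n) < m + 1 / Suc n"
    by metis
  have Jmid: "(nrm (x - y))\<^sup>2 \<le> 2 * (J x - m) + 2 * (J y - m)" if "x \<in> H" "y \<in> H" for x y
  proof -
    define w where "w = (1/2) *s (x + y)"
    have w: "w \<in> H" using that by (simp add: w_def)
    have "(nrm w)\<^sup>2 = (nrm (x + y))\<^sup>2 / 4"
      using that by (simp add: w_def nrm_scale power_divide)
    moreover have "Re (F w) = (Re (F x) + Re (F y)) / 2"
      using that by (simp add: w_def sc add)
    ultimately have "4 * J w = 2 * J x + 2 * J y - (nrm (x - y))\<^sup>2"
      using parallelogram[OF that] by (simp add: J_def)
    then show ?thesis using m_le[OF w] by simp
  qed
  have "cauchy_seq f"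
  proof (rule cauchy_seqI[OF f])
    show "(nrm (f m - f n))\<^sup>2 \<le> 2 * inverse (real (Suc m)) + 2 * inverse (real (Suc n))" for m n
      using Jmid[OF f[of m] f[of n]] Jf[of m] Jf[of n] by (simp add: inverse_eq_divide)
    show "(\<lambda>n. 2 * inverse (real (Suc n))) \<longlonglongrightarrow> 0"
      by (rule tendsto_mult_right_zero[OF LIMSEQ_inverse_real_of_nat])
  qed
  then obtain l where l: "l \<in> H" "converges_to f l" using complete_H f by blast
  have Fdiff: "F (x - y) = F x - F y" if "x \<in> H" "y \<in> H" for x y
    using add[of x "(-1) *s y"] sc[of y "-1"] that by (simp add: scale_minus_left)
  have "(\<lambda>n. Re (F (f n)) - Re (F l)) \<longlonglongrightarrow> 0"
  proof (rule Lim_null_comparison)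
    show "\<forall>\<^sub>F n in sequentially. norm (Re (F (f n)) - Re (F l)) \<le> C * nrm (f n - l)"
      using F_le[OF H_closed(4)[OF f l(1)]] Fdiff[OF f l(1)] by (intro always_eventually) simp
    show "(\<lambda>n. C * nrm (f n - l)) \<longlonglongrightarrow> 0"
      using l(2) unfolding converges_to_def by (rule tendsto_mult_right_zero)
  qed
  then have "(\<lambda>n. Re (F (f n))) \<longlonglongrightarrow> Re (F l)" by (rule Lim_null[THEN iffD2])
  then have "(\<lambda>n. J (f n)) \<longlonglongrightarrow> J l"
    unfolding J_def using nrm_tendsto[OF f l] by (intro tendsto_diff tendsto_mult tendsto_power tendsto_const)
  moreover have "(\<lambda>n. J (f n)) \<longlonglongrightarrow> m"
  proof (rule tendsto_sandwich)
    show "\<forall>\<^sub>F n in sequentially. m \<le> J (f n)" using m_le f by simp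
    show "\<forall>\<^sub>F n in sequentially. J (f n) \<le> m + 1 / Suc n" using Jf less_imp_le by (intro always_eventually allI) blast
    show "(\<lambda>n. m + 1 / Suc n) \<longlonglongrightarrow> m"
      using tendsto_add[OF tendsto_const[of m] LIMSEQ_inverse_real_of_nat] by (simp add: inverse_eq_divide)
  qed simp
  ultimately have Jl: "J l = m" using LIMSEQ_unique by blast
  \<comment> \<open>The Euler-Lagrange equation at the minimizer, tested in the direction \<open>t h\<close>.\<close>
  have real_zero: "Re (cnj c * (ip h l - F h)) = 0" if h: "h \<in> H" for h c
  proof -
    define g where "g = c *s h"
    have g: "g \<in> H" using h by (simp add: g_def)
    define b where "b = Re (ip g l - F g)"
    have "0 \<le> 2 * t * b + t\<^sup>2 * (nrm g)\<^sup>2" for t :: real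
    proof -
      have "(nrm (l + complex_of_real t *s g))\<^sup>2 = (nrm l)\<^sup>2 + 2 * t * Re (ip g l) + t\<^sup>2 * (nrm g)\<^sup>2"
        using g l(1) ip_commute[OF g l(1)]
        by (simp add: nrm_sq_add ip_scale_right nrm_scale power_mult_distrib)
      moreover have "Re (F (l + complex_of_real t *s g)) = Re (F l) + t * Re (F g)"
        using g l(1) by (simp add: add sc)
      ultimately have "J (l + complex_of_real t *s g) = J l + 2 * t * b + t\<^sup>2 * (nrm g)\<^sup>2"
        by (simp add: J_def b_def algebra_simps)
      moreover have "m \<le> J (l + complex_of_real t *s g)" using g l(1) by (intro m_le) auto
      ultimately show ?thesis using Jl by simp
    qed
    note q = this
    have "b = 0"
    proof (rule ccontr)
      assume b: "b \<noteq> 0"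
      define s where "s = 1 / ((nrm g)\<^sup>2 + 1)"
      have pos: "(nrm g)\<^sup>2 + 1 > 0" by (simp add: add_nonneg_pos)
      have "0 \<le> 2 * (- b * s) * b + (- b * s)\<^sup>2 * (nrm g)\<^sup>2" by (rule q)
      also have "\<dots> = b\<^sup>2 * s * (s * (nrm g)\<^sup>2 - 2)" by (simp add: power2_eq_square algebra_simps)
      also have "\<dots> < 0"
      proof -
        have "s * (nrm g)\<^sup>2 < 2" using pos by (simp add: s_def field_simps add_strict_increasing)
        moreover have "b\<^sup>2 * s > 0" using b pos by (simp add: s_def)
        ultimately show ?thesis by (simp add: mult_pos_neg)
      qed
      finally show False by simp
    qed
    then show ?thesis using h l(1) by (simp add: b_def g_def sc ip_scale_left algebra_simps)
  qed
  have "F h = ip h l" if h: "h \<in> H" for h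
    using real_zero[OF h, of 1] real_zero[OF h, of \<i>] by (simp add: complex_eq_iff)
  then show ?thesis using l(1) by blast
qed

text \<open>The Baire category theorem for a countable closed cover: if no member contained a ball, nested
  balls avoiding them one after the other would shrink to a point that none of them covers.\<close>
lemma Baire_ball:
  assumes sub: "\<And>n. B n \<subseteq> H" and cover: "H \<subseteq> (\<Union>n::nat. B n)"
    and closed: "\<And>n f l. (\<And>k. f k \<in> B n) \<Longrightarrow> l \<in> H \<Longrightarrow> converges_to f l \<Longrightarrow> l \<in> B n"
  shows "\<exists>n. \<exists>x\<in>H. \<exists>r>0. \<forall>y\<in>H. nrm (y - x) < r \<longrightarrow> y \<in> B n"
proof (rule ccontr)
  assume neg: "\<not> ?thesis"
  define good where "good n x r \<longleftrightarrow> x \<in> H \<and> r > 0 \<and> r \<le> 1 / real (Suc n)" for n x and r :: real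
  have step: "\<exists>y s. good (Suc n) y s \<and>
      (\<forall>z\<in>H. nrm (z - y) \<le> s \<longrightarrow> nrm (z - x) \<le> r \<and> z \<notin> B n)" if g: "good n x r" for n x r
  proof -
    have x: "x \<in> H" and r: "r > 0" using g by (auto simp: good_def)
    obtain y where y: "y \<in> H" "nrm (y - x) < r" "y \<notin> B n" using neg x r by blast
    have "\<exists>s>0. \<forall>z\<in>H. nrm (z - y) \<le> s \<longrightarrow> z \<notin> B n"
    proof (rule ccontr)
      assume "\<not> ?thesis"
      then have "\<forall>k. \<exists>z\<in>H. nrm (z - y) \<le> 1 / real (Suc k) \<and> z \<in> B n"
        by (metis of_nat_0_less_iff zero_less_Suc zero_less_divide_1_iff)
      then obtain z where z: "\<And>k. z k \<in> H" "\<And>k. nrm (z k - y) \<le> 1 / real (Suc k)" "\<And>k. z k \<in> B n"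
        by metis
      have "converges_to z y" unfolding converges_to_def
      proof (rule Lim_null_comparison)
        show "\<forall>\<^sub>F k in sequentially. norm (nrm (z k - y)) \<le> inverse (real (Suc k))"
          using z y(1) by (auto simp: inverse_eq_divide)
      qed (rule LIMSEQ_inverse_real_of_nat)
      then have "y \<in> B n" using closed z(3) y(1) by blast
      then show False using y(3) by simp
    qed
    then obtain s where s: "s > 0" "\<And>z. z \<in> H \<Longrightarrow> nrm (z - y) \<le> s \<Longrightarrow> z \<notin> B n" by blast
    define t where "t = min s (min (r - nrm (y - x)) (1 / real (Suc (Suc n))))"
    have "good (Suc n) y t" using s(1) y by (simp add: good_def t_def)
    moreover have "nrm (z - x) \<le> r" if "z \<in> H" "nrm (z - y) \<le> t" for z
      using nrm_triangle3[of z y x] that x y(1) by (simp add: t_def)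
    ultimately show ?thesis using s(2) by (intro exI[of _ y] exI[of _ t]) (auto simp: t_def)
  qed
  have "\<exists>F. \<forall>n. good n (fst (F n)) (snd (F n)) \<and>
      (\<forall>z\<in>H. nrm (z - fst (F (Suc n))) \<le> snd (F (Suc n)) \<longrightarrow> nrm (z - fst (F n)) \<le> snd (F n) \<and> z \<notin> B n)"
  proof (rule dependent_nat_choice)
    show "\<exists>p. good 0 (fst p) (snd p)" by (intro exI[of _ "(0, 1)"]) (simp add: good_def)
  next
    fix p n assume "good n (fst p) (snd p)"
    from step[OF this] obtain y s where "good (Suc n) y s"
      "\<forall>z\<in>H. nrm (z - y) \<le> s \<longrightarrow> nrm (z - fst p) \<le> snd p \<and> z \<notin> B n" by blast
    then show "\<exists>p'. good (Suc n) (fst p') (snd p') \<and>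
       (\<forall>z\<in>H. nrm (z - fst p') \<le> snd p' \<longrightarrow> nrm (z - fst p) \<le> snd p \<and> z \<notin> B n)"
      by (intro exI[of _ "(y, s)"]) simp
  qed
  then obtain F where F: "\<And>n. good n (fst (F n)) (snd (F n))"
    "\<And>n z. z \<in> H \<Longrightarrow> nrm (z - fst (F (Suc n))) \<le> snd (F (Suc n)) \<Longrightarrow> nrm (z - fst (F n)) \<le> snd (F n) \<and> z \<notin> B n"
    by blast
  define x r where "x n = fst (F n)" and "r n = snd (F n)" for n
  have x: "x n \<in> H" and r: "r n > 0" "r n \<le> 1 / real (Suc n)" for n
    using F(1)[of n] by (auto simp: good_def x_def r_def)
  have nest: "nrm (z - x n) \<le> r n" if "z \<in> H" "nrm (z - x (n + k)) \<le> r (n + k)" for z n k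
    using that
  proof (induction k)
    case (Suc k)
    then show ?case using F(2)[of z "n + k"] by (simp add: x_def r_def)
  qed simp
  have in_ball: "nrm (x m - x n) \<le> r n" if "m \<ge> n" for m n
    using nest[of "x m" n "m - n"] that x[of m] r(1)[of m] by simp
  have "cauchy_seq x" unfolding cauchy_seq_def
  proof safe
    fix e :: real assume e: "e > 0"
    obtain N where N: "2 / e < real N" using reals_Archimedean2 by blast
    then have N': "2 / real (Suc N) < e" using e by (simp add: field_simps add_pos_nonneg)
    have "nrm (x m - x n) < e" if "m \<ge> N" "n \<ge> N" for m n
    proof -
      have "nrm (x m - x n) \<le> nrm (x m - x N) + nrm (x N - x n)"
        using nrm_triangle3[of "x m" "x N" "x n"] x by simp
      also have "\<dots> \<le> r N + r N" using in_ball[OF that(1)] in_ball[OF that(2)] nrm_diff_commute[of "x N"] x by fastforce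
      also have "\<dots> < e" using r(2)[of N] N' by simp
      finally show ?thesis .
    qed
    then show "\<exists>N. \<forall>m\<ge>N. \<forall>n\<ge>N. nrm (x m - x n) < e" by blast
  qed
  then obtain l where l: "l \<in> H" "converges_to x l" using complete_H x by blast
  have "nrm (l - x n) \<le> r n" for n
  proof (rule LIMSEQ_le_const2)
    show "(\<lambda>m. nrm (x m - x n)) \<longlonglongrightarrow> nrm (l - x n)"
      using l x by (intro nrm_tendsto) (auto simp: converges_to_def algebra_simps)
    show "\<exists>N. \<forall>m\<ge>N. nrm (x m - x n) \<le> r n" using in_ball by blast
  qed
  then have "l \<notin> B n" for n
    using F(2)[OF l(1), of n] by (simp add: x_def r_def)
  then show False using cover l(1) by blast
qed

end

section \<open>Square-integrable functions\<close>

definition cscale :: "complex \<Rightarrow> ('a \<Rightarrow> complex) \<Rightarrow> 'a \<Rightarrow> complex" where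
  "cscale c f = (\<lambda>x. c * f x)"

lemma cscale_apply [simp]: "cscale c f x = c * f x"
  by (simp add: cscale_def)

interpretation fun_vs: vector_space "cscale :: complex \<Rightarrow> ('a \<Rightarrow> complex) \<Rightarrow> _"
  by unfold_locales (auto simp: cscale_def fun_eq_iff algebra_simps)

lemma sum_fun_apply: "(\<Sum>i\<in>I. f i) x = (\<Sum>i\<in>I. f i x)" for f :: "'i \<Rightarrow> 'a \<Rightarrow> complex"
  by (induction I rule: infinite_finite_induct) auto

lemma L2_measurable [measurable_dest]: "f \<in> L2 M \<Longrightarrow> f \<in> borel_measurable M"
  by (simp add: L2_def)

lemma L2_integrable: "f \<in> L2 M \<Longrightarrow> integrable M (\<lambda>x. (norm (f x))\<^sup>2)"
  by (simp add: L2_def)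

lemma L2_I: "f \<in> borel_measurable M \<Longrightarrow> integrable M (\<lambda>x. (norm (f x))\<^sup>2) \<Longrightarrow> f \<in> L2 M"
  by (simp add: L2_def)

lemma L2_add: assumes f: "f \<in> L2 M" and g: "g \<in> L2 M" shows "f + g \<in> L2 M"
proof (rule L2_I)
  show "f + g \<in> borel_measurable M"
    using L2_measurable[OF f] L2_measurable[OF g] by (simp add: plus_fun_def)
  have le: "norm (a + b) ^ 2 \<le> 2 * norm a ^ 2 + 2 * norm b ^ 2" for a b :: complex
  proof -
    have "norm (a + b) ^ 2 \<le> (norm a + norm b) ^ 2" by (simp add: norm_triangle_ineq power_mono)
    also have "\<dots> \<le> 2 * norm a ^ 2 + 2 * norm b ^ 2"
      using sum_squares_bound[of "norm a" "norm b"] by (simp add: power2_sum)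
    finally show ?thesis .
  qed
  show "integrable M (\<lambda>x. (norm ((f + g) x))\<^sup>2)"
  proof (rule Bochner_Integration.integrable_bound)
    show "integrable M (\<lambda>x. 2 * (norm (f x))\<^sup>2 + 2 * (norm (g x))\<^sup>2)"
      using L2_integrable[OF f] L2_integrable[OF g] by simp
    show "(\<lambda>x. (norm ((f + g) x))\<^sup>2) \<in> borel_measurable M"
      using L2_measurable[OF f] L2_measurable[OF g] by simp
    show "AE x in M. norm ((norm ((f + g) x))\<^sup>2) \<le> norm (2 * (norm (f x))\<^sup>2 + 2 * (norm (g x))\<^sup>2)"
    proof (rule AE_I2)
      fix x
      show "norm ((norm ((f + g) x))\<^sup>2) \<le> norm (2 * (norm (f x))\<^sup>2 + 2 * (norm (g x))\<^sup>2)"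
        using le[of "f x" "g x"] by simp
    qed
  qed
qed

lemma L2_cscale: "f \<in> L2 M \<Longrightarrow> cscale c f \<in> L2 M"
  by (auto simp: L2_def cscale_def norm_mult power_mult_distrib)

lemma L2_subspace: "fun_vs.subspace (L2 M)"
  by (rule fun_vs.subspaceI) (auto simp: L2_add L2_cscale, simp add: L2_def zero_fun_def)

lemma borel_measurable_cnj: "f \<in> borel_measurable M \<Longrightarrow> (\<lambda>x. cnj (f x)) \<in> borel_measurable M"
  by (rule measurable_compose[OF _ borel_measurable_continuous_onI]) (auto intro: continuous_intros)

lemma L2_mult_integrable:
  assumes f: "f \<in> L2 M" and g: "g \<in> L2 M" shows "integrable M (\<lambda>x. cnj (f x) * g x)"
proof (rule Bochner_Integration.integrable_bound)
  show "integrable M (\<lambda>x. (norm (f x))\<^sup>2 + (norm (g x))\<^sup>2)"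
    using f g by (simp add: L2_integrable)
  show "(\<lambda>x. cnj (f x) * g x) \<in> borel_measurable M"
    using L2_measurable[OF f] L2_measurable[OF g] by (intro borel_measurable_times borel_measurable_cnj)
  show "AE x in M. norm (cnj (f x) * g x) \<le> norm ((norm (f x))\<^sup>2 + (norm (g x))\<^sup>2)"
  proof (rule AE_I2)
    fix x
    have "norm (f x) * norm (g x) \<le> (norm (f x))\<^sup>2 + (norm (g x))\<^sup>2"
      using sum_squares_bound[of "norm (f x)" "norm (g x)"]
        mult_nonneg_nonneg[OF norm_ge_zero[of "f x"] norm_ge_zero[of "g x"]]
      unfolding mult.assoc by linarith
    then show "norm (cnj (f x) * g x) \<le> norm ((norm (f x))\<^sup>2 + (norm (g x))\<^sup>2)"
      by (simp add: norm_mult)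
  qed
qed

lemma l2_inner_self: "l2_inner M f f = complex_of_real (LINT x|M. (norm (f x))\<^sup>2)"
proof -
  have "(\<lambda>x. cnj (f x) * f x) = (\<lambda>x. complex_of_real ((norm (f x))\<^sup>2))"
    by (simp add: fun_eq_iff complex_norm_square mult.commute del: of_real_power)
  then show ?thesis by (simp only: l2_inner_def integral_complex_of_real)
qed

lemma nrm_eq_l2_norm: "semi_inner_space.nrm (l2_inner M) = l2_norm M" if "semi_inner_space sc H (l2_inner M)"
  using that by (simp add: fun_eq_iff semi_inner_space.nrm_def[OF that] l2_norm_def l2_inner_self)

lemma semi_inner_L2_subset:
  assumes sub: "fun_vs.subspace H" and H: "H \<subseteq> L2 M"
  shows "semi_inner_space cscale H (l2_inner M)"
proof (unfold_locales, rule sub)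
  fix f g h :: "'a \<Rightarrow> complex" and c assume "f \<in> H" "g \<in> H"
  then have f: "f \<in> L2 M" and g: "g \<in> L2 M" using H by auto
  show "l2_inner M f (cscale c g) = c * l2_inner M f g"
  proof -
    have "(\<lambda>x. cnj (f x) * (cscale c g) x) = (\<lambda>x. c * (cnj (f x) * g x))"
      by (auto simp: fun_eq_iff)
    then show ?thesis by (simp add: l2_inner_def)
  qed
  show "l2_inner M g f = cnj (l2_inner M f g)"
  proof -
    have "(\<lambda>x. cnj (g x) * f x) = (\<lambda>x. cnj (cnj (f x) * g x))" by (simp add: fun_eq_iff)
    then show ?thesis by (simp only: l2_inner_def Bochner_Integration.integral_cnj)
  qed
  show "0 \<le> Re (l2_inner M f f)"
    by (simp add: l2_inner_self)
  assume "h \<in> H"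
  then have h: "h \<in> L2 M" using H by auto
  show "l2_inner M f (g + h) = l2_inner M f g + l2_inner M f h"
    using L2_mult_integrable[OF f g] L2_mult_integrable[OF f h]
    by (simp add: l2_inner_def distrib_left)
qed

lemma l2_norm_sq: "(l2_norm M f)\<^sup>2 = (LINT x|M. (norm (f x))\<^sup>2)"
  by (simp add: l2_norm_def)

lemma l2_norm_nonneg [simp]: "0 \<le> l2_norm M f"
  by (simp add: l2_norm_def)

lemma l2_norm_nn_integral:
  "f \<in> L2 M \<Longrightarrow> (\<integral>\<^sup>+x. ennreal ((norm (f x))\<^sup>2) \<partial>M) = ennreal ((l2_norm M f)\<^sup>2)"
  by (simp add: l2_norm_sq nn_integral_eq_integral[OF L2_integrable])

text \<open>Fatou's lemma transfers a bound on the distances from \<open>g\<close> to an almost everywhere limit.\<close>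
lemma l2_limit_of_AE_limit:
  assumes f: "\<And>n. f n \<in> L2 M" and l [measurable]: "l \<in> borel_measurable M" and g: "g \<in> L2 M"
    and lim: "AE x in M. (\<lambda>n. f n x) \<longlonglongrightarrow> l x"
    and bd: "\<And>n. n \<ge> N \<Longrightarrow> l2_norm M (g - f n) \<le> e" and sub: "\<And>n. g - f n \<in> L2 M"
  shows "g - l \<in> L2 M \<and> l2_norm M (g - l) \<le> e"
proof -
  note [measurable] = L2_measurable[OF f] L2_measurable[OF g]
  have e: "0 \<le> e" using bd[of N] order_trans[of 0 "l2_norm M (g - f N)" e] by (simp add: l2_norm_def)
  have "(\<integral>\<^sup>+x. ennreal ((norm ((g - l) x))\<^sup>2) \<partial>M) = (\<integral>\<^sup>+x. liminf (\<lambda>n. ennreal ((norm (g x - f n x))\<^sup>2)) \<partial>M)"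
  proof (rule nn_integral_cong_AE, use lim in eventually_elim)
    case (elim x)
    have "(\<lambda>n. ennreal ((norm (g x - f n x))\<^sup>2)) \<longlonglongrightarrow> ennreal ((norm (g x - l x))\<^sup>2)"
      using elim by (intro tendsto_ennrealI tendsto_intros)
    then show ?case using lim_imp_Liminf[OF sequentially_bot] by fastforce
  qed
  also have "\<dots> \<le> liminf (\<lambda>n. \<integral>\<^sup>+x. ennreal ((norm (g x - f n x))\<^sup>2) \<partial>M)"
    by (rule nn_integral_liminf) measurable
  also have "\<dots> \<le> ennreal (e\<^sup>2)"
  proof (rule Liminf_le)
    show "\<forall>\<^sub>F n in sequentially. (\<integral>\<^sup>+x. ennreal ((norm (g x - f n x))\<^sup>2) \<partial>M) \<le> ennreal (e\<^sup>2)"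
    proof (rule eventually_sequentiallyI)
      fix n assume "n \<ge> N"
      then have "(l2_norm M (g - f n))\<^sup>2 \<le> e\<^sup>2"
        using bd by (intro power_mono) (auto simp: l2_norm_def)
      then show "(\<integral>\<^sup>+x. ennreal ((norm (g x - f n x))\<^sup>2) \<partial>M) \<le> ennreal (e\<^sup>2)"
        using l2_norm_nn_integral[OF sub[of n]] by (simp add: ennreal_leI)
    qed
  qed simp
  finally have le: "(\<integral>\<^sup>+x. ennreal ((norm ((g - l) x))\<^sup>2) \<partial>M) \<le> ennreal (e\<^sup>2)" .
  have meas: "g - l \<in> borel_measurable M" unfolding fun_diff_def by measurable
  have L2: "g - l \<in> L2 M"
  proof (rule L2_I[OF meas], rule integrableI_bounded)
    show "(\<integral>\<^sup>+x. ennreal (norm ((norm ((g - l) x))\<^sup>2)) \<partial>M) < \<infinity>"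
      using le_less_trans[OF le ennreal_less_top] by simp
  qed (use meas in measurable)
  then have "(l2_norm M (g - l))\<^sup>2 \<le> e\<^sup>2"
    using le unfolding l2_norm_nn_integral[OF L2] by (simp only: ennreal_le_iff zero_le_power2)
  then show ?thesis using L2 e by (auto intro: power2_le_imp_le)
qed

text \<open>Riesz-Fischer: a subsequence with rapidly decreasing increments converges almost everywhere, and
  its limit is also the limit in norm.\<close>
lemma L2_complete:
  assumes f: "\<And>n. f n \<in> L2 M"
    and cauchy: "\<And>e. e > 0 \<Longrightarrow> \<exists>N. \<forall>m\<ge>N. \<forall>n\<ge>N. l2_norm M (f m - f n) < e"
  shows "\<exists>l\<in>L2 M. (\<lambda>n. l2_norm M (f n - l)) \<longlonglongrightarrow> 0"
proof -
  interpret semi_inner_space cscale "L2 M" "l2_inner M"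
    by (rule semi_inner_L2_subset[OF L2_subspace order_refl])
  note [measurable] = L2_measurable[OF f]
  have "\<exists>N. \<forall>m\<ge>N. \<forall>n\<ge>N. l2_norm M (f m - f n) < sqrt ((1/8)^k)" for k :: nat
    by (rule cauchy) simp
  then obtain N where N: "\<And>k m n. m \<ge> N k \<Longrightarrow> n \<ge> N k \<Longrightarrow> l2_norm M (f m - f n) < sqrt ((1/8)^k)"
    by metis
  define r where "r k = (\<Sum>j\<le>k. N j)" for k
  \<comment> \<open>The increments satisfy \<open>\<parallel>d k\<parallel>\<^sup>2 \<le> 8^(- k)\<close>, so that \<open>\<Sum>k. 4\<^sup>k |d k|\<^sup>2\<close> is integrable; where it is finite,
    \<open>|d k|\<close> is bounded by a multiple of \<open>2^(- k)\<close>.\<close>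
  have r_ge: "r k \<ge> N k" for k unfolding r_def by (rule member_le_sum) auto
  have r_mono: "r k \<le> r (Suc k)" for k by (simp add: r_def)
  define d where "d k x = f (r (Suc k)) x - f (r k) x" for k x
  have [measurable]: "d k \<in> borel_measurable M" for k unfolding d_def by measurable
  have d_int: "(\<integral>\<^sup>+x. ennreal (4^k * (norm (d k x))\<^sup>2) \<partial>M) \<le> ennreal ((1/2)^k)" for k
  proof -
    have "(l2_norm M (f (r (Suc k)) - f (r k)))\<^sup>2 \<le> (sqrt ((1/8)^k))\<^sup>2"
      using N[of k "r (Suc k)" "r k"] r_ge[of k] r_mono[of k]
      by (intro power_mono) (auto simp: l2_norm_def)
    then have le: "(l2_norm M (f (r (Suc k)) - f (r k)))\<^sup>2 \<le> (1/8)^k" by simp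
    have "(\<integral>\<^sup>+x. ennreal (4^k * (norm (d k x))\<^sup>2) \<partial>M) = ennreal (4^k) * (\<integral>\<^sup>+x. ennreal ((norm (d k x))\<^sup>2) \<partial>M)"
      by (simp add: ennreal_mult nn_integral_cmult)
    also have "(\<integral>\<^sup>+x. ennreal ((norm (d k x))\<^sup>2) \<partial>M) = ennreal ((l2_norm M (f (r (Suc k)) - f (r k)))\<^sup>2)"
      using l2_norm_nn_integral[of "f (r (Suc k)) - f (r k)" M] f by (simp add: d_def)
    also have "ennreal (4^k) * \<dots> \<le> ennreal (4^k) * ennreal ((1/8)^k)"
      using le by (intro mult_left_mono) (auto intro: ennreal_leI)
    also have "\<dots> = ennreal ((1/2)^k)"
      by (simp flip: ennreal_mult power_mult_distrib)
    finally show ?thesis .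
  qed
  have "(\<integral>\<^sup>+x. (\<Sum>k. ennreal (4^k * (norm (d k x))\<^sup>2)) \<partial>M) = (\<Sum>k. \<integral>\<^sup>+x. ennreal (4^k * (norm (d k x))\<^sup>2) \<partial>M)"
    by (rule nn_integral_suminf) measurable
  also have "\<dots> \<le> (\<Sum>k. ennreal ((1/2)^k))"
    by (rule suminf_le[OF d_int summableI summableI])
  also have "\<dots> = ennreal 2"
  proof (rule suminf_ennreal_eq)
    show "(\<lambda>k. (1/2)^k) sums (2::real)" using geometric_sums[of "1/2::real"] by simp
  qed simp
  finally have "(\<integral>\<^sup>+x. (\<Sum>k. ennreal (4^k * (norm (d k x))\<^sup>2)) \<partial>M) \<noteq> \<infinity>"
    by (auto simp: top_unique)
  then have AE_fin: "AE x in M. (\<Sum>k. ennreal (4^k * (norm (d k x))\<^sup>2)) \<noteq> \<infinity>"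
    by (rule nn_integral_noteq_infinite[OF borel_measurable_suminf_order, rotated]) simp
  have conv: "convergent (\<lambda>k. f (r k) x)" if fin: "(\<Sum>k. ennreal (4^k * (norm (d k x))\<^sup>2)) \<noteq> \<infinity>" for x
  proof -
    define C where "C = enn2real (\<Sum>k. ennreal (4^k * (norm (d k x))\<^sup>2))"
    have C: "(\<Sum>k. ennreal (4^k * (norm (d k x))\<^sup>2)) = ennreal C" "C \<ge> 0"
      using fin unfolding C_def infinity_ennreal_def
      by (simp_all add: less_top)
    have "norm (d k x) \<le> sqrt C * (1/2)^k" for k
    proof -
      have "ennreal (4^k * (norm (d k x))\<^sup>2) = (\<Sum>k\<in>{k}. ennreal (4^k * (norm (d k x))\<^sup>2))"
        by (simp only: sum.insert sum.empty finite.emptyI empty_iff not_False_eq_True add_0_right)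
      also have "\<dots> \<le> (\<Sum>k. ennreal (4^k * (norm (d k x))\<^sup>2))"
        by (rule sum_le_suminf[OF summableI]) simp_all
      finally have "ennreal (4^k * (norm (d k x))\<^sup>2) \<le> ennreal C" by (simp only: C(1))
      then have "4^k * (norm (d k x))\<^sup>2 \<le> C" using C(2) by (simp only: ennreal_le_iff)
      moreover have "(4::real)^k = (2^k)\<^sup>2" by (simp add: power2_eq_square flip: power_mult_distrib)
      ultimately have "(2^k * norm (d k x))\<^sup>2 \<le> C" by (simp only: power_mult_distrib)
      then have "2^k * norm (d k x) \<le> sqrt C" by (rule real_le_rsqrt)
      then show ?thesis by (simp add: field_simps)
    qed
    moreover have "summable (\<lambda>k. sqrt C * (1/2)^k)" by (intro summable_mult summable_geometric) simp
    ultimately have "summable (\<lambda>k. d k x)"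
      using summable_comparison_test'[of "\<lambda>k. sqrt C * (1/2)^k" 0 "\<lambda>k. d k x"] by blast
    then have "convergent (\<lambda>n. \<Sum>k<n. d k x)" by (simp add: summable_iff_convergent)
    moreover have "(\<Sum>k<n. d k x) = f (r n) x - f (r 0) x" for n
      using sum_lessThan_telescope[of "\<lambda>k. f (r k) x" n] by (simp add: d_def)
    ultimately have "convergent (\<lambda>n. f (r n) x - f (r 0) x + f (r 0) x)"
      by (intro convergent_add convergent_const) (simp only:)
    then show ?thesis by simp
  qed
  have AE_lim: "AE x in M. (\<lambda>k. f (r k) x) \<longlonglongrightarrow> lim (\<lambda>k. f (r k) x)"
    by (rule AE_mp[OF AE_fin], rule AE_I2, rule impI) (use conv convergent_LIMSEQ_iff in blast)
  define l where "l x = lim (\<lambda>k. f (r k) x)" for x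
  have l_meas: "l \<in> borel_measurable M" unfolding l_def by measurable
  have bound: "f n - l \<in> L2 M \<and> l2_norm M (f n - l) \<le> sqrt ((1/8)^k)" if "n \<ge> N k" for n k
  proof (rule l2_limit_of_AE_limit)
    show "AE x in M. (\<lambda>k. f (r k) x) \<longlonglongrightarrow> l x" using AE_lim by (simp add: l_def)
    show "l2_norm M (f n - f (r j)) \<le> sqrt ((1/8)^k)" if "j \<ge> k" for j
    proof -
      have "r k \<le> r j" using that by (simp add: r_def sum_mono2)
      then show ?thesis using N[of k n "r j"] \<open>n \<ge> N k\<close> r_ge[of k] by simp
    qed
  qed (use f l_meas in auto)
  have "f (N 0) - l \<in> L2 M" using bound[of 0 "N 0"] by simp
  then have "f (N 0) - (f (N 0) - l) \<in> L2 M" using f by blast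
  then have l: "l \<in> L2 M" by simp
  have "(\<lambda>n. l2_norm M (f n - l)) \<longlonglongrightarrow> 0"
  proof (rule LIMSEQ_I)
    fix e :: real assume e: "e > 0"
    have "(\<lambda>k. sqrt ((1/8)^k)) \<longlonglongrightarrow> sqrt 0" by (intro tendsto_real_sqrt LIMSEQ_realpow_zero) auto
    then obtain k where k: "sqrt ((1/8)^k) < e"
      using LIMSEQ_D[of "\<lambda>k. sqrt ((1/8)^k)" 0 e] e by force
    have "norm (l2_norm M (f n - l) - 0) < e" if "n \<ge> N k" for n
      using bound[OF that] k l2_norm_nonneg[of M "f n - l"] by simp
    then show "\<exists>no. \<forall>n\<ge>no. norm (l2_norm M (f n - l) - 0) < e" by blast
  qed
  then show ?thesis using l by blast
qed

lemma semi_hilbert_L2_subset: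
  assumes sub: "fun_vs.subspace H" and H: "H \<subseteq> L2 M"
    and closed: "\<And>f l. (\<And>n. f n \<in> H) \<Longrightarrow> l \<in> L2 M \<Longrightarrow> (\<lambda>n. l2_norm M (f n - l)) \<longlonglongrightarrow> 0 \<Longrightarrow> l \<in> H"
  shows "semi_hilbert_space cscale H (l2_inner M)"
proof -
  interpret semi_inner_space cscale H "l2_inner M"
    rewrites "semi_inner_space.nrm (l2_inner M) = l2_norm M"
    using semi_inner_L2_subset[OF sub H] nrm_eq_l2_norm by blast+
  show ?thesis
  proof unfold_locales
    fix f :: "nat \<Rightarrow> 'a \<Rightarrow> complex" assume f: "\<And>n. f n \<in> H" and c: "cauchy_seq f"
    obtain l where "l \<in> L2 M" "(\<lambda>n. l2_norm M (f n - l)) \<longlonglongrightarrow> 0"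
      using L2_complete[of f M] f H c unfolding cauchy_seq_def by blast
    then show "\<exists>l\<in>H. converges_to f l"
      using closed f unfolding converges_to_def by blast
  qed
qed

interpretation L2sp: semi_hilbert_space cscale "L2 M" "l2_inner M"
  rewrites "semi_inner_space.nrm (l2_inner M) = l2_norm M" for M
  using semi_hilbert_L2_subset[OF L2_subspace order_refl] semi_inner_L2_subset[OF L2_subspace order_refl] nrm_eq_l2_norm
  by blast+

lemma l2_norm_zero_iff: "f \<in> L2 M \<Longrightarrow> l2_norm M f = 0 \<longleftrightarrow> (AE x in M. f x = 0)"
  using integral_nonneg_eq_0_iff_AE[OF L2_integrable[of f M]] by (simp add: l2_norm_def)

lemma L2_eq_AE_iff: "f \<in> L2 M \<Longrightarrow> g \<in> L2 M \<Longrightarrow> l2_norm M (f - g) = 0 \<longleftrightarrow> (AE x in M. f x = g x)"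
  by (subst l2_norm_zero_iff) auto

lemma L2_AE_eqI:
  assumes "f \<in> L2 M" "g \<in> L2 M" "\<And>h. h \<in> L2 M \<Longrightarrow> l2_inner M h f = l2_inner M h g"
  shows "AE x in M. f x = g x"
  using assms L2sp.ip_all_zero_imp_nrm_zero[of "f - g" M] L2_eq_AE_iff[of f M g]
  by (simp add: L2sp.ip_diff_right)

lemma l2_inner_cong_AE:
  assumes "AE x in M. f x = f' x" "AE x in M. g x = g' x"
    and "f \<in> L2 M" "f' \<in> L2 M" "g \<in> L2 M" "g' \<in> L2 M"
  shows "l2_inner M f g = l2_inner M f' g'"
  unfolding l2_inner_def
proof (rule integral_cong_AE)
  show "(\<lambda>x. cnj (f x) * g x) \<in> borel_measurable M" "(\<lambda>x. cnj (f' x) * g' x) \<in> borel_measurable M"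
    using L2_mult_integrable assms by (blast intro: borel_measurable_integrable)+
  show "AE x in M. cnj (f x) * g x = cnj (f' x) * g' x"
    using assms(1,2) by eventually_elim simp
qed

lemma l2_norm_cong_AE:
  assumes "AE x in M. f x = f' x" "f \<in> L2 M" "f' \<in> L2 M"
  shows "l2_norm M f = l2_norm M f'"
  using l2_inner_cong_AE[OF assms(1,1,2,3,2,3)] L2sp.nrm_sq[OF assms(2)] L2sp.nrm_sq[OF assms(3)]
    L2sp.nrm_nonneg[OF assms(2)] L2sp.nrm_nonneg[OF assms(3)] by (metis power2_eq_imp_eq)

lemma L2_limit_AE_subseq:
  assumes f: "\<And>n. f n \<in> L2 M" and l: "l \<in> L2 M" and lim: "(\<lambda>n. l2_norm M (f n - l)) \<longlonglongrightarrow> 0"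
  shows "\<exists>r::nat \<Rightarrow> nat. strict_mono r \<and> (AE x in M. (\<lambda>n. f (r n) x) \<longlonglongrightarrow> l x)"
proof -
  have "\<exists>r. strict_mono r \<and> (AE x in M. (\<lambda>n. (norm ((f (r n) - l) x))\<^sup>2) \<longlonglongrightarrow> 0)"
  proof (rule tendsto_L1_AE_subseq)
    show "integrable M (\<lambda>x. (norm ((f n - l) x))\<^sup>2)" for n
      by (rule L2_integrable[OF L2sp.H_closed(4)[OF f l]])
    show "(\<lambda>n. LINT x|M. norm ((norm ((f n - l) x))\<^sup>2)) \<longlonglongrightarrow> 0"
      using tendsto_power[OF lim, of 2] unfolding l2_norm_sq by simp
  qed
  then obtain r where r: "strict_mono r" "AE x in M. (\<lambda>n. (norm ((f (r n) - l) x))\<^sup>2) \<longlonglongrightarrow> 0" by blast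
  have "AE x in M. (\<lambda>n. f (r n) x) \<longlonglongrightarrow> l x" using r(2)
  proof eventually_elim
    case (elim x)
    then have "(\<lambda>n. sqrt ((norm ((f (r n) - l) x))\<^sup>2)) \<longlonglongrightarrow> sqrt 0" by (rule tendsto_real_sqrt)
    then show ?case by (simp add: tendsto_norm_zero_iff LIM_zero_iff)
  qed
  with r(1) show ?thesis by blast
qed

lemma l2_closure_iff:
  assumes "S \<subseteq> L2 M"
  shows "l \<in> l2_closure M S \<longleftrightarrow> l \<in> L2 M \<and> (\<exists>f. (\<forall>n. f n \<in> S) \<and> (\<lambda>n. l2_norm M (f n - l)) \<longlonglongrightarrow> 0)"
proof safe
  assume l: "l \<in> l2_closure M S"
  then show L: "l \<in> L2 M" by (simp add: l2_closure_def)
  have "\<exists>g\<in>S. l2_norm M (l - g) < inverse (real (Suc n))" for n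
    using l by (simp add: l2_closure_def fun_diff_def)
  then obtain f where f: "\<And>n. f n \<in> S" "\<And>n. l2_norm M (l - f n) < inverse (real (Suc n))" by metis
  have "(\<lambda>n. l2_norm M (f n - l)) \<longlonglongrightarrow> 0"
  proof (rule Lim_null_comparison)
    show "\<forall>\<^sub>F n in sequentially. norm (l2_norm M (f n - l)) \<le> inverse (real (Suc n))"
    proof (intro always_eventually allI)
      fix n
      have "f n \<in> L2 M" using f(1) assms by auto
      then show "norm (l2_norm M (f n - l)) \<le> inverse (real (Suc n))"
        using f(2)[of n] L2sp.nrm_diff_commute[of "f n" M l] L by (simp add: less_imp_le)
    qed
  qed (rule LIMSEQ_inverse_real_of_nat)
  then show "\<exists>f. (\<forall>n. f n \<in> S) \<and> (\<lambda>n. l2_norm M (f n - l)) \<longlonglongrightarrow> 0" using f(1) by blast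
next
  fix f assume l: "l \<in> L2 M" and f: "\<forall>n. f n \<in> S" and lim: "(\<lambda>n. l2_norm M (f n - l)) \<longlonglongrightarrow> 0"
  have "\<exists>g\<in>S. l2_norm M (l - g) < e" if e: "e > 0" for e
  proof -
    obtain n where n: "l2_norm M (f n - l) < e"
      using LIMSEQ_D[OF lim e] by force
    have "f n \<in> L2 M" using f assms by auto
    then show ?thesis using n f L2sp.nrm_diff_commute[of "f n" M l] l by (intro bexI[of _ "f n"]) auto
  qed
  then show "l \<in> l2_closure M S" using l by (simp add: l2_closure_def fun_diff_def)
qed

lemma subspace_l2_closure:
  assumes sub: "fun_vs.subspace S" and S: "S \<subseteq> L2 M"
  shows "fun_vs.subspace (l2_closure M S)"
proof (rule fun_vs.subspaceI)
  show "0 \<in> l2_closure M S"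
    using fun_vs.subspace_0[OF sub] by (subst l2_closure_iff[OF S]) (auto intro!: exI[of _ "\<lambda>_. 0"])
next
  fix f g assume f: "f \<in> l2_closure M S" and g: "g \<in> l2_closure M S"
  have fL: "f \<in> L2 M" and gL: "g \<in> L2 M" using f g by (auto simp: l2_closure_def)
  from f g obtain u v where u: "\<And>n. u n \<in> S" "(\<lambda>n. l2_norm M (u n - f)) \<longlonglongrightarrow> 0"
    and v: "\<And>n. v n \<in> S" "(\<lambda>n. l2_norm M (v n - g)) \<longlonglongrightarrow> 0"
    unfolding l2_closure_iff[OF S] by blast
  have uL: "u n \<in> L2 M" and vL: "v n \<in> L2 M" for n using u(1) v(1) S by auto
  have "(\<lambda>n. l2_norm M ((u n + v n) - (f + g))) \<longlonglongrightarrow> 0"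
  proof (rule Lim_null_comparison)
    show "\<forall>\<^sub>F n in sequentially. norm (l2_norm M ((u n + v n) - (f + g))) \<le> l2_norm M (u n - f) + l2_norm M (v n - g)"
    proof (intro always_eventually allI)
      fix n
      have "(u n + v n) - (f + g) = (u n - f) + (v n - g)" by simp
      then show "norm (l2_norm M ((u n + v n) - (f + g))) \<le> l2_norm M (u n - f) + l2_norm M (v n - g)"
        using L2sp.nrm_triangle[of "u n - f" M "v n - g"] uL vL fL gL
        by (metis L2sp.H_closed(2,4) L2sp.nrm_nonneg abs_of_nonneg real_norm_def)
    qed
    show "(\<lambda>n. l2_norm M (u n - f) + l2_norm M (v n - g)) \<longlonglongrightarrow> 0"
      using tendsto_add[OF u(2) v(2)] by simp
  qed
  then show "f + g \<in> l2_closure M S"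
    unfolding l2_closure_iff[OF S] using fL gL u(1) v(1) fun_vs.subspace_add[OF sub]
    by (intro conjI exI[of _ "\<lambda>n. u n + v n"] allI L2_add) simp_all
next
  fix c f assume f: "f \<in> l2_closure M S"
  have fL: "f \<in> L2 M" using f by (auto simp: l2_closure_def)
  from f obtain u where u: "\<And>n. u n \<in> S" "(\<lambda>n. l2_norm M (u n - f)) \<longlonglongrightarrow> 0"
    unfolding l2_closure_iff[OF S] by blast
  have uL: "u n \<in> L2 M" for n using u(1) S by auto
  have "l2_norm M (cscale c (u n) - cscale c f) = cmod c * l2_norm M (u n - f)" for n
    using L2sp.nrm_scale[of "u n - f" M c] uL fL by (simp add: fun_vs.scale_right_diff_distrib)
  then have "(\<lambda>n. l2_norm M (cscale c (u n) - cscale c f)) \<longlonglongrightarrow> 0"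
    using tendsto_mult_right_zero[OF u(2), of "cmod c"] by simp
  then show "cscale c f \<in> l2_closure M S"
    unfolding l2_closure_iff[OF S] using fL u(1) fun_vs.subspace_scale[OF sub]
    by (intro conjI exI[of _ "\<lambda>n. cscale c (u n)"] allI L2_cscale) simp_all
qed

lemma closed_l2_closure:
  assumes S: "S \<subseteq> L2 M" and f: "\<And>n. f n \<in> l2_closure M S" and l: "l \<in> L2 M"
    and lim: "(\<lambda>n. l2_norm M (f n - l)) \<longlonglongrightarrow> 0"
  shows "l \<in> l2_closure M S"
  unfolding l2_closure_def
proof (safe, rule l)
  fix e :: real assume e: "e > 0"
  obtain n where n: "l2_norm M (f n - l) < e / 2"
    using LIMSEQ_D[OF lim, of "e / 2"] e by force
  obtain g where g: "g \<in> S" "l2_norm M (f n - g) < e / 2"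
  proof -
    have "\<forall>e>0. \<exists>g\<in>S. l2_norm M (f n - g) < e"
      using f[of n] by (simp add: l2_closure_def fun_diff_def)
    then show ?thesis using that e by (meson half_gt_zero)
  qed
  have L: "f n \<in> L2 M" "g \<in> L2 M" using f[of n] g(1) S by (auto simp: l2_closure_def)
  have "l2_norm M (l - g) < e"
    using L2sp.nrm_triangle3[OF l L] L2sp.nrm_diff_commute[OF l L(1)] n g(2) by simp
  then show "\<exists>g\<in>S. l2_norm M (\<lambda>x. l x - g x) < e" using g(1) by (auto simp: fun_diff_def)
qed

section \<open>Closed forms and purely discrete spectrum\<close>

lemma convergent_subseq_finite_family:
  fixes a :: "'s \<Rightarrow> nat \<Rightarrow> complex"
  assumes "finite S" and "\<And>s. s \<in> S \<Longrightarrow> bounded (range (a s))"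
  shows "\<exists>r::nat \<Rightarrow> nat. strict_mono r \<and> (\<forall>s\<in>S. convergent (\<lambda>n. a s (r n)))"
  using assms
proof (induction S)
  case empty
  show ?case by (intro exI[of _ id]) (simp add: strict_mono_def)
next
  case (insert s S)
  then obtain r where r: "strict_mono r" "\<forall>s\<in>S. convergent (\<lambda>n. a s (r n))" by auto
  have "bounded (range (\<lambda>n. a s (r n)))"
    using insert.prems[of s] by (rule bounded_subset) auto
  then obtain l r' where r': "strict_mono r'" "((\<lambda>n. a s (r n)) \<circ> r') \<longlonglongrightarrow> l"
    using bounded_imp_convergent_subsequence by blast
  have "convergent (\<lambda>n. a t ((r \<circ> r') n))" if "t \<in> insert s S" for t
  proof (cases "t = s")
    case True
    then show ?thesis using r'(2) by (auto simp: convergent_def comp_def)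
  next
    case False
    then have "convergent (\<lambda>n. a t (r n))" using that r(2) by simp
    then show ?thesis using convergent_subseq_convergent[OF _ r'(1)] by (fastforce simp: comp_def)
  qed
  then show ?case using strict_mono_o[OF r(1) r'(1)] by blast
qed

text \<open>A closed semibounded quadratic form \<open>q\<close> with form domain \<open>Q\<close>, normalized so that \<open>q + \<kappa> \<parallel>\<cdot>\<parallel>\<^sup>2\<close>
  dominates the square of the norm. Closedness is completeness of \<open>Q\<close> in this form norm. The
  operator of the form lives in the closure \<open>K\<close> of \<open>Q\<close>, possibly a proper subspace of \<open>L\<^sup>2\<close>.\<close>
locale closed_form =
  fixes M :: "'a measure" and Q :: "('a \<Rightarrow> complex) set" and q :: "('a \<Rightarrow> complex) \<Rightarrow> real"
    and \<kappa> :: real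
  assumes Q_subspace: "fun_vs.subspace Q"
    and Q_L2: "Q \<subseteq> L2 M"
    and Q_AE: "f \<in> Q \<Longrightarrow> g \<in> L2 M \<Longrightarrow> (AE x in M. g x = f x) \<Longrightarrow> g \<in> Q"
    and B_add: "h \<in> Q \<Longrightarrow> f \<in> Q \<Longrightarrow> g \<in> Q \<Longrightarrow> polarize q h (f + g) = polarize q h f + polarize q h g"
    and B_scale: "h \<in> Q \<Longrightarrow> f \<in> Q \<Longrightarrow> polarize q h (cscale a f) = a * polarize q h f"
    and B_commute: "h \<in> Q \<Longrightarrow> f \<in> Q \<Longrightarrow> polarize q f h = cnj (polarize q h f)"
    and B_self: "f \<in> Q \<Longrightarrow> polarize q f f = complex_of_real (q f)"
    and lower_bound: "f \<in> Q \<Longrightarrow> (l2_norm M f)\<^sup>2 \<le> q f + \<kappa> * (l2_norm M f)\<^sup>2"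
    and form_complete: "(\<And>n. u n \<in> Q) \<Longrightarrow>
      (\<And>e. e > 0 \<Longrightarrow> \<exists>N. \<forall>m\<ge>N. \<forall>n\<ge>N. q (u m - u n) + \<kappa> * (l2_norm M (u m - u n))\<^sup>2 < e) \<Longrightarrow>
      \<exists>l\<in>Q. (\<lambda>n. q (u n - l) + \<kappa> * (l2_norm M (u n - l))\<^sup>2) \<longlonglongrightarrow> 0"
begin

abbreviation "B \<equiv> polarize q"

definition "ipQ h f = B h f + \<kappa> * l2_inner M h f"

lemma Q_in_L2 [simp]: "f \<in> Q \<Longrightarrow> f \<in> L2 M"
  using Q_L2 by auto

lemma ipQ_self: "f \<in> Q \<Longrightarrow> ipQ f f = complex_of_real (q f + \<kappa> * (l2_norm M f)\<^sup>2)"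
  by (simp add: ipQ_def B_self L2sp.ip_self)

lemma form_norm_nonneg: "f \<in> Q \<Longrightarrow> 0 \<le> q f + \<kappa> * (l2_norm M f)\<^sup>2"
  using lower_bound[of f] zero_le_power2[of "l2_norm M f"] by linarith

sublocale Qsp: semi_hilbert_space cscale Q ipQ
proof -
  interpret semi_inner_space cscale Q ipQ
  proof (unfold_locales, rule Q_subspace)
    fix f g h :: "'a \<Rightarrow> complex" and c assume f: "f \<in> Q" and g: "g \<in> Q"
    show "ipQ f (cscale c g) = c * ipQ f g"
      using f g by (simp add: ipQ_def B_scale L2sp.ip_scale_right algebra_simps)
    show "ipQ g f = cnj (ipQ f g)"
      using f g by (simp add: ipQ_def B_commute[of f g] L2sp.ip_commute[of f M g])
    show "0 \<le> Re (ipQ f f)"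
      using f by (simp add: ipQ_self form_norm_nonneg)
    assume h: "h \<in> Q"
    show "ipQ f (g + h) = ipQ f g + ipQ f h"
      using f g h by (simp add: ipQ_def B_add L2sp.ip_add_right algebra_simps)
  qed
  show "semi_hilbert_space cscale Q ipQ"
  proof
    fix u :: "nat \<Rightarrow> 'a \<Rightarrow> complex" assume u: "\<And>n. u n \<in> Q" and c: "cauchy_seq u"
    have sq: "q f + \<kappa> * (l2_norm M f)\<^sup>2 = (nrm f)\<^sup>2" if "f \<in> Q" for f
      using that by (simp add: nrm_sq ipQ_self)
    have "\<exists>N. \<forall>m\<ge>N. \<forall>n\<ge>N. q (u m - u n) + \<kappa> * (l2_norm M (u m - u n))\<^sup>2 < e" if e: "e > 0" for e
    proof -
      obtain N where N: "\<And>m n. m \<ge> N \<Longrightarrow> n \<ge> N \<Longrightarrow> nrm (u m - u n) < sqrt e"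
        using c e unfolding cauchy_seq_def by (meson real_sqrt_gt_zero)
      have "q (u m - u n) + \<kappa> * (l2_norm M (u m - u n))\<^sup>2 < e" if "m \<ge> N" "n \<ge> N" for m n
      proof -
        have "(nrm (u m - u n))\<^sup>2 < (sqrt e)\<^sup>2"
          using N[OF that] u by (intro power_strict_mono) auto
        then show ?thesis using sq[of "u m - u n"] u e by simp
      qed
      then show ?thesis by blast
    qed
    then obtain l where l: "l \<in> Q" "(\<lambda>n. q (u n - l) + \<kappa> * (l2_norm M (u n - l))\<^sup>2) \<longlonglongrightarrow> 0"
      using form_complete[of u] u by blast
    have "(\<lambda>n. sqrt ((nrm (u n - l))\<^sup>2)) \<longlonglongrightarrow> sqrt 0"
      using l(2) sq u l(1) by (intro tendsto_real_sqrt) simp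
    then have "converges_to u l"
      using u l(1) by (simp add: converges_to_def)
    then show "\<exists>l\<in>Q. converges_to u l" using l(1) by blast
  qed
qed

lemma nrmQ_sq: "f \<in> Q \<Longrightarrow> (Qsp.nrm f)\<^sup>2 = q f + \<kappa> * (l2_norm M f)\<^sup>2"
  by (simp add: Qsp.nrm_sq ipQ_self)

lemma l2_norm_le_nrmQ: "f \<in> Q \<Longrightarrow> l2_norm M f \<le> Qsp.nrm f"
  by (rule power2_le_imp_le) (simp_all add: nrmQ_sq lower_bound)

definition K where "K = l2_closure M Q"

lemma K_L2 [simp]: "f \<in> K \<Longrightarrow> f \<in> L2 M"
  by (simp add: K_def l2_closure_def)

lemma K_subspace: "fun_vs.subspace K"
  unfolding K_def by (rule subspace_l2_closure[OF Q_subspace Q_L2])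

lemma Q_K [simp]: "f \<in> Q \<Longrightarrow> f \<in> K"
  unfolding K_def l2_closure_def by (auto intro!: bexI[of _ f] simp: l2_norm_def)

text \<open>The weak form of \<open>(A - z) f = k\<close>.\<close>
definition solves :: "complex \<Rightarrow> ('a \<Rightarrow> complex) \<Rightarrow> ('a \<Rightarrow> complex) \<Rightarrow> bool" where
  "solves z f k \<longleftrightarrow> f \<in> Q \<and> k \<in> K \<and> (\<forall>h\<in>Q. B h f - z * l2_inner M h f = l2_inner M h k)"

lemma solvesD: "solves z f k \<Longrightarrow> f \<in> Q" "solves z f k \<Longrightarrow> k \<in> K"
  "solves z f k \<Longrightarrow> h \<in> Q \<Longrightarrow> B h f = z * l2_inner M h f + l2_inner M h k"
  by (auto simp: solves_def algebra_simps)

lemma solves_in_L2 [simp]: "solves z f k \<Longrightarrow> f \<in> L2 M" "solves z f k \<Longrightarrow> k \<in> L2 M"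
  by (auto simp: solves_def)

lemma solves_add: "solves z f k \<Longrightarrow> solves z f' k' \<Longrightarrow> solves z (f + f') (k + k')"
  unfolding solves_def
  using fun_vs.subspace_add[OF Q_subspace] fun_vs.subspace_add[OF K_subspace]
  by (auto simp: B_add L2sp.ip_add_right algebra_simps)

lemma solves_scale: "solves z f k \<Longrightarrow> solves z (cscale a f) (cscale a k)"
  unfolding solves_def
  using fun_vs.subspace_scale[OF Q_subspace] fun_vs.subspace_scale[OF K_subspace]
  by (auto simp: B_scale L2sp.ip_scale_right algebra_simps)

lemma solves_diff: "solves z f k \<Longrightarrow> solves z f' k' \<Longrightarrow> solves z (f - f') (k - k')"
  using solves_add[of z f k "cscale (-1) f'" "cscale (-1) k'"] solves_scale[of z f' k' "-1"]
  by (simp add: fun_vs.scale_minus_left)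

lemma solves_zero: "solves z 0 0"
  using fun_vs.subspace_0[OF K_subspace] B_scale[of _ 0 0] by (auto simp: solves_def)

lemma solves_sum: "(\<And>i. i \<in> I \<Longrightarrow> solves z (f i) 0) \<Longrightarrow> solves z (sum f I) 0"
proof (induction I rule: infinite_finite_induct)
  case (insert i I)
  have "solves z (f i) 0" "solves z (sum f I) 0" using insert by blast+
  then have "solves z (f i + sum f I) (0 + 0)" by (rule solves_add)
  then show ?case unfolding sum.insert[OF insert(1,2)] add_0_left .
qed (simp_all only: sum.empty sum.infinite solves_zero not_False_eq_True)

lemma form_operator_iff: "(f, g) \<in> form_operator M Q q \<longleftrightarrow> solves 0 f g"
  by (auto simp: form_operator_def solves_def K_def)

lemma shift_op_iff: "(f, k) \<in> shift_op (form_operator M Q q) z \<longleftrightarrow> solves z f k"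
proof -
  have eq: "(f, k) \<in> shift_op (form_operator M Q q) z \<longleftrightarrow> (\<exists>g. solves 0 f g \<and> k = g - cscale z f)"
    by (auto simp: shift_op_def form_operator_iff fun_diff_def)
  show ?thesis unfolding eq
  proof safe
    fix g assume g: "solves 0 f g"
    then show "solves z f (g - cscale z f)"
      using fun_vs.subspace_diff[OF K_subspace] fun_vs.subspace_scale[OF K_subspace]
      by (auto simp: solves_def L2sp.ip_diff_right L2sp.ip_scale_right)
  next
    assume k: "solves z f k"
    have "solves 0 f (k + cscale z f)"
      using k fun_vs.subspace_add[OF K_subspace] fun_vs.subspace_scale[OF K_subspace]
      by (auto simp: solves_def L2sp.ip_add_right L2sp.ip_scale_right algebra_simps)
    then show "\<exists>g. solves 0 f g \<and> k = g - cscale z f"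
      by (intro exI[of _ "k + cscale z f"]) simp
  qed
qed

lemma solves_form: "solves z f k \<Longrightarrow> q f = Re z * (l2_norm M f)\<^sup>2 + Re (l2_inner M f k)"
  using solvesD(3)[of z f k f] solvesD(1)[of z f k]
  by (auto simp: B_self L2sp.ip_self complex_eq_iff)

text \<open>The operator is closed, even without a limit vector given in advance: for a sequence of
  solutions, convergence of the right-hand sides and the Cauchy property in \<open>L\<^sup>2\<close> bound the form of the
  differences, so the sequence is Cauchy in the form norm too.\<close>
lemma solves_limit:
  assumes s: "\<And>n. solves z (f n) (k n)"
    and cf: "L2sp.cauchy_seq M f"
    and k: "k' \<in> L2 M" "L2sp.converges_to M k k'"
  shows "\<exists>f'. solves z f' k' \<and> L2sp.converges_to M f f'"
proof -
  have fQ: "f n \<in> Q" and kK: "k n \<in> K" for n using solvesD(1,2)[OF s] by auto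
  have ck: "L2sp.cauchy_seq M k"
    using k by (intro L2sp.converges_to_imp_cauchy_seq) (auto simp: kK)
  define a where "a = cmod z + \<bar>\<kappa>\<bar>"
  have a: "a \<ge> 0" by (simp add: a_def)
  have "Qsp.cauchy_seq f"
    unfolding Qsp.cauchy_seq_def
  proof safe
    fix e :: real assume e: "e > 0"
    define \<delta> where "\<delta> = min 1 (e\<^sup>2 / (a + 2))"
    have \<delta>: "\<delta> > 0" "\<delta> \<le> 1" "(a + 1) * \<delta> < e\<^sup>2"
    proof -
      show "\<delta> > 0" using e a by (simp add: \<delta>_def add_nonneg_pos)
      then have "(a + 1) * \<delta> < (a + 2) * \<delta>" by (intro mult_strict_right_mono) auto
      also have "\<dots> \<le> (a + 2) * (e\<^sup>2 / (a + 2))"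
        using a by (intro mult_left_mono) (auto simp: \<delta>_def)
      also have "\<dots> = e\<^sup>2" using a by simp
      finally show "(a + 1) * \<delta> < e\<^sup>2" .
    qed (simp add: \<delta>_def)
    obtain N where N: "\<And>m n. m \<ge> N \<Longrightarrow> n \<ge> N \<Longrightarrow> l2_norm M (f m - f n) < \<delta>"
      using cf \<delta>(1) unfolding L2sp.cauchy_seq_def by meson
    obtain N' where N': "\<And>m n. m \<ge> N' \<Longrightarrow> n \<ge> N' \<Longrightarrow> l2_norm M (k m - k n) < 1"
      using ck unfolding L2sp.cauchy_seq_def by (meson zero_less_one)
    have "Qsp.nrm (f m - f n) < e" if "m \<ge> max N N'" "n \<ge> max N N'" for m n
    proof -
      define d where "d = f m - f n"
      have dQ: "d \<in> Q" using fQ by (simp add: d_def)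
      have sd: "solves z d (k m - k n)" unfolding d_def using s by (intro solves_diff)
      have d: "l2_norm M d < \<delta>" using N that by (simp add: d_def)
      have "(Qsp.nrm d)\<^sup>2 = (Re z + \<kappa>) * (l2_norm M d)\<^sup>2 + Re (l2_inner M d (k m - k n))"
        using nrmQ_sq[OF dQ] solves_form[OF sd] by (simp add: algebra_simps)
      also have "\<dots> \<le> a * (l2_norm M d * l2_norm M d) + l2_norm M d * 1"
      proof (intro add_mono)
        have "Re z + \<kappa> \<le> a" unfolding a_def using complex_Re_le_cmod[of z] by simp
        then show "(Re z + \<kappa>) * (l2_norm M d)\<^sup>2 \<le> a * (l2_norm M d * l2_norm M d)"
          by (simp add: power2_eq_square mult_right_mono)
        have "Re (l2_inner M d (k m - k n)) \<le> l2_norm M d * l2_norm M (k m - k n)"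
          using L2sp.Cauchy_Schwarz[of d M "k m - k n"] complex_Re_le_cmod[of "l2_inner M d (k m - k n)"] sd by simp
        also have "\<dots> \<le> l2_norm M d * 1"
          using N'[of m n] that by (intro mult_left_mono) auto
        finally show "Re (l2_inner M d (k m - k n)) \<le> l2_norm M d * 1" .
      qed
      also have "\<dots> \<le> a * (\<delta> * 1) + \<delta> * 1"
        using d \<delta> a by (intro add_mono mult_left_mono mult_mono) auto
      also have "\<dots> < e\<^sup>2" using \<delta>(3) by (simp add: algebra_simps)
      finally show ?thesis using e by (auto intro: power_less_imp_less_base simp: d_def)
    qed
    then show "\<exists>N. \<forall>m\<ge>N. \<forall>n\<ge>N. Qsp.nrm (f m - f n) < e" by blast
  qed
  then obtain f' where f': "f' \<in> Q" "Qsp.converges_to f f'"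
    using Qsp.complete_H fQ by blast
  have conv: "L2sp.converges_to M f f'"
    unfolding L2sp.converges_to_def
  proof (rule Lim_null_comparison)
    show "\<forall>\<^sub>F n in sequentially. norm (l2_norm M (f n - f')) \<le> Qsp.nrm (f n - f')"
      using l2_norm_le_nrmQ[OF Qsp.H_closed(4)[OF fQ f'(1)]] by simp
    show "(\<lambda>n. Qsp.nrm (f n - f')) \<longlonglongrightarrow> 0" using f'(2) by (simp add: Qsp.converges_to_def)
  qed
  have "B h f' = z * l2_inner M h f' + l2_inner M h k'" if h: "h \<in> Q" for h
  proof -
    have l1: "(\<lambda>n. l2_inner M h (f n)) \<longlonglongrightarrow> l2_inner M h f'"
      using h fQ f'(1) conv by (intro L2sp.ip_tendsto_right) auto
    have l2: "(\<lambda>n. l2_inner M h (k n)) \<longlonglongrightarrow> l2_inner M h k'"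
      using h kK k by (intro L2sp.ip_tendsto_right) auto
    have "(\<lambda>n. ipQ h (f n)) \<longlonglongrightarrow> ipQ h f'"
      by (rule Qsp.ip_tendsto_right[OF fQ f'(1) h f'(2)])
    moreover have "ipQ h (f n) = (z + \<kappa>) * l2_inner M h (f n) + l2_inner M h (k n)" for n
      using solvesD(3)[OF s h, of n] by (simp add: ipQ_def algebra_simps)
    moreover have "(\<lambda>n. (z + \<kappa>) * l2_inner M h (f n) + l2_inner M h (k n))
        \<longlonglongrightarrow> (z + \<kappa>) * l2_inner M h f' + l2_inner M h k'"
      by (intro tendsto_intros l1 l2)
    ultimately have "ipQ h f' = (z + \<kappa>) * l2_inner M h f' + l2_inner M h k'"
      using LIMSEQ_unique by fastforce
    then show ?thesis by (simp add: ipQ_def algebra_simps)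
  qed
  moreover have "k' \<in> K"
    using closed_l2_closure[OF Q_L2, of k k'] kK k unfolding K_def L2sp.converges_to_def by blast
  ultimately have "solves z f' k'" using f'(1) by (simp add: solves_def)
  then show ?thesis using conv by blast
qed

text \<open>At the point \<open>-\<kappa>\<close> the weak equation is \<open>ipQ h f = \<langle>h, k\<rangle>\<close>, solved by Riesz representation in the
  form domain. This provides one resolvent to start from.\<close>
lemma solves_minus_\<kappa>: "k \<in> K \<Longrightarrow> \<exists>f. solves (- \<kappa>) f k"
proof -
  assume k: "k \<in> K"
  have "\<exists>f\<in>Q. \<forall>h\<in>Q. l2_inner M h k = ipQ h f"
  proof (rule Qsp.Riesz_representation)
    fix h assume h: "h \<in> Q"
    have "cmod (l2_inner M h k) \<le> l2_norm M h * l2_norm M k"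
      using h k by (intro L2sp.Cauchy_Schwarz) auto
    also have "\<dots> \<le> Qsp.nrm h * l2_norm M k"
      using l2_norm_le_nrmQ[OF h] by (intro mult_right_mono) auto
    finally show "cmod (l2_inner M h k) \<le> l2_norm M k * Qsp.nrm h" by (simp add: mult.commute)
  qed (use k in \<open>simp_all add: L2sp.ip_add_left L2sp.ip_scale_left\<close>)
  then show ?thesis using k by (auto simp: solves_def ipQ_def)
qed

end

text \<open>The hypothesis says that \<open>q\<close> exceeds any given multiple of the square of the norm once the
  contribution of finitely many linear functionals is taken into account. It is the form in which
  compactness of the embedding of \<open>Q\<close> into \<open>L\<^sup>2\<close> is used: finitely many bounded scalar sequences
  converge along a common subsequence.\<close>
locale discrete_form = closed_form +
  assumes compact_embedding: "\<exists>S C. finite S \<and> S \<subseteq> L2 M \<and> 0 \<le> C \<and>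
    (\<forall>f\<in>Q. \<Lambda> * (l2_norm M f)\<^sup>2 \<le> q f + C * (\<Sum>s\<in>S. (cmod (l2_inner M s f))\<^sup>2))"
begin

text \<open>Applied to differences along a subsequence on which the finitely many functionals converge, the
  inequality for \<open>\<mu> + 1\<close> has one unit of \<open>\<parallel>\<cdot>\<parallel>\<^sup>2\<close> to spare over the assumed bound by \<open>\<mu>\<close>.\<close>
lemma cauchy_subseq:
  assumes f: "\<And>n. f n \<in> Q" and bd: "\<And>n. l2_norm M (f n) \<le> 1" and \<epsilon>: "\<epsilon> \<longlonglongrightarrow> 0"
    and q: "\<And>m n. q (f m - f n) \<le> \<mu> * (l2_norm M (f m - f n))\<^sup>2 + \<epsilon> m + \<epsilon> n"
  shows "\<exists>r::nat \<Rightarrow> nat. strict_mono r \<and> L2sp.cauchy_seq M (\<lambda>n. f (r n))"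
proof -
  obtain S C where S: "finite S" "S \<subseteq> L2 M" and C: "0 \<le> C"
    and SC: "\<And>g. g \<in> Q \<Longrightarrow> (\<mu> + 1) * (l2_norm M g)\<^sup>2 \<le> q g + C * (\<Sum>s\<in>S. (cmod (l2_inner M s g))\<^sup>2)"
    using compact_embedding[of "\<mu> + 1"] by blast
  have "bounded (range (\<lambda>n. l2_inner M s (f n)))" if s: "s \<in> S" for s
  proof (rule boundedI, safe)
    fix n
    have "cmod (l2_inner M s (f n)) \<le> l2_norm M s * l2_norm M (f n)"
      using s S(2) f by (intro L2sp.Cauchy_Schwarz) auto
    also have "\<dots> \<le> l2_norm M s * 1" using bd by (intro mult_left_mono) auto
    finally show "cmod (l2_inner M s (f n)) \<le> l2_norm M s" by simp
  qed
  from convergent_subseq_finite_family[OF S(1), of "\<lambda>s n. l2_inner M s (f n)", OF this] obtain r where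
    r: "strict_mono (r :: nat \<Rightarrow> nat)" "\<And>s. s \<in> S \<Longrightarrow> convergent (\<lambda>n. l2_inner M s (f (r n)))" by blast
  from r(2) obtain L where L: "\<And>s. s \<in> S \<Longrightarrow> (\<lambda>n. l2_inner M s (f (r n))) \<longlonglongrightarrow> L s"
    unfolding convergent_def by metis
  define \<eta> where "\<eta> n = \<epsilon> (r n) + 2 * C * (\<Sum>s\<in>S. (cmod (l2_inner M s (f (r n)) - L s))\<^sup>2)" for n
  have "(\<lambda>n. \<epsilon> (r n)) \<longlonglongrightarrow> 0"
    using LIMSEQ_subseq_LIMSEQ[OF \<epsilon> r(1)] by (simp add: comp_def)
  moreover have "(\<lambda>n. (cmod (l2_inner M s (f (r n)) - L s))\<^sup>2) \<longlonglongrightarrow> 0\<^sup>2" if "s \<in> S" for s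
    using L[OF that] by (intro tendsto_power tendsto_norm_zero LIM_zero)
  ultimately have "(\<lambda>n. \<epsilon> (r n) + 2 * C * (\<Sum>s\<in>S. (cmod (l2_inner M s (f (r n)) - L s))\<^sup>2)) \<longlonglongrightarrow> 0 + 2 * C * (\<Sum>s\<in>S. 0\<^sup>2)"
    by (intro tendsto_add tendsto_mult tendsto_const tendsto_sum) simp_all
  then have \<eta>: "\<eta> \<longlonglongrightarrow> 0" by (simp add: \<eta>_def[abs_def])
  have le: "(l2_norm M (f (r m) - f (r n)))\<^sup>2 \<le> \<eta> m + \<eta> n" for m n
  proof -
    define d where "d = f (r m) - f (r n)"
    have d: "d \<in> Q" using f by (simp add: d_def)
    have sq: "(cmod (a - b))\<^sup>2 \<le> 2 * (cmod (a - l))\<^sup>2 + 2 * (cmod (b - l))\<^sup>2" for a b l :: complex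
    proof -
      have "cmod (a - b) \<le> cmod (a - l) + cmod (b - l)"
        using norm_triangle_ineq4[of "a - l" "b - l"] by simp
      then have "(cmod (a - b))\<^sup>2 \<le> (cmod (a - l) + cmod (b - l))\<^sup>2" by (intro power_mono) auto
      also have "\<dots> \<le> 2 * (cmod (a - l))\<^sup>2 + 2 * (cmod (b - l))\<^sup>2"
        using sum_squares_bound[of "cmod (a - l)" "cmod (b - l)"] by (simp add: power2_sum)
      finally show ?thesis .
    qed
    have "(\<Sum>s\<in>S. (cmod (l2_inner M s d))\<^sup>2)
        \<le> (\<Sum>s\<in>S. 2 * (cmod (l2_inner M s (f (r m)) - L s))\<^sup>2 + 2 * (cmod (l2_inner M s (f (r n)) - L s))\<^sup>2)"
    proof (rule sum_mono)
      fix s assume "s \<in> S"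
      then have "s \<in> L2 M" using S(2) by auto
      then have "l2_inner M s d = l2_inner M s (f (r m)) - l2_inner M s (f (r n))"
        using f by (simp add: d_def L2sp.ip_diff_right)
      then show "(cmod (l2_inner M s d))\<^sup>2
        \<le> 2 * (cmod (l2_inner M s (f (r m)) - L s))\<^sup>2 + 2 * (cmod (l2_inner M s (f (r n)) - L s))\<^sup>2"
        using sq by simp
    qed
    also have "\<dots> = 2 * (\<Sum>s\<in>S. (cmod (l2_inner M s (f (r m)) - L s))\<^sup>2)
        + 2 * (\<Sum>s\<in>S. (cmod (l2_inner M s (f (r n)) - L s))\<^sup>2)"
      by (simp add: sum.distrib sum_distrib_left)
    finally have "C * (\<Sum>s\<in>S. (cmod (l2_inner M s d))\<^sup>2) \<le> C * (2 * (\<Sum>s\<in>S. (cmod (l2_inner M s (f (r m)) - L s))\<^sup>2)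
        + 2 * (\<Sum>s\<in>S. (cmod (l2_inner M s (f (r n)) - L s))\<^sup>2))"
      using C by (rule mult_left_mono)
    then show ?thesis
      using SC[OF d] q[of "r m" "r n"] by (simp add: \<eta>_def d_def algebra_simps)
  qed
  have "L2sp.cauchy_seq M (\<lambda>n. f (r n))"
    by (rule L2sp.cauchy_seqI[OF _ le \<eta>]) (use f in simp)
  then show ?thesis using r(1) by blast
qed

text \<open>For orthonormal eigenvectors the difference of two members has \<open>\<parallel>f m - f n\<parallel>\<^sup>2 = 2\<close> and
  \<open>q (f m - f n) = \<nu> m + \<nu> n \<le> 2 \<mu>\<close>, so a subsequence would be Cauchy although its members keep a fixed
  distance. This gives both finite multiplicities and discreteness of the eigenvalues.\<close>
lemma no_orthonormal_sequence:
  fixes f :: "nat \<Rightarrow> 'a \<Rightarrow> complex" and \<nu> :: "nat \<Rightarrow> real" and \<mu> :: real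
  assumes f: "\<And>n. f n \<in> Q" and on: "\<And>m n. l2_inner M (f m) (f n) = (if m = n then 1 else 0)"
    and q: "\<And>m n. B (f m) (f n) = complex_of_real (\<nu> n) * l2_inner M (f m) (f n)" and \<nu>: "\<And>n. \<nu> n \<le> \<mu>"
  shows False
proof -
  have n1: "l2_norm M (f n) = 1" for n
  proof -
    have "complex_of_real ((l2_norm M (f n))\<^sup>2) = complex_of_real 1"
      using L2sp.ip_self[of "f n" M] on[of n n] f by simp
    then have "(l2_norm M (f n))\<^sup>2 = 1" by (simp only: of_real_eq_iff)
    then show ?thesis using l2_norm_nonneg[of M "f n"] by (simp add: power2_eq_1_iff)
  qed
  have d2: "(l2_norm M (f m - f n))\<^sup>2 = 2" if "m \<noteq> n" for m n
    using that f n1 on by (simp add: L2sp.nrm_sq_diff)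
  have "q (f m - f n) \<le> \<mu> * (l2_norm M (f m - f n))\<^sup>2 + 0 + 0" for m n
  proof (cases "m = n")
    case True
    have "complex_of_real (q 0) = 0"
      using B_self[of 0] B_scale[of 0 0 0] by simp
    then show ?thesis using True by (simp add: l2_norm_def)
  next
    case False
    have "complex_of_real (q (f m - f n)) = B (f m - f n) (f m - f n)"
      using f by (simp add: B_self)
    also have "\<dots> = complex_of_real (\<nu> m + \<nu> n)"
    proof -
      have "ipQ (f m - f n) (f m - f n) = ipQ (f m) (f m) - ipQ (f m) (f n) - ipQ (f n) (f m) + ipQ (f n) (f n)"
        using f by (simp add: Qsp.ip_diff_left Qsp.ip_diff_right)
      moreover have "ipQ (f m - f n) (f m - f n) = B (f m - f n) (f m - f n) + 2 * \<kappa>"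
        using f d2[OF False] L2sp.ip_self[of "f m - f n" M] by (simp add: ipQ_def)
      ultimately show ?thesis using q on False by (simp add: ipQ_def)
    qed
    finally have "q (f m - f n) = \<nu> m + \<nu> n" by (simp only: of_real_eq_iff)
    then show ?thesis using \<nu>[of m] \<nu>[of n] d2[OF False] by simp
  qed
  then have "\<exists>r::nat \<Rightarrow> nat. strict_mono r \<and> L2sp.cauchy_seq M (\<lambda>n. f (r n))"
    using f n1 by (intro cauchy_subseq[of f "\<lambda>_. 0" \<mu>]) simp_all
  then obtain r where r: "strict_mono (r :: nat \<Rightarrow> nat)" "L2sp.cauchy_seq M (\<lambda>n. f (r n))" by blast
  then obtain N where N: "\<And>m n. m \<ge> N \<Longrightarrow> n \<ge> N \<Longrightarrow> l2_norm M (f (r m) - f (r n)) < 1"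
    unfolding L2sp.cauchy_seq_def by (meson zero_less_one)
  have "r N \<noteq> r (Suc N)" using r(1) by (metis n_not_Suc_n strict_mono_eq)
  then have "(l2_norm M (f (r N) - f (r (Suc N))))\<^sup>2 = 2" by (rule d2)
  moreover have "(l2_norm M (f (r N) - f (r (Suc N))))\<^sup>2 \<le> 1\<^sup>2"
    using N[of N "Suc N"] by (intro power_mono) auto
  ultimately show False by simp
qed

text \<open>Otherwise normalized approximate eigenvectors would have a convergent subsequence, and its limit
  would be an eigenvector.\<close>
lemma solves_bounded_below:
  assumes no_ev: "\<And>f. solves z f 0 \<Longrightarrow> l2_norm M f = 0"
  shows "\<exists>C. \<forall>f k. solves z f k \<longrightarrow> l2_norm M f \<le> C * l2_norm M k"
proof (rule ccontr)
  assume neg: "\<not> ?thesis"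
  have "\<exists>f k. solves z f k \<and> l2_norm M f = 1 \<and> l2_norm M k \<le> 1 / real (Suc n)" for n
  proof -
    obtain f k where fk: "solves z f k" "l2_norm M f > real (Suc n) * l2_norm M k"
      using neg by (meson linorder_not_le)
    define a where "a = complex_of_real (1 / l2_norm M f)"
    have pos: "l2_norm M f > 0"
      using fk(2) mult_nonneg_nonneg[OF of_nat_0_le_iff[of "Suc n"] l2_norm_nonneg[of M k]] by linarith
    have "l2_norm M (cscale a f) = 1"
      using pos fk(1) L2sp.nrm_scale[of f M a] by (simp add: a_def norm_divide)
    moreover have "l2_norm M (cscale a k) \<le> 1 / real (Suc n)"
    proof -
      have "l2_norm M (cscale a k) = l2_norm M k / l2_norm M f"
        using pos fk(1) L2sp.nrm_scale[of k M a] by (simp add: a_def norm_divide)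
      also have "\<dots> \<le> 1 / real (Suc n)"
        using fk(2) pos by (simp add: divide_le_eq pos_le_divide_eq mult.commute less_imp_le)
      finally show ?thesis .
    qed
    ultimately show ?thesis using solves_scale[OF fk(1)] by blast
  qed
  then obtain f k where s: "\<And>n. solves z (f n) (k n)" and f1: "\<And>n. l2_norm M (f n) = 1"
    and k: "\<And>n. l2_norm M (k n) \<le> 1 / real (Suc n)" by metis
  have k0: "(\<lambda>n. l2_norm M (k n)) \<longlonglongrightarrow> 0"
    by (rule Lim_null_comparison[OF _ LIMSEQ_inverse_real_of_nat])
      (use k in \<open>simp add: inverse_eq_divide\<close>)
  have fQ: "f n \<in> Q" for n using s solvesD by auto
  have "q (f m - f n) \<le> Re z * (l2_norm M (f m - f n))\<^sup>2 + 2 * l2_norm M (k m) + 2 * l2_norm M (k n)" for m n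
  proof -
    have sd: "solves z (f m - f n) (k m - k n)" using s by (intro solves_diff)
    have kL: "k m \<in> L2 M" "k n \<in> L2 M" using s solves_in_L2 by blast+
    have "l2_norm M (f m - f n) \<le> 2"
      using L2sp.nrm_triangle_diff[of "f m" M "f n"] fQ f1 by simp
    moreover have "l2_norm M (k m - k n) \<le> l2_norm M (k m) + l2_norm M (k n)"
      using L2sp.nrm_triangle_diff[of "k m" M "k n"] kL by simp
    ultimately have "l2_norm M (f m - f n) * l2_norm M (k m - k n) \<le> 2 * (l2_norm M (k m) + l2_norm M (k n))"
      by (intro mult_mono) auto
    moreover have "Re (l2_inner M (f m - f n) (k m - k n)) \<le> l2_norm M (f m - f n) * l2_norm M (k m - k n)"
      by (rule order_trans[OF complex_Re_le_cmod L2sp.Cauchy_Schwarz[OF solves_in_L2[OF sd]]])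
    ultimately show ?thesis using solves_form[OF sd] by simp
  qed
  moreover have "(\<lambda>n. 2 * l2_norm M (k n)) \<longlonglongrightarrow> 0" using k0 by (rule tendsto_mult_right_zero)
  ultimately obtain r where r: "strict_mono (r :: nat \<Rightarrow> nat)" "L2sp.cauchy_seq M (\<lambda>n. f (r n))"
    using cauchy_subseq[of f "\<lambda>n. 2 * l2_norm M (k n)" "Re z"] fQ f1 by auto
  have "L2sp.converges_to M (\<lambda>n. k (r n)) 0"
    using LIMSEQ_subseq_LIMSEQ[OF k0 r(1)] by (simp add: L2sp.converges_to_def comp_def)
  then obtain f' where f': "solves z f' 0" "L2sp.converges_to M (\<lambda>n. f (r n)) f'"
    using solves_limit[of z "\<lambda>n. f (r n)" "\<lambda>n. k (r n)" 0] s r(2) by auto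
  have "(\<lambda>n. l2_norm M (f (r n))) \<longlonglongrightarrow> l2_norm M f'"
    using f' fQ by (intro L2sp.nrm_tendsto) auto
  then have "l2_norm M f' = 1" using f1 LIMSEQ_unique[of "\<lambda>n. 1::real"] by fastforce
  then show False using no_ev[OF f'(1)] by simp
qed

lemma eigenvalue_real:
  assumes "solves z f 0" "l2_norm M f \<noteq> 0" shows "z = complex_of_real (Re z)"
proof -
  have "complex_of_real (q f) = z * complex_of_real ((l2_norm M f)\<^sup>2)"
    using solvesD(3)[OF assms(1), of f] solvesD(1)[OF assms(1)] by (simp add: B_self L2sp.ip_self)
  then have "z = complex_of_real (q f / (l2_norm M f)\<^sup>2)"
    using assms(2) by (simp add: field_simps)
  then show ?thesis by simp
qed

text \<open>The Fredholm alternative. The lower bound makes the range \<open>R\<close> closed. If \<open>w\<close> is orthogonal to it,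
  write elements of the range as \<open>u - (z + \<kappa>) f\<close> with \<open>(A + \<kappa>) f = u\<close>: symmetry of the resolvent gives
  \<open>w = cnj (z + \<kappa>) v\<close> with \<open>(A + \<kappa>) v = w\<close>, so \<open>w\<close> is an eigenvector for \<open>cnj z\<close>. Eigenvalues are real, hence
  \<open>cnj z = z\<close> and \<open>w\<close> vanishes.\<close>
lemma solves_surj:
  assumes no_ev: "\<And>f. solves z f 0 \<Longrightarrow> l2_norm M f = 0" and k: "k \<in> K"
  shows "\<exists>f. solves z f k"
proof -
  obtain C where C: "\<And>f k. solves z f k \<Longrightarrow> l2_norm M f \<le> C * l2_norm M k"
    using solves_bounded_below[OF no_ev] by blast
  define R where "R = {k. \<exists>f. solves z f k}"
  have R_K: "R \<subseteq> K" using solvesD(2) by (auto simp: R_def)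
  have R_sub: "fun_vs.subspace R"
  proof (rule fun_vs.subspaceI)
    show "0 \<in> R" using solves_zero by (auto simp: R_def)
  qed (auto simp: R_def intro: solves_add solves_scale)
  have R_closed: "l \<in> R" if g: "\<And>n. g n \<in> R" and l: "l \<in> L2 M" and lim: "(\<lambda>n. l2_norm M (g n - l)) \<longlonglongrightarrow> 0" for g l
  proof -
    obtain f where f: "\<And>n. solves z (f n) (g n)" using g unfolding R_def by (simp, metis)
    have gL: "g n \<in> L2 M" for n using f solves_in_L2 by blast
    have conv: "L2sp.converges_to M g l" using lim by (simp add: L2sp.converges_to_def)
    have "L2sp.cauchy_seq M f"
      unfolding L2sp.cauchy_seq_def
    proof safe
      fix e :: real assume e: "e > 0"
      have "e / (\<bar>C\<bar> + 1) > 0" using e by (simp add: add_nonneg_pos)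
      then obtain N where N: "\<And>m n. m \<ge> N \<Longrightarrow> n \<ge> N \<Longrightarrow> l2_norm M (g m - g n) < e / (\<bar>C\<bar> + 1)"
        using L2sp.converges_to_imp_cauchy_seq[OF gL l conv] unfolding L2sp.cauchy_seq_def by meson
      have "l2_norm M (f m - f n) < e" if "m \<ge> N" "n \<ge> N" for m n
      proof -
        have "l2_norm M (f m - f n) \<le> C * l2_norm M (g m - g n)"
          using f by (intro C solves_diff)
        also have "\<dots> \<le> (\<bar>C\<bar> + 1) * l2_norm M (g m - g n)" by (intro mult_right_mono) auto
        also have "\<dots> < e" using N[OF that] by (simp add: field_simps)
        finally show ?thesis .
      qed
      then show "\<exists>N. \<forall>m\<ge>N. \<forall>n\<ge>N. l2_norm M (f m - f n) < e" by blast
    qed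
    then show ?thesis using solves_limit[OF f _ l conv] by (auto simp: R_def)
  qed
  interpret R: semi_hilbert_space cscale R "l2_inner M"
    rewrites "semi_inner_space.nrm (l2_inner M) = l2_norm M"
  proof -
    have RL: "R \<subseteq> L2 M" using R_K K_L2 by auto
    show "semi_hilbert_space cscale R (l2_inner M)" using R_sub RL R_closed by (rule semi_hilbert_L2_subset)
    show "semi_inner_space.nrm (l2_inner M) = l2_norm M"
      using nrm_eq_l2_norm[OF semi_inner_L2_subset[OF R_sub RL]] .
  qed
  have R_L2: "h \<in> L2 M" if "h \<in> R" for h using that R_K K_L2 by auto
  \<comment> \<open>The orthogonal projection of \<open>k\<close> onto the range.\<close>
  have "\<exists>r\<in>R. \<forall>h\<in>R. l2_inner M h k = l2_inner M h r"
  proof (rule R.Riesz_representation)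
    fix h assume h: "h \<in> R"
    show "cmod (l2_inner M h k) \<le> l2_norm M k * l2_norm M h"
      using L2sp.Cauchy_Schwarz[of h M k] R_L2[OF h] k by (simp add: mult.commute)
  qed (use k R_L2 in \<open>simp_all add: L2sp.ip_add_left L2sp.ip_scale_left\<close>)
  then obtain r where r: "r \<in> R" "\<And>h. h \<in> R \<Longrightarrow> l2_inner M h k = l2_inner M h r" by blast
  define w where "w = k - r"
  have wK: "w \<in> K" unfolding w_def using k r(1) R_K fun_vs.subspace_diff[OF K_subspace] by blast
  have w_orth: "l2_inner M w h = 0" if "h \<in> R" for h
    using r(2)[OF that] R_L2[OF that] R_L2[OF r(1)] k L2sp.ip_commute[of h M w]
    by (simp add: w_def L2sp.ip_diff_right)
  obtain v where v: "solves (- \<kappa>) v w" using solves_minus_\<kappa>[OF wK] by blast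
  define c where "c = cnj (z + \<kappa>)"
  have orth: "l2_inner M u (w - cscale c v) = 0" if u: "u \<in> K" for u
  proof -
    obtain f where f: "solves (- \<kappa>) f u" using solves_minus_\<kappa>[OF u] by blast
    have fQ: "f \<in> Q" and vQ: "v \<in> Q" using f v solvesD by auto
    have "solves z f (u - cscale (z + \<kappa>) f)"
      unfolding solves_def
      using fQ u f fun_vs.subspace_diff[OF K_subspace] fun_vs.subspace_scale[OF K_subspace]
      by (auto simp: solvesD(3)[OF f] L2sp.ip_diff_right L2sp.ip_scale_right ring_distribs)
    then have "l2_inner M w (u - cscale (z + \<kappa>) f) = 0"
      using w_orth by (auto simp: R_def)
    then have "l2_inner M w u = (z + \<kappa>) * l2_inner M w f"
      using wK u fQ by (simp add: L2sp.ip_diff_right L2sp.ip_scale_right)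
    moreover have "l2_inner M w f = l2_inner M v u"
    proof -
      have "l2_inner M f w = ipQ f v"
        using solvesD(3)[OF v fQ] by (simp add: ipQ_def)
      moreover have "l2_inner M v u = ipQ v f"
        using solvesD(3)[OF f vQ] by (simp add: ipQ_def)
      ultimately show ?thesis
        using Qsp.ip_commute[OF fQ vQ] L2sp.ip_commute[of f M w] fQ wK by simp
    qed
    ultimately have "l2_inner M (w - cscale c v) u = 0"
      using wK u vQ by (simp add: L2sp.ip_diff_left L2sp.ip_scale_left c_def)
    then show ?thesis
      using L2sp.ip_commute[of "w - cscale c v" M u] wK u vQ by simp
  qed
  have vQ: "v \<in> Q" using v solvesD by auto
  have "w - cscale c v \<in> K"
    using wK vQ fun_vs.subspace_diff[OF K_subspace] fun_vs.subspace_scale[OF K_subspace] by auto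
  then have "l2_norm M (w - cscale c v) = 0"
    using orth L2sp.ip_self[of "w - cscale c v" M] by simp
  then have w_eq: "AE x in M. w x = cscale c v x"
    using L2_eq_AE_iff[of w M "cscale c v"] wK vQ by simp
  have cvQ: "cscale c v \<in> Q" using vQ by simp
  have w_in: "l2_inner M h w = c * l2_inner M h v" if h: "h \<in> Q" for h
    using l2_inner_cong_AE[of h h M w "cscale c v"] w_eq h wK vQ by (simp add: L2sp.ip_scale_right)
  have sc: "solves (cnj z) (cscale c v) 0"
    unfolding solves_def
  proof (intro conjI ballI)
    fix h assume h: "h \<in> Q"
    show "B h (cscale c v) - cnj z * l2_inner M h (cscale c v) = l2_inner M h 0"
    proof -
      have "B h v = cnj z * l2_inner M h v"
        using solvesD(3)[OF v h] w_in[OF h] by (simp add: c_def ring_distribs)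
      then show ?thesis using h vQ by (simp add: B_scale L2sp.ip_scale_right)
    qed
  qed (use cvQ fun_vs.subspace_0[OF K_subspace] in auto)
  have "l2_norm M (cscale c v) = 0"
  proof (rule ccontr)
    assume nz: "l2_norm M (cscale c v) \<noteq> 0"
    have "cnj z = z" using eigenvalue_real[OF sc nz] by (simp add: complex_eq_iff)
    then show False using no_ev[of "cscale c v"] sc nz by simp
  qed
  then have "l2_norm M w = 0" using l2_norm_cong_AE[OF w_eq K_L2[OF wK] Q_in_L2[OF cvQ]] by simp
  then have "AE x in M. k x = r x"
    using L2_eq_AE_iff[of k M r] k R_L2[OF r(1)] by (simp add: w_def)
  moreover obtain f where "solves z f r" using r(1) by (auto simp: R_def)
  ultimately have "solves z f k"
    unfolding solves_def using k R_L2[OF r(1)] by (auto intro: l2_inner_cong_AE)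
  then show ?thesis by blast
qed

lemma spectrum_imp_eigenvalue:
  assumes "z \<in> spectrum M K (form_operator M Q q)"
  shows "\<exists>f. solves z f 0 \<and> l2_norm M f \<noteq> 0"
proof (rule ccontr)
  assume neg: "\<not> ?thesis"
  then have no_ev: "\<And>f. solves z f 0 \<Longrightarrow> l2_norm M f = 0" by blast
  have "K \<subseteq> Range (shift_op (form_operator M Q q) z)"
    using solves_surj[OF no_ev] by (auto simp: Range_iff shift_op_iff)
  moreover have "\<exists>C. \<forall>(f, k)\<in>shift_op (form_operator M Q q) z. l2_norm M f \<le> C * l2_norm M k"
    using solves_bounded_below[of z, OF no_ev] by (simp add: split_beta' shift_op_iff Ball_def)
  ultimately have "z \<in> resolvent_set M K (form_operator M Q q)"
    by (simp add: resolvent_set_def)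
  then show False using assms by (simp add: spectrum_def)
qed

lemma eigenspace_iff: "f \<in> eigenspace (form_operator M Q q) z \<longleftrightarrow> solves z f 0"
proof -
  have "f \<in> eigenspace (form_operator M Q q) z \<longleftrightarrow> solves 0 f (cscale z f)"
    by (simp add: eigenspace_def form_operator_iff cscale_def)
  also have "\<dots> \<longleftrightarrow> solves z f 0"
    using fun_vs.subspace_0[OF K_subspace] fun_vs.subspace_scale[OF K_subspace]
    by (auto simp: solves_def L2sp.ip_scale_right)
  finally show ?thesis .
qed

lemma finite_eigenvalues_below:
  "finite {z. Re z \<le> \<mu> \<and> (\<exists>f. solves z f 0 \<and> l2_norm M f \<noteq> 0)}" (is "finite ?S")
proof (rule ccontr)
  assume "infinite ?S"
  then obtain z :: "nat \<Rightarrow> complex" where z: "inj z" "range z \<subseteq> ?S"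
    using infinite_countable_subset by blast
  have "\<exists>f. solves (z n) f 0 \<and> l2_norm M f = 1" for n
  proof -
    obtain f where f: "solves (z n) f 0" "l2_norm M f \<noteq> 0" using z(2) by auto
    define a where "a = complex_of_real (1 / l2_norm M f)"
    have "l2_norm M (cscale a f) = 1"
      using f L2sp.nrm_scale[of f M a] by (simp add: a_def norm_divide)
    moreover have "solves (z n) (cscale a f) 0"
      using solves_scale[OF f(1), of a] by simp
    ultimately show ?thesis by blast
  qed
  then obtain f where f: "\<And>n. solves (z n) (f n) 0" "\<And>n. l2_norm M (f n) = 1" by metis
  have fQ: "f n \<in> Q" for n using f(1) solvesD by blast
  have zr: "z n = complex_of_real (Re (z n))" for n using eigenvalue_real[OF f(1)] f(2) by simp
  have Bf: "B (f m) (f n) = complex_of_real (Re (z n)) * l2_inner M (f m) (f n)" for m n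
    using solvesD(3)[OF f(1) fQ, of n m] solvesD(3)[OF f(1) fQ, of m n] zr[of n] fQ by simp
  have on: "l2_inner M (f m) (f n) = (if m = n then 1 else 0)" for m n
  proof (cases "m = n")
    case True
    then show ?thesis using L2sp.ip_self[of "f n" M] f(2) fQ by simp
  next
    case False
    have "complex_of_real (Re (z n)) * l2_inner M (f m) (f n) = cnj (B (f n) (f m))"
      using Bf B_commute[OF fQ[of n] fQ[of m]] by simp
    also have "\<dots> = complex_of_real (Re (z m)) * l2_inner M (f m) (f n)"
      using Bf[of n m] L2sp.ip_commute[of "f n" M "f m"] fQ by simp
    finally have "l2_inner M (f m) (f n) = 0 \<or> Re (z n) = Re (z m)" by auto
    moreover have "Re (z n) \<noteq> Re (z m)"
      using z(1) False zr[of n] zr[of m] by (metis injD)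
    ultimately show ?thesis using False by simp
  qed
  show False
    by (rule no_orthonormal_sequence[of f "\<lambda>n. Re (z n)" \<mu>, OF fQ on Bf]) (use z(2) in auto)
qed

text \<open>In an eigenspace that no finite set spans, Gram-Schmidt would produce an infinite orthonormal
  sequence.\<close>
lemma finite_dim_eigenspace: "finite_dim M (eigenspace (form_operator M Q q) z)" (is "finite_dim M ?W")
proof (rule ccontr)
  assume nf: "\<not> finite_dim M ?W"
  define on where "on f n \<longleftrightarrow> (\<forall>i<n. solves z (f i) 0) \<and>
    (\<forall>i<n. \<forall>j<n. l2_inner M (f i) (f j) = (if i = j then 1 else 0))" for f :: "nat \<Rightarrow> 'a \<Rightarrow> complex" and n
  have step: "\<exists>g. solves z g 0 \<and> l2_norm M g = 1 \<and> (\<forall>i<n. l2_inner M (f i) g = 0)" if on: "on f n" for f n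
  proof -
    have f: "\<And>i. i < n \<Longrightarrow> solves z (f i) 0"
      and fon: "\<And>i j. i < n \<Longrightarrow> j < n \<Longrightarrow> l2_inner M (f i) (f j) = (if i = j then 1 else 0)"
      using on by (auto simp: on_def)
    have fL: "\<And>i. i < n \<Longrightarrow> f i \<in> L2 M" using f solves_in_L2 by blast
    have inj: "inj_on f {..<n}"
      using fon by (intro inj_onI) (metis lessThan_iff zero_neq_one)
    have "finite (f ` {..<n})" "f ` {..<n} \<subseteq> L2 M" using fL by auto
    then have "(\<forall>w\<in>?W. \<exists>c. AE x in M. w x = (\<Sum>b\<in>f ` {..<n}. c b * b x)) \<Longrightarrow> finite_dim M ?W"
      unfolding finite_dim_def by (intro exI[of _ "f ` {..<n}"] conjI)
    with nf have "\<not> (\<forall>w\<in>?W. \<exists>c. AE x in M. w x = (\<Sum>b\<in>f ` {..<n}. c b * b x))" by argo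
    then obtain w where w: "w \<in> ?W" "\<forall>c. \<not> (AE x in M. w x = (\<Sum>b\<in>f ` {..<n}. c b * b x))"
      unfolding Ball_def not_all not_imp not_ex by (elim exE conjE) (rule that)
    have sw: "solves z w 0" using w(1) by (simp add: eigenspace_iff)
    define p where "p = (\<Sum>i<n. cscale (l2_inner M (f i) w) (f i))"
    have "solves z p 0"
      unfolding p_def using f solves_scale[of z _ 0] by (intro solves_sum) fastforce
    then have sd: "solves z (w - p) 0" using solves_diff[OF sw] by fastforce
    have p_eq: "p x = (\<Sum>b\<in>f ` {..<n}. l2_inner M b w * b x)" for x
      using inj by (simp add: p_def sum_fun_apply sum.reindex)
    have pL: "p \<in> L2 M" using \<open>solves z p 0\<close> by simp
    have nz: "l2_norm M (w - p) \<noteq> 0"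
      using w(2)[rule_format, of "\<lambda>b. l2_inner M b w"] L2_eq_AE_iff[of w M p] sw pL by (simp add: p_eq)
    have orth: "l2_inner M (f i) (w - p) = 0" if i: "i < n" for i
    proof -
      have "l2_inner M (f i) p = l2_inner M (f i) w"
        unfolding p_def using i fL fon by (intro L2sp.ip_sum_orthonormal) auto
      then show ?thesis using fL[OF i] sw pL by (simp add: L2sp.ip_diff_right)
    qed
    define a where "a = complex_of_real (1 / l2_norm M (w - p))"
    have dL: "w - p \<in> L2 M" using sd by simp
    have "l2_norm M (cscale a (w - p)) = 1"
      using nz L2sp.nrm_scale[OF dL, of a] by (simp add: a_def norm_divide)
    moreover have "solves z (cscale a (w - p)) 0"
      using solves_scale[OF sd, of a] by simp
    moreover have "\<forall>i<n. l2_inner M (f i) (cscale a (w - p)) = 0"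
      using orth fL dL by (simp add: L2sp.ip_scale_right)
    ultimately show ?thesis by blast
  qed
  have "\<exists>f::nat \<Rightarrow> 'a \<Rightarrow> complex. \<forall>n. on f n \<longrightarrow>
      solves z (f n) 0 \<and> l2_norm M (f n) = 1 \<and> (\<forall>i<n. l2_inner M (f i) (f n) = 0)"
  proof (rule dependent_wf_choice[of less_than "\<lambda>f n g. on f n \<longrightarrow>
      solves z g 0 \<and> l2_norm M g = 1 \<and> (\<forall>i<n. l2_inner M (f i) g = 0)"])
    show "(on f n \<longrightarrow> solves z r 0 \<and> l2_norm M r = 1 \<and> (\<forall>i<n. l2_inner M (f i) r = 0)) =
        (on g n \<longrightarrow> solves z r 0 \<and> l2_norm M r = 1 \<and> (\<forall>i<n. l2_inner M (g i) r = 0))"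
      if "\<And>y. (y, n) \<in> less_than \<Longrightarrow> f y = g y" for f g n r
      using that by (simp add: on_def)
  qed (use step in auto)
  then obtain f where f: "\<And>n. on f n \<Longrightarrow>
      solves z (f n) 0 \<and> l2_norm M (f n) = 1 \<and> (\<forall>i<n. l2_inner M (f i) (f n) = 0)" by blast
  have onf: "on f n" for n
  proof (induction n)
    case 0
    show ?case by (simp add: on_def)
  next
    case (Suc n)
    note fn = f[OF Suc.IH]
    have fL: "f i \<in> L2 M" if "i \<le> n" for i
      using that fn Suc.IH unfolding on_def by (metis le_neq_implies_less solves_in_L2(1))
    have "l2_inner M (f n) (f n) = 1" using fn fL[of n] L2sp.ip_self[of "f n" M] by simp
    moreover have "l2_inner M (f n) (f i) = 0" if "i < n" for i
      using that fn L2sp.ip_commute[of "f i" M "f n"] fL by simp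
    ultimately show ?case using Suc.IH fn by (auto simp: on_def less_Suc_eq)
  qed
  have s: "solves z (f n) 0" and n1: "l2_norm M (f n) = 1" for n using f[OF onf] by auto
  have fQ: "f n \<in> Q" for n using s solvesD by blast
  have zr: "z = complex_of_real (Re z)" using eigenvalue_real[OF s] n1 by simp
  show False
  proof (rule no_orthonormal_sequence[of f "\<lambda>_. Re z" "Re z"])
    show "l2_inner M (f m) (f n) = (if m = n then 1 else 0)" for m n
      using onf[of "Suc (max m n)"] by (auto simp: on_def)
    show "B (f m) (f n) = complex_of_real (Re z) * l2_inner M (f m) (f n)" for m n
      using solvesD(3)[OF s fQ, of n m] solvesD(3)[OF s fQ, of m n] zr fQ by simp
  qed (use fQ in simp_all)
qed

text \<open>Every spectral point is an eigenvalue of finite multiplicity, and only finitely many eigenvalues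
  lie to the left of any vertical line, in particular near the given one.\<close>
theorem purely_discrete: "purely_discrete_spectrum M (l2_closure M Q) (form_operator M Q q)"
proof -
  have "z \<in> discrete_spectrum M K (form_operator M Q q)"
    if z: "z \<in> spectrum M K (form_operator M Q q)" for z
  proof -
    obtain f where f: "solves z f 0" "l2_norm M f \<noteq> 0" using spectrum_imp_eigenvalue[OF z] by blast
    define E where "E = {w. Re w \<le> Re z + 1 \<and> (\<exists>f. solves w f 0 \<and> l2_norm M f \<noteq> 0)} - {z}"
    have "finite E" unfolding E_def using finite_eigenvalues_below by simp
    then have op: "open (ball z 1 - E)" by (intro open_Diff finite_imp_closed) auto
    have "w = z" if w: "w \<in> ball z 1 - E" "w \<in> spectrum M K (form_operator M Q q)" for w
    proof -
      have "Re w - Re z \<le> cmod (w - z)" using complex_Re_le_cmod[of "w - z"] by simp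
      also have "\<dots> < 1" using w(1) by (simp add: dist_norm norm_minus_commute)
      finally have "Re w \<le> Re z + 1" by simp
      then show ?thesis using spectrum_imp_eigenvalue[OF w(2)] w(1) by (auto simp: E_def)
    qed
    moreover have "z \<in> ball z 1 - E" by (simp add: E_def)
    ultimately have "z isolated_in spectrum M K (form_operator M Q q)"
      unfolding isolated_in_def using op z by blast
    moreover have "f \<in> eigenspace (form_operator M Q q) z" "\<not> (AE x in M. f x = 0)"
      using f l2_norm_zero_iff[of f M] by (auto simp: eigenspace_iff)
    ultimately show ?thesis using finite_dim_eigenspace by (auto simp: discrete_spectrum_def)
  qed
  then show ?thesis
    by (auto simp: purely_discrete_spectrum_def essential_spectrum_def simp flip: K_def)
qed

end

section \<open>Functional calculus of a projection-valued measure\<close>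

lemma polarize_alt:
  "polarize q h f = (\<Sum>k<4::nat. cnj (\<i> ^ k) * complex_of_real (q (h + cscale (\<i> ^ k) f))) / 4"
  by (simp add: polarize_def plus_fun_def)

lemma sum_lessThan_4: "(\<Sum>k<4::nat. F k) = F 0 + F 1 + F 2 + F (3::nat)" for F :: "nat \<Rightarrow> complex"
  by (simp add: eval_nat_numeral add.assoc)

text \<open>A sesquilinear form is determined by its diagonal. Below, this turns identities between integrals
  against the measures \<open>\<nu> u\<close>, which depend quadratically on \<open>u\<close>, into linear and multiplicative laws
  for operators.\<close>
lemma polarize_eq_sesquilinear:
  assumes D: "fun_vs.subspace D" and h: "h \<in> D" and f: "f \<in> D"
    and add: "\<And>u v w. u \<in> D \<Longrightarrow> v \<in> D \<Longrightarrow> w \<in> D \<Longrightarrow> \<beta> u (v + w) = \<beta> u v + \<beta> u w"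
    and scale: "\<And>u v a. u \<in> D \<Longrightarrow> v \<in> D \<Longrightarrow> \<beta> u (cscale a v) = a * \<beta> u v"
    and herm: "\<And>u v. u \<in> D \<Longrightarrow> v \<in> D \<Longrightarrow> \<beta> v u = cnj (\<beta> u v)"
    and diag: "\<And>u. u \<in> D \<Longrightarrow> \<beta> u u = complex_of_real (q u)"
  shows "polarize q h f = \<beta> h f"
proof -
  have "complex_of_real (q (h + cscale a f)) = \<beta> h h + a * \<beta> h f + cnj (a * \<beta> h f) + a * cnj a * \<beta> f f" for a
  proof -
    define g where "g = cscale a f"
    have g: "g \<in> D" "h + g \<in> D"
      using h f fun_vs.subspace_add[OF D] fun_vs.subspace_scale[OF D] by (auto simp: g_def)
    have "\<beta> (h + g) h = cnj (\<beta> h h + \<beta> h g)"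
      using herm[OF h g(2)] add[OF h h g(1)] by metis
    moreover have "\<beta> (h + g) g = cnj (\<beta> g h + \<beta> g g)"
      using herm[OF g(1) g(2)] add[OF g(1) h g(1)] by metis
    ultimately have "\<beta> (h + g) h + \<beta> (h + g) g = \<beta> h h + cnj (\<beta> h g) + \<beta> h g + \<beta> g g"
      using herm[OF h h] herm[OF h g(1)] herm[OF g(1) g(1)] by simp
    then have "complex_of_real (q (h + g)) = \<beta> h h + cnj (\<beta> h g) + \<beta> h g + \<beta> g g"
      using diag[OF g(2)] add[OF g(2) h g(1)] by metis
    moreover have "\<beta> h g = a * \<beta> h f" using scale h f by (simp add: g_def)
    moreover have "\<beta> g g = a * cnj a * \<beta> f f"
      using scale[OF g(1) f, of a] herm[OF f g(1)] scale[OF f f, of a] herm[OF f f] by (simp add: g_def)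
    ultimately show ?thesis by (simp add: g_def)
  qed
  note expand = this
  have i3: "\<i> ^ 3 = - \<i>" by (simp add: eval_nat_numeral)
  show ?thesis
    unfolding polarize_alt expand sum_lessThan_4 i3
    by (simp add: algebra_simps)
qed

locale pvm =
  fixes M :: "'a measure" and E :: "real set \<Rightarrow> ('a \<Rightarrow> complex) \<Rightarrow> ('a \<Rightarrow> complex)"
  assumes pvm: "projection_valued_measure M E"
begin

abbreviation "\<nu> \<equiv> spectral_dist M E"

lemma E_L2 [simp]: "S \<in> sets borel \<Longrightarrow> f \<in> L2 M \<Longrightarrow> E S f \<in> L2 M"
  using pvm by (simp add: projection_valued_measure_def)

lemma E_sym: "S \<in> sets borel \<Longrightarrow> f \<in> L2 M \<Longrightarrow> g \<in> L2 M \<Longrightarrow> l2_inner M f (E S g) = l2_inner M (E S f) g"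
  using pvm by (simp add: projection_valued_measure_def)

lemma E_mult: "S \<in> sets borel \<Longrightarrow> T \<in> sets borel \<Longrightarrow> f \<in> L2 M \<Longrightarrow> AE x in M. E S (E T f) x = E (S \<inter> T) f x"
  using pvm by (simp add: projection_valued_measure_def)

lemma E_UNIV: "f \<in> L2 M \<Longrightarrow> AE x in M. E UNIV f x = f x"
  using pvm by (simp add: projection_valued_measure_def)

lemma E_sigma:
  assumes "f \<in> L2 M" "range S \<subseteq> sets borel" "disjoint_family (S :: nat \<Rightarrow> real set)"
  shows "(\<lambda>n. l2_norm M (E (\<Union>i. S i) f - (\<Sum>i<n. E (S i) f))) \<longlonglongrightarrow> 0"
proof -
  have eq: "(\<lambda>x. E (\<Union>i. S i) f x - (\<Sum>i<n. E (S i) f x)) = E (\<Union>i. S i) f - (\<Sum>i<n. E (S i) f)" for n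
    by (simp add: fun_eq_iff sum_fun_apply)
  have "(\<lambda>n. l2_norm M (\<lambda>x. E (\<Union>i. S i) f x - (\<Sum>i<n. E (S i) f x))) \<longlonglongrightarrow> 0"
    using pvm assms unfolding projection_valued_measure_def by simp
  then show ?thesis by (simp only: eq)
qed

lemma inner_E_E:
  assumes "S \<in> sets borel" "T \<in> sets borel" "f \<in> L2 M" "g \<in> L2 M"
  shows "l2_inner M (E S f) (E T g) = l2_inner M f (E (S \<inter> T) g)"
proof -
  have "l2_inner M (E S f) (E T g) = l2_inner M f (E S (E T g))"
    using assms by (simp add: E_sym)
  also have "\<dots> = l2_inner M f (E (S \<inter> T) g)"
    using assms by (intro l2_inner_cong_AE E_mult) auto
  finally show ?thesis .
qed

lemma inner_E_self: "S \<in> sets borel \<Longrightarrow> f \<in> L2 M \<Longrightarrow> l2_inner M f (E S f) = complex_of_real ((l2_norm M (E S f))\<^sup>2)"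
  using inner_E_E[of S S f f] L2sp.ip_self[of "E S f" M] by simp

text \<open>Additivity for the constant family of empty sets: the norms of \<open>(1 - n) E {} f\<close> tend to zero.\<close>
lemma E_empty: assumes f: "f \<in> L2 M" shows "l2_norm M (E {} f) = 0"
proof (rule ccontr)
  define a where "a = E {} f"
  have a: "a \<in> L2 M" using f by (simp add: a_def)
  assume "l2_norm M (E {} f) \<noteq> 0"
  then have pos: "l2_norm M a > 0" by (simp add: a_def less_le)
  have "(\<lambda>n. l2_norm M (E (\<Union>i::nat. {}) f - (\<Sum>i<n. E {} f))) \<longlonglongrightarrow> 0"
    using E_sigma[OF f, of "\<lambda>_. {}"] by (simp add: disjoint_family_on_def)
  then have lim0: "(\<lambda>n. l2_norm M (a - (\<Sum>i<n. a))) \<longlonglongrightarrow> 0" by (simp add: a_def)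
  obtain N :: nat where N: "\<And>n. n \<ge> N \<Longrightarrow> l2_norm M (a - (\<Sum>i<n. a)) < l2_norm M a"
    using order_tendstoD(2)[OF lim0 pos] unfolding eventually_sequentially by blast
  define n :: nat where "n = N + 2"
  have "a - (\<Sum>i<n. a) = cscale (1 - of_nat n) a"
    by (simp add: fun_eq_iff sum_fun_apply algebra_simps)
  then have "l2_norm M (a - (\<Sum>i<n. a)) = cmod (1 - of_nat n) * l2_norm M a"
    using L2sp.nrm_scale[OF a] by simp
  moreover have "cmod (1 - of_nat n) = real n - 1"
  proof -
    have "(1::complex) - of_nat n = complex_of_real (1 - real n)" by simp
    then show ?thesis by (simp only: norm_of_real) (simp add: n_def)
  qed
  moreover have "real n - 1 \<ge> 1" by (simp add: n_def)
  ultimately have "l2_norm M (a - (\<Sum>i<n. a)) \<ge> 1 * l2_norm M a"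
    using pos by (simp only: mult_right_mono less_imp_le)
  then show False using N[of n] by (simp add: n_def)
qed

lemma sets_\<nu> [simp, measurable_cong]: "sets (\<nu> f) = sets borel"
  unfolding spectral_dist_def using sets.sigma_sets_eq[of "borel :: real measure"] by (simp add: sets_measure_of)

lemma space_\<nu> [simp]: "space (\<nu> f) = UNIV"
  by (simp add: spectral_dist_def space_measure_of)

lemma emeasure_\<nu>:
  assumes f: "f \<in> L2 M" and S: "S \<in> sets borel"
  shows "emeasure (\<nu> f) S = ennreal ((l2_norm M (E S f))\<^sup>2)"
proof -
  let ?m = "\<lambda>S. ennreal (Re (l2_inner M f (E S f)))"
  have "emeasure (\<nu> f) S = ?m S"
  proof (rule emeasure_measure_of[OF spectral_dist_def])
    show "positive (sets (\<nu> f)) ?m"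
      using inner_E_self[OF _ f, of "{}"] E_empty[OF f] by (simp add: positive_def)
    show "countably_additive (sets (\<nu> f)) ?m"
    proof (rule countably_additiveI)
      fix A :: "nat \<Rightarrow> real set"
      assume A: "range A \<subseteq> sets (\<nu> f)" "disjoint_family A"
      have Ab: "A i \<in> sets borel" for i using A(1) by auto
      have Ub: "(\<Union>i. A i) \<in> sets borel" using Ab by auto
      have sumL: "(\<Sum>i<n. E (A i) f) \<in> L2 M" for n using Ab f by (intro L2sp.H_sum) auto
      have "L2sp.converges_to M (\<lambda>n. \<Sum>i<n. E (A i) f) (E (\<Union>i. A i) f)"
        unfolding L2sp.converges_to_def
        using E_sigma[OF f, of A] A Ub f L2sp.nrm_diff_commute[OF sumL E_L2[OF Ub f]] by simp
      then have "(\<lambda>n. l2_inner M f (\<Sum>i<n. E (A i) f)) \<longlonglongrightarrow> l2_inner M f (E (\<Union>i. A i) f)"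
        using Ub f sumL by (intro L2sp.ip_tendsto_right) auto
      then have "(\<lambda>n. Re (l2_inner M f (\<Sum>i<n. E (A i) f))) \<longlonglongrightarrow> Re (l2_inner M f (E (\<Union>i. A i) f))"
        by (rule tendsto_Re)
      moreover have "Re (l2_inner M f (\<Sum>i<n. E (A i) f)) = (\<Sum>i<n. Re (l2_inner M f (E (A i) f)))" for n
        using Ab f by (subst L2sp.ip_sum_right) auto
      ultimately have "(\<lambda>i. Re (l2_inner M f (E (A i) f))) sums Re (l2_inner M f (E (\<Union>i. A i) f))"
        by (simp add: sums_def)
      then show "(\<Sum>i. ?m (A i)) = ?m (\<Union>i. A i)"
        using inner_E_self[OF Ab f] by (intro suminf_ennreal_eq) simp_all
    qed
  qed (use S in auto)
  then show ?thesis using inner_E_self[OF S f] by simp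
qed

lemma finite_measure_\<nu>: "f \<in> L2 M \<Longrightarrow> finite_measure (\<nu> f)"
  by (rule finite_measureI) (simp add: emeasure_\<nu>)

lemma measure_\<nu>: "f \<in> L2 M \<Longrightarrow> S \<in> sets borel \<Longrightarrow> measure (\<nu> f) S = (l2_norm M (E S f))\<^sup>2"
  by (simp add: emeasure_\<nu> measure_def)

lemma inner_E_measure: "f \<in> L2 M \<Longrightarrow> S \<in> sets borel \<Longrightarrow> l2_inner M f (E S f) = complex_of_real (measure (\<nu> f) S)"
  by (simp add: measure_\<nu> inner_E_self)

lemma measure_\<nu>_UNIV: "f \<in> L2 M \<Longrightarrow> measure (\<nu> f) UNIV = (l2_norm M f)\<^sup>2"
  using l2_norm_cong_AE[OF E_UNIV, of f] by (simp add: measure_\<nu>)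

lemma \<nu>_cong_AE:
  assumes fg: "AE x in M. f x = g x" and f: "f \<in> L2 M" and g: "g \<in> L2 M"
  shows "\<nu> f = \<nu> g"
proof (rule measure_eqI)
  fix S assume "S \<in> sets (\<nu> f)"
  then have S: "S \<in> sets borel" by simp
  have "AE x in M. E S f x = E S g x"
  proof (rule L2_AE_eqI)
    fix h assume h: "h \<in> L2 M"
    have "l2_inner M (E S h) f = l2_inner M (E S h) g"
      using fg f g h S by (intro l2_inner_cong_AE) auto
    then show "l2_inner M h (E S f) = l2_inner M h (E S g)"
      using E_sym[OF S h f] E_sym[OF S h g] by simp
  qed (use S f g in auto)
  then have "l2_norm M (E S f) = l2_norm M (E S g)"
    by (rule l2_norm_cong_AE) (use S f g in auto)
  then show "emeasure (\<nu> f) S = emeasure (\<nu> g) S" using S f g by (simp add: emeasure_\<nu>)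
qed simp

text \<open>The operator \<open>\<integral> \<sigma> dE\<close> for a simple function \<open>\<sigma>\<close>.\<close>
definition Phi :: "(real \<Rightarrow> real) \<Rightarrow> ('a \<Rightarrow> complex) \<Rightarrow> ('a \<Rightarrow> complex)" where
  "Phi \<sigma> f = (\<Sum>c\<in>range \<sigma>. cscale (complex_of_real c) (E (\<sigma> -` {c}) f))"

lemma simple_borelD:
  assumes "simple_function (borel :: real measure) \<sigma>"
  shows "finite (range \<sigma>)" "\<sigma> -` X \<in> sets borel"
  using simple_functionD[OF assms] by auto

lemma simple_bounded:
  fixes \<sigma> :: "real \<Rightarrow> real"
  assumes "simple_function borel \<sigma>" shows "\<exists>b>0. \<forall>t. \<bar>\<sigma> t\<bar> \<le> b"
  using finite_imp_bounded[OF simple_borelD(1)[OF assms]] by (auto simp: bounded_pos)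

lemma simple_measurable: "simple_function borel \<sigma> \<Longrightarrow> \<sigma> \<in> borel_measurable (\<nu> f)" for \<sigma> :: "real \<Rightarrow> real"
  using borel_measurable_simple_function[of borel \<sigma>] measurable_cong_sets[OF sets_\<nu> refl] by blast

lemma bounded_integrable:
  fixes \<phi> :: "real \<Rightarrow> real"
  assumes "f \<in> L2 M" "\<phi> \<in> borel_measurable borel" "\<And>t. \<bar>\<phi> t\<bar> \<le> b"
  shows "integrable (\<nu> f) \<phi>"
proof -
  interpret finite_measure "\<nu> f" using assms(1) by (rule finite_measure_\<nu>)
  show ?thesis using assms(2,3) by (intro integrable_const_bound[of _ b]) auto
qed

lemma simple_integrable: "f \<in> L2 M \<Longrightarrow> simple_function borel \<sigma> \<Longrightarrow> integrable (\<nu> f) \<sigma>" for \<sigma> :: "real \<Rightarrow> real"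
  using simple_bounded[of \<sigma>] borel_measurable_simple_function[of borel \<sigma>] bounded_integrable by blast

lemma Phi_L2 [simp]: "f \<in> L2 M \<Longrightarrow> simple_function borel \<sigma> \<Longrightarrow> Phi \<sigma> f \<in> L2 M"
  unfolding Phi_def using simple_borelD(2)[of \<sigma>] by (intro L2sp.H_sum L2_cscale E_L2)

lemma inner_Phi_Phi:
  assumes h: "h \<in> L2 M" and f: "f \<in> L2 M" and s: "simple_function borel \<sigma>" and t: "simple_function borel \<tau>"
  shows "l2_inner M (Phi \<sigma> h) (Phi \<tau> f) =
    (\<Sum>c\<in>range \<sigma>. \<Sum>d\<in>range \<tau>. complex_of_real (c * d) * l2_inner M h (E (\<sigma> -` {c} \<inter> \<tau> -` {d}) f))"
proof -
  note b = simple_borelD(2)[OF s] simple_borelD(2)[OF t]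
  have "l2_inner M (Phi \<sigma> h) (Phi \<tau> f) = (\<Sum>c\<in>range \<sigma>. l2_inner M (cscale (complex_of_real c) (E (\<sigma> -` {c}) h)) (Phi \<tau> f))"
    unfolding Phi_def[of \<sigma>] using f t b h by (intro L2sp.ip_sum_left) auto
  also have "\<dots> = (\<Sum>c\<in>range \<sigma>. \<Sum>d\<in>range \<tau>. complex_of_real (c * d) * l2_inner M h (E (\<sigma> -` {c} \<inter> \<tau> -` {d}) f))"
  proof (rule sum.cong[OF refl])
    fix c
    have "l2_inner M (cscale (complex_of_real c) (E (\<sigma> -` {c}) h)) (Phi \<tau> f)
      = (\<Sum>d\<in>range \<tau>. l2_inner M (cscale (complex_of_real c) (E (\<sigma> -` {c}) h)) (cscale (complex_of_real d) (E (\<tau> -` {d}) f)))"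
      unfolding Phi_def using f h b by (intro L2sp.ip_sum_right) auto
    also have "\<dots> = (\<Sum>d\<in>range \<tau>. complex_of_real (c * d) * l2_inner M h (E (\<sigma> -` {c} \<inter> \<tau> -` {d}) f))"
      using f h b by (intro sum.cong) (auto simp: L2sp.ip_scale_left L2sp.ip_scale_right inner_E_E L2_cscale)
    finally show "l2_inner M (cscale (complex_of_real c) (E (\<sigma> -` {c}) h)) (Phi \<tau> f) = \<dots>" .
  qed
  finally show ?thesis .
qed

lemma inner_Phi_Phi_self:
  assumes f: "f \<in> L2 M" and s: "simple_function borel \<sigma>" and t: "simple_function borel \<tau>"
  shows "l2_inner M (Phi \<sigma> f) (Phi \<tau> f) = complex_of_real (LINT x|\<nu> f. \<sigma> x * \<tau> x)"
proof -
  interpret finite_measure "\<nu> f" using f by (rule finite_measure_\<nu>)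
  note b = simple_borelD(2)[OF s] simple_borelD(2)[OF t]
  note fin = simple_borelD(1)[OF s] simple_borelD(1)[OF t]
  have st: "\<sigma> x * \<tau> x = (\<Sum>c\<in>range \<sigma>. \<Sum>d\<in>range \<tau>. c * d * indicator (\<sigma> -` {c} \<inter> \<tau> -` {d}) x)" for x
  proof -
    have "(\<Sum>c\<in>range \<sigma>. \<Sum>d\<in>range \<tau>. c * d * indicator (\<sigma> -` {c} \<inter> \<tau> -` {d}) x)
       = (\<Sum>c\<in>range \<sigma>. if c = \<sigma> x then (\<Sum>d\<in>range \<tau>. if d = \<tau> x then \<sigma> x * \<tau> x else 0) else 0)"
      by (intro sum.cong refl) (auto simp: indicator_def intro!: sum.cong)
    also have "\<dots> = \<sigma> x * \<tau> x" using fin by simp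
    finally show ?thesis by simp
  qed
  have "(LINT x|\<nu> f. \<sigma> x * \<tau> x) = (\<Sum>c\<in>range \<sigma>. \<Sum>d\<in>range \<tau>. c * d * measure (\<nu> f) (\<sigma> -` {c} \<inter> \<tau> -` {d}))"
    unfolding st using b
    by (subst Bochner_Integration.integral_sum; (intro Bochner_Integration.integrable_sum)?; auto simp: emeasure_eq_measure)
  then show ?thesis
    using f b by (simp add: inner_Phi_Phi[OF f f s t] inner_E_measure)
qed

lemma nrm_Phi_sq: "f \<in> L2 M \<Longrightarrow> simple_function borel \<sigma> \<Longrightarrow> (l2_norm M (Phi \<sigma> f))\<^sup>2 = (LINT x|\<nu> f. (\<sigma> x)\<^sup>2)"
  using inner_Phi_Phi_self[of f \<sigma> \<sigma>] L2sp.ip_self[of "Phi \<sigma> f" M]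
  by (simp add: power2_eq_square flip: of_real_mult)

lemma Phi_isometry:
  assumes f: "f \<in> L2 M" and s: "simple_function borel \<sigma>" and t: "simple_function borel \<tau>"
  shows "(l2_norm M (Phi \<sigma> f - Phi \<tau> f))\<^sup>2 = (LINT x|\<nu> f. (\<sigma> x - \<tau> x)\<^sup>2)"
proof -
  have int: "integrable (\<nu> f) (\<lambda>x. (\<sigma> x)\<^sup>2)" "integrable (\<nu> f) (\<lambda>x. (\<tau> x)\<^sup>2)" "integrable (\<nu> f) (\<lambda>x. \<sigma> x * \<tau> x)"
    using f s t by (auto intro!: simple_integrable intro: simple_function_compose1 simple_function_compose2)
  have "(l2_norm M (Phi \<sigma> f - Phi \<tau> f))\<^sup>2 = (LINT x|\<nu> f. (\<sigma> x)\<^sup>2) - 2 * (LINT x|\<nu> f. \<sigma> x * \<tau> x) + (LINT x|\<nu> f. (\<tau> x)\<^sup>2)"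
    using f s t by (simp add: L2sp.nrm_sq_diff nrm_Phi_sq inner_Phi_Phi_self)
  also have "\<dots> = (LINT x|\<nu> f. (\<sigma> x)\<^sup>2 - 2 * (\<sigma> x * \<tau> x) + (\<tau> x)\<^sup>2)"
    using int by simp
  also have "\<dots> = (LINT x|\<nu> f. (\<sigma> x - \<tau> x)\<^sup>2)"
    by (simp add: power2_diff mult.assoc algebra_simps)
  finally show ?thesis .
qed

lemma Phi_sym:
  assumes h: "h \<in> L2 M" and f: "f \<in> L2 M" and s: "simple_function borel \<sigma>"
  shows "l2_inner M h (Phi \<sigma> f) = l2_inner M (Phi \<sigma> h) f"
proof -
  note b = simple_borelD(2)[OF s]
  have "l2_inner M h (Phi \<sigma> f) = (\<Sum>c\<in>range \<sigma>. complex_of_real c * l2_inner M h (E (\<sigma> -` {c}) f))"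
    unfolding Phi_def using h f b by (subst L2sp.ip_sum_right) (auto simp: L2sp.ip_scale_right)
  also have "\<dots> = l2_inner M (Phi \<sigma> h) f"
    unfolding Phi_def using h f b by (subst L2sp.ip_sum_left) (auto simp: L2sp.ip_scale_left E_sym)
  finally show ?thesis .
qed

lemma inner_Phi_self:
  assumes f: "f \<in> L2 M" and s: "simple_function borel \<sigma>"
  shows "l2_inner M f (Phi \<sigma> f) = complex_of_real (LINT x|\<nu> f. \<sigma> x)"
proof -
  have one: "simple_function borel (\<lambda>_::real. 1::real)" by simp
  have "Phi (\<lambda>_. 1) f = E UNIV f" by (simp add: Phi_def vimage_def)
  then have "AE x in M. Phi (\<lambda>_. 1) f x = f x" using E_UNIV[OF f] by simp
  then have "l2_inner M f (Phi \<sigma> f) = l2_inner M (Phi (\<lambda>_. 1) f) (Phi \<sigma> f)"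
    using f s one by (intro l2_inner_cong_AE) auto
  then show ?thesis using inner_Phi_Phi_self[OF f one s] by simp
qed

lemma Phi_add_AE:
  assumes f: "f \<in> L2 M" and g: "g \<in> L2 M" and s: "simple_function borel \<sigma>"
  shows "AE x in M. Phi \<sigma> (f + g) x = (Phi \<sigma> f + Phi \<sigma> g) x"
  using f g s L2_AE_eqI[of "Phi \<sigma> (f + g)" M "Phi \<sigma> f + Phi \<sigma> g"]
  by (simp add: Phi_sym L2sp.ip_add_right L2_add)

lemma Phi_scale_AE:
  assumes f: "f \<in> L2 M" and s: "simple_function borel \<sigma>"
  shows "AE x in M. Phi \<sigma> (cscale a f) x = cscale a (Phi \<sigma> f) x"
  using f s L2_AE_eqI[of "Phi \<sigma> (cscale a f)" M "cscale a (Phi \<sigma> f)"]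
  by (simp add: Phi_sym L2sp.ip_scale_right L2_cscale)

lemma Phi_add:
  assumes f: "f \<in> L2 M" and g: "g \<in> L2 M" and s: "simple_function borel \<sigma>"
  shows "l2_norm M (Phi \<sigma> (f + g)) = l2_norm M (Phi \<sigma> f + Phi \<sigma> g)"
proof -
  have "AE x in M. Phi \<sigma> (f + g) x = (Phi \<sigma> f + Phi \<sigma> g) x"
    using f g s by (rule Phi_add_AE)
  then show ?thesis by (rule l2_norm_cong_AE[where f' = "Phi \<sigma> f + Phi \<sigma> g"]) (use f g s in \<open>simp_all only: Phi_L2 L2_add\<close>)
qed

lemma Phi_scale:
  assumes f: "f \<in> L2 M" and s: "simple_function borel \<sigma>"
  shows "l2_norm M (Phi \<sigma> (cscale a f)) = cmod a * l2_norm M (Phi \<sigma> f)"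
proof -
  have "AE x in M. Phi \<sigma> (cscale a f) x = cscale a (Phi \<sigma> f) x"
    using f s by (rule Phi_scale_AE)
  then have "l2_norm M (Phi \<sigma> (cscale a f)) = l2_norm M (cscale a (Phi \<sigma> f))"
    by (rule l2_norm_cong_AE[where f' = "cscale a (Phi \<sigma> f)"]) (use f s in \<open>simp_all only: Phi_L2 L2_cscale\<close>)
  then show ?thesis using f s by (simp add: L2sp.nrm_scale)
qed

lemma Phi_diff:
  assumes f: "f \<in> L2 M" and g: "g \<in> L2 M" and s: "simple_function borel \<sigma>"
  shows "l2_norm M (Phi \<sigma> (f - g)) = l2_norm M (Phi \<sigma> f - Phi \<sigma> g)"
proof -
  have "AE x in M. Phi \<sigma> (f - g) x = (Phi \<sigma> f - Phi \<sigma> g) x"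
    using f g s L2_AE_eqI[of "Phi \<sigma> (f - g)" M "Phi \<sigma> f - Phi \<sigma> g"]
    by (simp add: Phi_sym L2sp.ip_diff_right)
  then show ?thesis
    by (rule l2_norm_cong_AE[where f' = "Phi \<sigma> f - Phi \<sigma> g"]) (use f g s in \<open>simp_all only: Phi_L2 L2sp.H_closed\<close>)
qed

lemma Phi_bounded:
  assumes f: "f \<in> L2 M" and s: "simple_function borel \<sigma>" and b: "\<And>t. \<bar>\<sigma> t\<bar> \<le> b"
  shows "l2_norm M (Phi \<sigma> f) \<le> b * l2_norm M f"
proof (rule power2_le_imp_le)
  interpret finite_measure "\<nu> f" using f by (rule finite_measure_\<nu>)
  show b0: "0 \<le> b * l2_norm M f" using b[of 0] by simp
  have "(l2_norm M (Phi \<sigma> f))\<^sup>2 = (LINT x|\<nu> f. (\<sigma> x)\<^sup>2)" using f s by (rule nrm_Phi_sq)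
  also have "\<dots> \<le> (LINT x|\<nu> f. b\<^sup>2)"
  proof (rule integral_mono)
    show "integrable (\<nu> f) (\<lambda>x. (\<sigma> x)\<^sup>2)"
      by (rule simple_integrable[OF f simple_function_compose1[OF s]])
    show "(\<sigma> x)\<^sup>2 \<le> b\<^sup>2" for x using b[of x] by (metis abs_ge_zero power2_abs power_mono)
  qed simp
  also have "\<dots> = (b * l2_norm M f)\<^sup>2"
    using measure_\<nu>_UNIV[OF f] by (simp add: power_mult_distrib)
  finally show "(l2_norm M (Phi \<sigma> f))\<^sup>2 \<le> (b * l2_norm M f)\<^sup>2" .
qed

lemma polarize_Phi:
  assumes h: "h \<in> L2 M" and f: "f \<in> L2 M" and s: "simple_function borel \<sigma>"
  shows "polarize (\<lambda>u. LINT t|\<nu> u. \<sigma> t) h f = l2_inner M h (Phi \<sigma> f)"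
proof (rule polarize_eq_sesquilinear[OF L2_subspace h f])
  fix u v w :: "'a \<Rightarrow> complex" and a assume u: "u \<in> L2 M" and v: "v \<in> L2 M"
  show "l2_inner M u (Phi \<sigma> (cscale a v)) = a * l2_inner M u (Phi \<sigma> v)"
    using u v s by (simp add: Phi_sym L2sp.ip_scale_right L2_cscale)
  show "l2_inner M v (Phi \<sigma> u) = cnj (l2_inner M u (Phi \<sigma> v))"
    using u v s L2sp.ip_commute[of u M "Phi \<sigma> v"] by (simp add: Phi_sym)
  show "l2_inner M u (Phi \<sigma> u) = complex_of_real (LINT t|\<nu> u. \<sigma> t)"
    using u s by (rule inner_Phi_self)
  assume w: "w \<in> L2 M"
  show "l2_inner M u (Phi \<sigma> (v + w)) = l2_inner M u (Phi \<sigma> v) + l2_inner M u (Phi \<sigma> w)"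
    using u v w s by (simp add: Phi_sym L2sp.ip_add_right L2_add)
qed

text \<open>Both sides have the same quadratic form \<open>u \<mapsto> \<integral> \<tau> \<sigma> d\<nu> u\<close>.\<close>
lemma Phi_mult:
  assumes f: "f \<in> L2 M" and s: "simple_function borel \<sigma>" and t: "simple_function borel \<tau>"
  shows "AE x in M. Phi \<tau> (Phi \<sigma> f) x = Phi (\<lambda>t. \<tau> t * \<sigma> t) f x"
proof (rule L2_AE_eqI)
  have ts: "simple_function borel (\<lambda>t. \<tau> t * \<sigma> t)"
    by (rule simple_function_compose2[OF t s, where h = "(*)"])
  show "Phi (\<lambda>t. \<tau> t * \<sigma> t) f \<in> L2 M" using f ts by simp
  fix h assume h: "h \<in> L2 M"
  have "polarize (\<lambda>u. LINT x|\<nu> u. \<tau> x * \<sigma> x) h f = l2_inner M (Phi \<tau> h) (Phi \<sigma> f)"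
  proof (rule polarize_eq_sesquilinear[OF L2_subspace h f])
    fix u v w :: "'a \<Rightarrow> complex" and a assume u: "u \<in> L2 M" and v: "v \<in> L2 M"
    show "l2_inner M (Phi \<tau> u) (Phi \<sigma> (cscale a v)) = a * l2_inner M (Phi \<tau> u) (Phi \<sigma> v)"
      using u v s t by (simp add: Phi_sym L2sp.ip_scale_right L2_cscale)
    show "l2_inner M (Phi \<tau> u) (Phi \<sigma> u) = complex_of_real (LINT x|\<nu> u. \<tau> x * \<sigma> x)"
      using u s t by (intro inner_Phi_Phi_self)
    show "l2_inner M (Phi \<tau> v) (Phi \<sigma> u) = cnj (l2_inner M (Phi \<tau> u) (Phi \<sigma> v))"
    proof -
      have "l2_inner M (Phi \<tau> v) (Phi \<sigma> u) = cnj (l2_inner M (Phi \<sigma> u) (Phi \<tau> v))"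
        using u v s t by (intro L2sp.ip_commute) auto
      also have "l2_inner M (Phi \<sigma> u) (Phi \<tau> v) = l2_inner M (Phi \<tau> u) (Phi \<sigma> v)"
        unfolding inner_Phi_Phi[OF u v s t] inner_Phi_Phi[OF u v t s]
        by (subst sum.swap) (simp add: Int_commute mult.commute)
      finally show ?thesis .
    qed
    assume w: "w \<in> L2 M"
    show "l2_inner M (Phi \<tau> u) (Phi \<sigma> (v + w)) = l2_inner M (Phi \<tau> u) (Phi \<sigma> v) + l2_inner M (Phi \<tau> u) (Phi \<sigma> w)"
      using u v w s t by (simp add: Phi_sym L2sp.ip_add_right L2_add)
  qed
  moreover have "polarize (\<lambda>u. LINT x|\<nu> u. \<tau> x * \<sigma> x) h f = l2_inner M h (Phi (\<lambda>t. \<tau> t * \<sigma> t) f)"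
    using h f ts by (rule polarize_Phi)
  ultimately show "l2_inner M h (Phi \<tau> (Phi \<sigma> f)) = l2_inner M h (Phi (\<lambda>t. \<tau> t * \<sigma> t) f)"
    using h f s t by (simp add: Phi_sym[of h "Phi \<sigma> f"])
qed (use f s t in auto)

text \<open>The domination by \<open>2 |\<phi>|\<close> makes these sequences suitable for dominated convergence in all spaces
  \<open>L\<^sup>p(\<nu> f)\<close> at once, independently of \<open>f\<close>.\<close>
definition approx :: "(real \<Rightarrow> real) \<Rightarrow> (nat \<Rightarrow> real \<Rightarrow> real) \<Rightarrow> bool" where
  "approx \<phi> s \<longleftrightarrow> (\<forall>n. simple_function borel (s n)) \<and> (\<forall>t. (\<lambda>n. s n t) \<longlonglongrightarrow> \<phi> t) \<and> (\<forall>n t. \<bar>s n t\<bar> \<le> 2 * \<bar>\<phi> t\<bar>)"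

lemma approx_exists: "\<phi> \<in> borel_measurable borel \<Longrightarrow> \<exists>s. approx \<phi> s"
  using borel_measurable_implies_sequence_metric[of \<phi> borel 0] by (auto simp: approx_def)

lemma approxD: "approx \<phi> s \<Longrightarrow> simple_function borel (s n)" "approx \<phi> s \<Longrightarrow> (\<lambda>n. s n t) \<longlonglongrightarrow> \<phi> t"
  "approx \<phi> s \<Longrightarrow> \<bar>s n t\<bar> \<le> 2 * \<bar>\<phi> t\<bar>"
  by (auto simp: approx_def)

lemma approx_integral:
  assumes s: "approx \<phi> s" and f: "f \<in> L2 M" and \<phi>: "integrable (\<nu> f) \<phi>"
  shows "(\<lambda>n. LINT t|\<nu> f. s n t) \<longlonglongrightarrow> (LINT t|\<nu> f. \<phi> t)"
proof (rule integral_dominated_convergence[where w = "\<lambda>t. 2 * \<bar>\<phi> t\<bar>"])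
  show "s n \<in> borel_measurable (\<nu> f)" for n using approxD(1)[OF s] by (rule simple_measurable)
  show "AE t in \<nu> f. norm (s n t) \<le> 2 * \<bar>\<phi> t\<bar>" for n using approxD(3)[OF s] by simp
qed (use \<phi> approxD(2)[OF s] in auto)

lemma approx_sq_integral:
  assumes s: "approx \<phi> s" and f: "f \<in> L2 M" and \<phi>: "\<phi> \<in> borel_measurable borel" "integrable (\<nu> f) (\<lambda>t. (\<phi> t)\<^sup>2)"
    and \<sigma>: "\<sigma> \<in> borel_measurable borel" "integrable (\<nu> f) (\<lambda>t. (\<sigma> t)\<^sup>2)"
  shows "(\<lambda>n. LINT t|\<nu> f. (s n t - \<sigma> t)\<^sup>2) \<longlonglongrightarrow> (LINT t|\<nu> f. (\<phi> t - \<sigma> t)\<^sup>2)"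
proof (rule integral_dominated_convergence[where w = "\<lambda>t. 8 * (\<phi> t)\<^sup>2 + 2 * (\<sigma> t)\<^sup>2"])
  have m: "\<phi> \<in> borel_measurable (\<nu> f)" "\<sigma> \<in> borel_measurable (\<nu> f)" "s n \<in> borel_measurable (\<nu> f)" for n
    using \<phi>(1) \<sigma>(1) simple_measurable[OF approxD(1)[OF s]] measurable_cong_sets[OF sets_\<nu> refl] by blast+
  then show "(\<lambda>t. (\<phi> t - \<sigma> t)\<^sup>2) \<in> borel_measurable (\<nu> f)" "(\<lambda>t. (s n t - \<sigma> t)\<^sup>2) \<in> borel_measurable (\<nu> f)" for n
    by auto
  have "(s n t - \<sigma> t)\<^sup>2 \<le> 8 * (\<phi> t)\<^sup>2 + 2 * (\<sigma> t)\<^sup>2" for n t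
  proof -
    have "(s n t)\<^sup>2 \<le> (2 * \<bar>\<phi> t\<bar>)\<^sup>2"
      using approxD(3)[OF s, of n t] by (metis abs_ge_zero power2_abs power_mono)
    then have "(s n t)\<^sup>2 \<le> 4 * (\<phi> t)\<^sup>2" by (simp add: power_mult_distrib)
    moreover have "0 \<le> (s n t + \<sigma> t)\<^sup>2" by simp
    ultimately show ?thesis by (simp add: power2_sum power2_diff)
  qed
  then show "AE t in \<nu> f. norm ((s n t - \<sigma> t)\<^sup>2) \<le> 8 * (\<phi> t)\<^sup>2 + 2 * (\<sigma> t)\<^sup>2" for n by simp
  show "AE t in \<nu> f. (\<lambda>n. (s n t - \<sigma> t)\<^sup>2) \<longlonglongrightarrow> (\<phi> t - \<sigma> t)\<^sup>2"
    using approxD(2)[OF s] by (intro AE_I2 tendsto_intros)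
qed (use \<phi> \<sigma> in simp)

text \<open>The relation \<open>g = (\<integral> \<phi> dE) f\<close> for \<open>\<phi> \<in> L\<^sup>2(\<nu> f)\<close>: the map \<open>\<sigma> \<mapsto> Phi \<sigma> f\<close> is isometric on simple functions,
  and \<open>g\<close> is the value at \<open>\<phi>\<close> of its isometric extension to \<open>L\<^sup>2(\<nu> f)\<close>.\<close>
definition is_fc :: "('a \<Rightarrow> complex) \<Rightarrow> (real \<Rightarrow> real) \<Rightarrow> ('a \<Rightarrow> complex) \<Rightarrow> bool" where
  "is_fc f \<phi> g \<longleftrightarrow> g \<in> L2 M \<and>
    (\<forall>\<sigma>. simple_function borel \<sigma> \<longrightarrow> (l2_norm M (Phi \<sigma> f - g))\<^sup>2 = (LINT t|\<nu> f. (\<phi> t - \<sigma> t)\<^sup>2))"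

lemma is_fc_approx:
  assumes g: "is_fc f \<phi> g" and s: "approx \<phi> s" and f: "f \<in> L2 M"
    and \<phi>: "\<phi> \<in> borel_measurable borel" "integrable (\<nu> f) (\<lambda>t. (\<phi> t)\<^sup>2)"
  shows "L2sp.converges_to M (\<lambda>n. Phi (s n) f) g"
proof -
  have "(\<lambda>n. LINT t|\<nu> f. (s n t - \<phi> t)\<^sup>2) \<longlonglongrightarrow> 0"
    using approx_sq_integral[OF s f \<phi> \<phi>] by simp
  moreover have "(l2_norm M (Phi (s n) f - g))\<^sup>2 = (LINT t|\<nu> f. (s n t - \<phi> t)\<^sup>2)" for n
    using g approxD(1)[OF s] by (simp add: is_fc_def power2_commute)
  ultimately have "(\<lambda>n. sqrt ((l2_norm M (Phi (s n) f - g))\<^sup>2)) \<longlonglongrightarrow> sqrt 0"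
    by (intro tendsto_real_sqrt) simp
  then show ?thesis by (simp add: L2sp.converges_to_def)
qed

lemma is_fcI:
  assumes g: "g \<in> L2 M" and u: "\<And>n. u n \<in> L2 M" "L2sp.converges_to M u g"
    and lim: "\<And>\<sigma>. simple_function borel \<sigma> \<Longrightarrow>
      (\<lambda>n. (l2_norm M (Phi \<sigma> f - u n))\<^sup>2) \<longlonglongrightarrow> (LINT t|\<nu> f. (\<phi> t - \<sigma> t)\<^sup>2)" and f: "f \<in> L2 M"
  shows "is_fc f \<phi> g"
  unfolding is_fc_def
proof (intro conjI allI impI)
  fix \<sigma> :: "real \<Rightarrow> real" assume s: "simple_function borel \<sigma>"
  have "(\<lambda>n. l2_norm M (u n - Phi \<sigma> f)) \<longlonglongrightarrow> l2_norm M (g - Phi \<sigma> f)"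
    using g u f s by (intro L2sp.nrm_tendsto) (auto simp: L2sp.converges_to_def)
  then have "(\<lambda>n. l2_norm M (Phi \<sigma> f - u n)) \<longlonglongrightarrow> l2_norm M (Phi \<sigma> f - g)"
    using L2sp.nrm_diff_commute[of "Phi \<sigma> f" M g] L2sp.nrm_diff_commute[of "Phi \<sigma> f" M] f s g u(1) by simp
  then show "(l2_norm M (Phi \<sigma> f - g))\<^sup>2 = (LINT t|\<nu> f. (\<phi> t - \<sigma> t)\<^sup>2)"
    using lim[OF s] by (blast intro: LIMSEQ_unique tendsto_power)
qed (rule g)

lemma is_fc_exists:
  assumes f: "f \<in> L2 M" and \<phi>: "\<phi> \<in> borel_measurable borel" "integrable (\<nu> f) (\<lambda>t. (\<phi> t)\<^sup>2)"
  shows "\<exists>g. is_fc f \<phi> g"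
proof -
  obtain s where s: "approx \<phi> s" using approx_exists[OF \<phi>(1)] by blast
  note ss = approxD(1)[OF s]
  have sm: "s n \<in> borel_measurable borel" for n by (rule borel_measurable_simple_function[OF ss])
  have s2: "integrable (\<nu> f) (\<lambda>t. (s n t)\<^sup>2)" for n
    using f simple_function_compose1[OF ss] by (rule simple_integrable)
  have I: "(\<lambda>n. LINT t|\<nu> f. (s n t - \<phi> t)\<^sup>2) \<longlonglongrightarrow> 0"
    using approx_sq_integral[OF s f \<phi> \<phi>] by simp
  have diff_int: "integrable (\<nu> f) (\<lambda>t. (s n t - \<phi> t)\<^sup>2)" for n
  proof (rule Bochner_Integration.integrable_bound)
    show "integrable (\<nu> f) (\<lambda>t. 2 * (s n t)\<^sup>2 + 2 * (\<phi> t)\<^sup>2)" using s2 \<phi> by simp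
    show "(\<lambda>t. (s n t - \<phi> t)\<^sup>2) \<in> borel_measurable (\<nu> f)"
      using sm[of n] \<phi>(1) by measurable
    have "(s n t - \<phi> t)\<^sup>2 \<le> 2 * (s n t)\<^sup>2 + 2 * (\<phi> t)\<^sup>2" for t
      using zero_le_power2[of "s n t + \<phi> t"] by (simp add: power2_sum power2_diff)
    then show "AE t in \<nu> f. norm ((s n t - \<phi> t)\<^sup>2) \<le> norm (2 * (s n t)\<^sup>2 + 2 * (\<phi> t)\<^sup>2)" by simp
  qed
  have "L2sp.cauchy_seq M (\<lambda>n. Phi (s n) f)"
  proof (rule L2sp.cauchy_seqI)
    fix m n
    have "(l2_norm M (Phi (s m) f - Phi (s n) f))\<^sup>2 = (LINT t|\<nu> f. (s m t - s n t)\<^sup>2)"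
      using f ss by (intro Phi_isometry)
    also have "\<dots> \<le> (LINT t|\<nu> f. 2 * (s m t - \<phi> t)\<^sup>2 + 2 * (s n t - \<phi> t)\<^sup>2)"
    proof (rule integral_mono_AE')
      have "(s m t - s n t)\<^sup>2 \<le> 2 * (s m t - \<phi> t)\<^sup>2 + 2 * (s n t - \<phi> t)\<^sup>2" for t
        using zero_le_power2[of "(s m t - \<phi> t) + (s n t - \<phi> t)"] by (simp add: power2_eq_square algebra_simps)
      then show "AE t in \<nu> f. (s m t - s n t)\<^sup>2 \<le> 2 * (s m t - \<phi> t)\<^sup>2 + 2 * (s n t - \<phi> t)\<^sup>2" by simp
    qed (use diff_int in auto)
    also have "\<dots> = 2 * (LINT t|\<nu> f. (s m t - \<phi> t)\<^sup>2) + 2 * (LINT t|\<nu> f. (s n t - \<phi> t)\<^sup>2)"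
      using diff_int by simp
    finally show "(l2_norm M (Phi (s m) f - Phi (s n) f))\<^sup>2
      \<le> 2 * (LINT t|\<nu> f. (s m t - \<phi> t)\<^sup>2) + 2 * (LINT t|\<nu> f. (s n t - \<phi> t)\<^sup>2)" .
  next
    show "(\<lambda>n. 2 * (LINT t|\<nu> f. (s n t - \<phi> t)\<^sup>2)) \<longlonglongrightarrow> 0" by (rule tendsto_mult_right_zero[OF I])
  qed (use f ss in simp)
  then obtain g where g: "g \<in> L2 M" "L2sp.converges_to M (\<lambda>n. Phi (s n) f) g"
    using L2sp.complete_H[of "\<lambda>n. Phi (s n) f" M] f ss by auto
  have "is_fc f \<phi> g"
  proof (rule is_fcI[OF g(1) _ g(2) _ f])
    fix \<sigma> :: "real \<Rightarrow> real" assume \<sigma>: "simple_function borel \<sigma>"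
    have "(l2_norm M (Phi \<sigma> f - Phi (s n) f))\<^sup>2 = (LINT t|\<nu> f. (s n t - \<sigma> t)\<^sup>2)" for n
      using Phi_isometry[OF f \<sigma> ss] by (simp add: power2_commute)
    then show "(\<lambda>n. (l2_norm M (Phi \<sigma> f - Phi (s n) f))\<^sup>2) \<longlonglongrightarrow> (LINT t|\<nu> f. (\<phi> t - \<sigma> t)\<^sup>2)"
      using approx_sq_integral[OF s f \<phi> borel_measurable_simple_function[OF \<sigma>]
          simple_integrable[OF f simple_function_compose1[OF \<sigma>]]] by simp
  qed (use f ss in auto)
  then show ?thesis by blast
qed

text \<open>Up to a factor 4, coming from the domination by \<open>2 |\<phi>|\<close>, the integral of \<open>\<phi>\<^sup>2\<close> against \<open>\<nu> w\<close> is the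
  supremum of \<open>\<parallel>Phi (s n) w\<parallel>\<^sup>2\<close>, a family of continuous seminorms of \<open>w\<close>. The linear structure of form
  domains and the lower semicontinuity of forms are read off from this.\<close>
lemma approx_norm_le:
  assumes s: "approx \<phi> s" and w: "w \<in> L2 M" and \<phi>: "\<phi> \<in> borel_measurable borel"
    and K: "(\<integral>\<^sup>+t. ennreal ((\<phi> t)\<^sup>2) \<partial>\<nu> w) \<le> ennreal K" "0 \<le> K"
  shows "(l2_norm M (Phi (s n) w))\<^sup>2 \<le> 4 * K"
proof -
  have "ennreal ((l2_norm M (Phi (s n) w))\<^sup>2) = (\<integral>\<^sup>+t. ennreal ((s n t)\<^sup>2) \<partial>\<nu> w)"
    unfolding nrm_Phi_sq[OF w approxD(1)[OF s]]
    by (rule nn_integral_eq_integral[symmetric])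
      (rule simple_integrable[OF w simple_function_compose1[OF approxD(1)[OF s]]], simp)
  also have "\<dots> \<le> (\<integral>\<^sup>+t. ennreal 4 * ennreal ((\<phi> t)\<^sup>2) \<partial>\<nu> w)"
  proof (rule nn_integral_mono)
    fix t
    have "(s n t)\<^sup>2 \<le> (2 * \<bar>\<phi> t\<bar>)\<^sup>2"
      using approxD(3)[OF s, of n t] by (metis abs_ge_zero power2_abs power_mono)
    then have "(s n t)\<^sup>2 \<le> 4 * (\<phi> t)\<^sup>2" by (simp add: power_mult_distrib)
    then show "ennreal ((s n t)\<^sup>2) \<le> ennreal 4 * ennreal ((\<phi> t)\<^sup>2)"
      by (subst ennreal_mult[symmetric]) (auto intro: ennreal_leI)
  qed
  also have "\<dots> = ennreal 4 * (\<integral>\<^sup>+t. ennreal ((\<phi> t)\<^sup>2) \<partial>\<nu> w)"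
    using \<phi> by (intro nn_integral_cmult) measurable
  also have "\<dots> \<le> ennreal 4 * ennreal K" using K(1) by (rule mult_left_mono) simp
  also have "\<dots> = ennreal (4 * K)" using K(2) by (simp add: ennreal_mult)
  finally show ?thesis using K(2) by (subst (asm) ennreal_le_iff) auto
qed

lemma approx_norm_ge:
  assumes s: "approx \<phi> s" and w: "w \<in> L2 M"
    and K: "\<And>n. (l2_norm M (Phi (s n) w))\<^sup>2 \<le> K"
  shows "(\<integral>\<^sup>+t. ennreal ((\<phi> t)\<^sup>2) \<partial>\<nu> w) \<le> ennreal K"
proof -
  note ss = approxD(1)[OF s]
  have "(\<integral>\<^sup>+t. ennreal ((\<phi> t)\<^sup>2) \<partial>\<nu> w) = (\<integral>\<^sup>+t. liminf (\<lambda>n. ennreal ((s n t)\<^sup>2)) \<partial>\<nu> w)"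
  proof (rule nn_integral_cong)
    fix t
    have "(\<lambda>n. ennreal ((s n t)\<^sup>2)) \<longlonglongrightarrow> ennreal ((\<phi> t)\<^sup>2)"
      using approxD(2)[OF s] by (intro tendsto_ennrealI tendsto_power)
    then show "ennreal ((\<phi> t)\<^sup>2) = liminf (\<lambda>n. ennreal ((s n t)\<^sup>2))"
      using lim_imp_Liminf[OF sequentially_bot] by fastforce
  qed
  also have "\<dots> \<le> liminf (\<lambda>n. \<integral>\<^sup>+t. ennreal ((s n t)\<^sup>2) \<partial>\<nu> w)"
  proof (rule nn_integral_liminf)
    fix n
    have [measurable]: "s n \<in> borel_measurable (\<nu> w)" by (rule simple_measurable[OF ss])
    show "(\<lambda>t. ennreal ((s n t)\<^sup>2)) \<in> borel_measurable (\<nu> w)" by measurable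
  qed
  also have "\<dots> \<le> ennreal K"
  proof (rule Liminf_le)
    have "(\<integral>\<^sup>+t. ennreal ((s n t)\<^sup>2) \<partial>\<nu> w) = ennreal ((l2_norm M (Phi (s n) w))\<^sup>2)" for n
      unfolding nrm_Phi_sq[OF w ss]
      by (rule nn_integral_eq_integral) (rule simple_integrable[OF w simple_function_compose1[OF ss]], simp)
    then show "\<forall>\<^sub>F n in sequentially. (\<integral>\<^sup>+t. ennreal ((s n t)\<^sup>2) \<partial>\<nu> w) \<le> ennreal K"
      using K by (simp add: ennreal_leI)
  qed simp
  finally show ?thesis .
qed

end

section \<open>Form domains and spectral integrals\<close>

context pvm
begin

lemma Phi_converges:
  assumes u: "\<And>n. u n \<in> L2 M" "l \<in> L2 M" "L2sp.converges_to M u l" and s: "simple_function borel \<sigma>"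
  shows "L2sp.converges_to M (\<lambda>n. Phi \<sigma> (u n)) (Phi \<sigma> l)"
proof -
  obtain b where b: "\<And>t. \<bar>\<sigma> t\<bar> \<le> b" using simple_bounded[OF s] by blast
  show ?thesis unfolding L2sp.converges_to_def
  proof (rule Lim_null_comparison)
    show "\<forall>\<^sub>F n in sequentially. norm (l2_norm M (Phi \<sigma> (u n) - Phi \<sigma> l)) \<le> b * l2_norm M (u n - l)"
      using Phi_bounded[OF L2sp.H_closed(4)[OF u(1,2)] s b] Phi_diff[OF u(1,2) s]
      by (intro always_eventually allI) simp
    show "(\<lambda>n. b * l2_norm M (u n - l)) \<longlonglongrightarrow> 0"
      using u(3) unfolding L2sp.converges_to_def by (rule tendsto_mult_right_zero)
  qed
qed

definition Dom :: "(real \<Rightarrow> real) \<Rightarrow> ('a \<Rightarrow> complex) set" where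
  "Dom \<phi> = {f \<in> L2 M. integrable (\<nu> f) \<phi>}"

lemma Dom_L2: "f \<in> Dom \<phi> \<Longrightarrow> f \<in> L2 M"
  by (simp add: Dom_def)

lemma measurable_\<nu>: "\<phi> \<in> borel_measurable borel \<Longrightarrow> \<phi> \<in> borel_measurable (\<nu> f)"
  using measurable_cong_sets[OF sets_\<nu> refl] by blast

lemma Dom_iff:
  assumes \<phi>: "\<phi> \<in> borel_measurable borel" and s: "approx (\<lambda>t. sqrt \<bar>\<phi> t\<bar>) s" and f: "f \<in> L2 M"
  shows "f \<in> Dom \<phi> \<longleftrightarrow> (\<exists>K. \<forall>n. (l2_norm M (Phi (s n) f))\<^sup>2 \<le> K)"
proof
  assume "f \<in> Dom \<phi>"
  then have int: "integrable (\<nu> f) (\<lambda>t. \<bar>\<phi> t\<bar>)" by (simp add: Dom_def)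
  have "(\<integral>\<^sup>+t. ennreal ((sqrt \<bar>\<phi> t\<bar>)\<^sup>2) \<partial>\<nu> f) = ennreal (LINT t|\<nu> f. \<bar>\<phi> t\<bar>)"
    using nn_integral_eq_integral[OF int] by simp
  then have "(l2_norm M (Phi (s n) f))\<^sup>2 \<le> 4 * (LINT t|\<nu> f. \<bar>\<phi> t\<bar>)" for n
    using \<phi> by (intro approx_norm_le[OF s f]) simp_all
  then show "\<exists>K. \<forall>n. (l2_norm M (Phi (s n) f))\<^sup>2 \<le> K" by blast
next
  assume "\<exists>K. \<forall>n. (l2_norm M (Phi (s n) f))\<^sup>2 \<le> K"
  then obtain K where "\<And>n. (l2_norm M (Phi (s n) f))\<^sup>2 \<le> K" by blast
  then have "(\<integral>\<^sup>+t. ennreal ((sqrt \<bar>\<phi> t\<bar>)\<^sup>2) \<partial>\<nu> f) \<le> ennreal K"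
    by (rule approx_norm_ge[OF s f])
  then have "(\<integral>\<^sup>+t. ennreal (norm (\<phi> t)) \<partial>\<nu> f) < \<infinity>"
    using le_less_trans[OF _ ennreal_less_top] by simp
  then show "f \<in> Dom \<phi>"
    using f measurable_\<nu>[OF \<phi>] by (simp add: Dom_def integrable_iff_bounded)
qed

lemma Dom_subspace:
  assumes \<phi>: "\<phi> \<in> borel_measurable borel"
  shows "fun_vs.subspace (Dom \<phi>)"
proof -
  have "(\<lambda>t. sqrt \<bar>\<phi> t\<bar>) \<in> borel_measurable borel" using \<phi> by measurable
  then obtain s where s: "approx (\<lambda>t. sqrt \<bar>\<phi> t\<bar>) s" using approx_exists by blast
  note ss = approxD(1)[OF s]
  note iff = Dom_iff[OF \<phi> s]
  show ?thesis
  proof (rule fun_vs.subspaceI)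
    have "l2_norm M (Phi (s n) 0) = 0" for n
      using Phi_scale[OF L2sp.H_closed(1)[of M] ss[of n], of 0] unfolding fun_vs.scale_zero_left by simp
    then show "0 \<in> Dom \<phi>" by (subst iff) auto
  next
    fix f g assume f: "f \<in> Dom \<phi>" and g: "g \<in> Dom \<phi>"
    note L = Dom_L2[OF f] Dom_L2[OF g]
    obtain K K' where K: "\<And>n. (l2_norm M (Phi (s n) f))\<^sup>2 \<le> K" "\<And>n. (l2_norm M (Phi (s n) g))\<^sup>2 \<le> K'"
      using f[unfolded iff[OF L(1)]] g[unfolded iff[OF L(2)]] by blast
    have "(l2_norm M (Phi (s n) (f + g)))\<^sup>2 \<le> 2 * K + 2 * K'" for n
      using L2sp.parallelogram[OF Phi_L2[OF L(1) ss[of n]] Phi_L2[OF L(2) ss[of n]]] K[of n]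
        zero_le_power2[of "l2_norm M (Phi (s n) f - Phi (s n) g)"]
      unfolding Phi_add[OF L ss] by linarith
    then show "f + g \<in> Dom \<phi>" unfolding iff[OF L2_add[OF L]] by blast
  next
    fix c f assume f: "f \<in> Dom \<phi>"
    note L = Dom_L2[OF f]
    obtain K where K: "\<And>n. (l2_norm M (Phi (s n) f))\<^sup>2 \<le> K" using f[unfolded iff[OF L]] by blast
    have "(l2_norm M (Phi (s n) (cscale c f)))\<^sup>2 \<le> (cmod c)\<^sup>2 * K" for n
      unfolding Phi_scale[OF L ss] power_mult_distrib using K[of n] by (rule mult_left_mono) simp
    then show "cscale c f \<in> Dom \<phi>" unfolding iff[OF L2_cscale[OF L]] by blast
  qed
qed

lemma Dom_cong_AE: "f \<in> Dom \<phi> \<Longrightarrow> g \<in> L2 M \<Longrightarrow> (AE x in M. g x = f x) \<Longrightarrow> g \<in> Dom \<phi>"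
  using \<nu>_cong_AE[of g f] by (simp add: Dom_def)

abbreviation form :: "(real \<Rightarrow> real) \<Rightarrow> ('a \<Rightarrow> complex) \<Rightarrow> ('a \<Rightarrow> complex) \<Rightarrow> complex" where
  "form \<phi> \<equiv> polarize (\<lambda>u. LINT t|\<nu> u. \<phi> t)"

lemma form_limit:
  assumes \<phi>: "\<phi> \<in> borel_measurable borel" and s: "approx \<phi> s" and h: "h \<in> Dom \<phi>" and f: "f \<in> Dom \<phi>"
  shows "(\<lambda>n. l2_inner M h (Phi (s n) f)) \<longlonglongrightarrow> form \<phi> h f"
proof -
  have "(\<lambda>n. form (s n) h f) \<longlonglongrightarrow> form \<phi> h f"
    unfolding polarize_alt
  proof (intro tendsto_divide tendsto_sum tendsto_mult tendsto_const tendsto_of_real)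
    fix k
    have "h + cscale (\<i> ^ k) f \<in> Dom \<phi>"
      using fun_vs.subspace_add[OF Dom_subspace[OF \<phi>]] fun_vs.subspace_scale[OF Dom_subspace[OF \<phi>]] h f by blast
    then show "(\<lambda>n. LINT t|\<nu> (h + cscale (\<i> ^ k) f). s n t) \<longlonglongrightarrow> (LINT t|\<nu> (h + cscale (\<i> ^ k) f). \<phi> t)"
      using s by (intro approx_integral) (simp_all only: Dom_def mem_Collect_eq)
  qed simp
  then show ?thesis
    using polarize_Phi[OF Dom_L2[OF h] Dom_L2[OF f] approxD(1)[OF s]] by simp
qed

lemma form_sesquilinear:
  assumes \<phi>: "\<phi> \<in> borel_measurable borel" and h: "h \<in> Dom \<phi>" and f: "f \<in> Dom \<phi>"
  shows "g \<in> Dom \<phi> \<Longrightarrow> form \<phi> h (f + g) = form \<phi> h f + form \<phi> h g"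
    and "form \<phi> h (cscale a f) = a * form \<phi> h f"
    and "form \<phi> f h = cnj (form \<phi> h f)"
    and "form \<phi> f f = complex_of_real (LINT t|\<nu> f. \<phi> t)"
proof -
  obtain s where s: "approx \<phi> s" using approx_exists[OF \<phi>] by blast
  note lim = form_limit[OF \<phi> s] and ss = approxD(1)[OF s]
  note hL = Dom_L2[OF h] and fL = Dom_L2[OF f]
  have cf: "cscale a f \<in> Dom \<phi>" using fun_vs.subspace_scale[OF Dom_subspace[OF \<phi>]] f by blast
  show "form \<phi> h (f + g) = form \<phi> h f + form \<phi> h g" if g: "g \<in> Dom \<phi>"
  proof (rule LIMSEQ_unique[OF lim[OF h]])
    show "f + g \<in> Dom \<phi>" using fun_vs.subspace_add[OF Dom_subspace[OF \<phi>]] f g by blast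
    have "l2_inner M h (Phi (s n) (f + g)) = l2_inner M h (Phi (s n) f) + l2_inner M h (Phi (s n) g)" for n
      using hL fL Dom_L2[OF g] ss by (simp add: Phi_sym L2sp.ip_add_right L2_add)
    then show "(\<lambda>n. l2_inner M h (Phi (s n) (f + g))) \<longlonglongrightarrow> form \<phi> h f + form \<phi> h g"
      using tendsto_add[OF lim[OF h f] lim[OF h g]] by simp
  qed
  show "form \<phi> h (cscale a f) = a * form \<phi> h f"
  proof (rule LIMSEQ_unique[OF lim[OF h cf]])
    have "l2_inner M h (Phi (s n) (cscale a f)) = a * l2_inner M h (Phi (s n) f)" for n
      using hL fL ss by (simp add: Phi_sym L2sp.ip_scale_right L2_cscale)
    then show "(\<lambda>n. l2_inner M h (Phi (s n) (cscale a f))) \<longlonglongrightarrow> a * form \<phi> h f"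
      using tendsto_mult_left[OF lim[OF h f], of a] by simp
  qed
  show "form \<phi> f h = cnj (form \<phi> h f)"
  proof (rule LIMSEQ_unique[OF lim[OF f h]])
    have "l2_inner M f (Phi (s n) h) = cnj (l2_inner M h (Phi (s n) f))" for n
      using hL fL ss L2sp.ip_commute[of h M "Phi (s n) f"] by (simp add: Phi_sym)
    then show "(\<lambda>n. l2_inner M f (Phi (s n) h)) \<longlonglongrightarrow> cnj (form \<phi> h f)"
      using tendsto_cnj[OF lim[OF h f]] by simp
  qed
  show "form \<phi> f f = complex_of_real (LINT t|\<nu> f. \<phi> t)"
  proof (rule LIMSEQ_unique[OF lim[OF f f]])
    have "l2_inner M f (Phi (s n) f) = complex_of_real (LINT t|\<nu> f. s n t)" for n
      using fL ss by (rule inner_Phi_self)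
    then show "(\<lambda>n. l2_inner M f (Phi (s n) f)) \<longlonglongrightarrow> complex_of_real (LINT t|\<nu> f. \<phi> t)"
      using approx_integral[OF s fL] f by (simp add: Dom_def tendsto_of_real)
  qed
qed

lemma integrable_of_square:
  fixes \<phi> :: "real \<Rightarrow> real"
  assumes f: "f \<in> L2 M" and \<phi>: "\<phi> \<in> borel_measurable borel" "integrable (\<nu> f) (\<lambda>t. (\<phi> t)\<^sup>2)"
  shows "integrable (\<nu> f) \<phi>"
proof (rule Bochner_Integration.integrable_bound)
  show "integrable (\<nu> f) (\<lambda>t. 1 + (\<phi> t)\<^sup>2)"
    using \<phi>(2) finite_measure.integrable_const[OF finite_measure_\<nu>[OF f]] by (intro Bochner_Integration.integrable_add)
  have "\<bar>\<phi> t\<bar> \<le> 1 + (\<phi> t)\<^sup>2" for t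
    using zero_le_power2[of "\<bar>\<phi> t\<bar> - 1"] by (simp add: power2_diff)
  then show "AE t in \<nu> f. norm (\<phi> t) \<le> norm (1 + (\<phi> t)\<^sup>2)" by (simp add: abs_of_nonneg)
qed (rule measurable_\<nu>[OF \<phi>(1)])

text \<open>The defining weak identity of the spectral integral holds for the limit of the vectors
  \<open>Phi (s n) f\<close>, which exists by isometry; so the domain is the full set of square-integrability.\<close>
lemma spectral_integral_total:
  assumes f: "f \<in> spectral_integral_dom M E \<phi>" and \<phi>: "\<phi> \<in> borel_measurable borel"
  shows "\<exists>g. (f, g) \<in> spectral_integral M E \<phi>"
proof -
  have fL: "f \<in> L2 M" and f2: "integrable (\<nu> f) (\<lambda>t. (\<phi> t)\<^sup>2)"
    using f by (auto simp: spectral_integral_dom_def)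
  obtain g where g: "is_fc f \<phi> g" using is_fc_exists[OF fL \<phi> f2] by blast
  obtain s where s: "approx \<phi> s" using approx_exists[OF \<phi>] by blast
  have gL: "g \<in> L2 M" using g by (simp add: is_fc_def)
  have fD: "f \<in> Dom \<phi>" using integrable_of_square[OF fL \<phi> f2] fL by (simp add: Dom_def)
  have "l2_inner M h g = form \<phi> h f" if h: "h \<in> spectral_integral_dom M E \<phi>" for h
  proof (rule LIMSEQ_unique)
    have hL: "h \<in> L2 M" and h2: "integrable (\<nu> h) (\<lambda>t. (\<phi> t)\<^sup>2)"
      using h by (auto simp: spectral_integral_dom_def)
    have "h \<in> Dom \<phi>" using integrable_of_square[OF hL \<phi> h2] hL by (simp add: Dom_def)
    then show "(\<lambda>n. l2_inner M h (Phi (s n) f)) \<longlonglongrightarrow> form \<phi> h f"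
      using fD by (rule form_limit[OF \<phi> s])
    show "(\<lambda>n. l2_inner M h (Phi (s n) f)) \<longlonglongrightarrow> l2_inner M h g"
      by (rule L2sp.ip_tendsto_right[OF Phi_L2[OF fL approxD(1)[OF s]] gL hL is_fc_approx[OF g s fL \<phi> f2]])
  qed
  then show ?thesis using f gL by (auto simp: spectral_integral_def)
qed

lemma is_fc_Phi:
  assumes h: "is_fc f \<phi> h" and f: "f \<in> L2 M" and \<phi>: "\<phi> \<in> borel_measurable borel" "integrable (\<nu> f) (\<lambda>t. (\<phi> t)\<^sup>2)"
    and t: "simple_function borel \<tau>"
  shows "is_fc f (\<lambda>t. \<tau> t * \<phi> t) (Phi \<tau> h)"
proof -
  obtain s where s: "approx \<phi> s" using approx_exists[OF \<phi>(1)] by blast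
  note ss = approxD(1)[OF s]
  have hL: "h \<in> L2 M" using h by (simp add: is_fc_def)
  have sL: "Phi (s n) f \<in> L2 M" for n using f ss by simp
  have ts: "simple_function borel (\<lambda>t. \<tau> t * s n t)" for n
    by (rule simple_function_compose2[OF t ss, where h = "(*)"])
  have app: "approx (\<lambda>t. \<tau> t * \<phi> t) (\<lambda>n t. \<tau> t * s n t)"
    unfolding approx_def
  proof (intro conjI allI)
    show "(\<lambda>n. \<tau> t * s n t) \<longlonglongrightarrow> \<tau> t * \<phi> t" for t
      using approxD(2)[OF s] by (intro tendsto_intros)
    show "\<bar>\<tau> t * s n t\<bar> \<le> 2 * \<bar>\<tau> t * \<phi> t\<bar>" for n t
      using mult_left_mono[OF approxD(3)[OF s, of n t], of "\<bar>\<tau> t\<bar>"] by (simp add: abs_mult mult_ac)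
  qed (rule ts)
  have \<tau>m: "\<tau> \<in> borel_measurable borel" using borel_measurable_simple_function[OF t] .
  obtain b where b: "\<And>t. \<bar>\<tau> t\<bar> \<le> b" using simple_bounded[OF t] by blast
  have m: "(\<lambda>t. \<tau> t * \<phi> t) \<in> borel_measurable borel" using \<tau>m \<phi>(1) by measurable
  have i: "integrable (\<nu> f) (\<lambda>t. (\<tau> t * \<phi> t)\<^sup>2)"
  proof (rule Bochner_Integration.integrable_bound)
    show "integrable (\<nu> f) (\<lambda>t. b\<^sup>2 * (\<phi> t)\<^sup>2)" using \<phi>(2) by simp
    show "(\<lambda>t. (\<tau> t * \<phi> t)\<^sup>2) \<in> borel_measurable (\<nu> f)"
      using measurable_\<nu>[OF m] by measurable
    have "(\<tau> t)\<^sup>2 \<le> b\<^sup>2" for t using b[of t] by (metis abs_ge_zero power2_abs power_mono)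
    then show "AE t in \<nu> f. norm ((\<tau> t * \<phi> t)\<^sup>2) \<le> norm (b\<^sup>2 * (\<phi> t)\<^sup>2)"
      by (simp add: power_mult_distrib mult_right_mono)
  qed
  show ?thesis
  proof (rule is_fcI[OF _ _ Phi_converges[OF sL hL is_fc_approx[OF h s f \<phi>] t] _ f])
    fix \<sigma> :: "real \<Rightarrow> real" assume \<sigma>: "simple_function borel \<sigma>"
    have "l2_norm M (Phi \<sigma> f - Phi \<tau> (Phi (s n) f)) = l2_norm M (Phi \<sigma> f - Phi (\<lambda>t. \<tau> t * s n t) f)" for n
    proof (rule l2_norm_cong_AE)
      show "AE x in M. (Phi \<sigma> f - Phi \<tau> (Phi (s n) f)) x = (Phi \<sigma> f - Phi (\<lambda>t. \<tau> t * s n t) f) x"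
        using Phi_mult[OF f ss t, of n] by eventually_elim simp
    qed (intro L2sp.H_closed Phi_L2 f \<sigma> t ss ts)+
    then have "(l2_norm M (Phi \<sigma> f - Phi \<tau> (Phi (s n) f)))\<^sup>2 = (LINT x|\<nu> f. (\<tau> x * s n x - \<sigma> x)\<^sup>2)" for n
      using Phi_isometry[OF f \<sigma> ts[of n]] by (simp add: power2_commute)
    then show "(\<lambda>n. (l2_norm M (Phi \<sigma> f - Phi \<tau> (Phi (s n) f)))\<^sup>2) \<longlonglongrightarrow> (LINT t|\<nu> f. (\<tau> t * \<phi> t - \<sigma> t)\<^sup>2)"
      using approx_sq_integral[OF app f m i borel_measurable_simple_function[OF \<sigma>]
          simple_integrable[OF f simple_function_compose1[OF \<sigma>]]] by simp
  qed (use sL hL t in auto)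
qed

text \<open>A vector in the range of \<open>E {-n..<c}\<close> lies in the domain of the operator, and its energy would be
  below \<open>c \<parallel>u\<parallel>\<^sup>2\<close> unless it vanishes.\<close>
lemma spectral_support:
  assumes lower: "\<And>u g. (u, g) \<in> spectral_integral M E (\<lambda>t. t) \<Longrightarrow> c * (l2_norm M u)\<^sup>2 \<le> Re (l2_inner M u g)"
    and f: "f \<in> L2 M"
  shows "AE t in \<nu> f. c \<le> t"
proof -
  have zero: "emeasure (\<nu> f) {- real n..<c} = 0" for n
  proof -
    define S where "S = {- real n..<c}"
    have S: "S \<in> sets borel" by (simp add: S_def)
    define u where "u = E S f"
    have u: "u \<in> L2 M" using S f by (simp add: u_def)
    interpret finite_measure "\<nu> u" using u by (rule finite_measure_\<nu>)
    have "emeasure (\<nu> u) (- S) = 0"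
    proof -
      have "l2_norm M (E (- S) u) = l2_norm M (E (- S \<inter> S) f)"
        unfolding u_def using S f by (intro l2_norm_cong_AE E_mult) auto
      then show ?thesis using S E_empty[OF f] u by (simp add: emeasure_\<nu>)
    qed
    then have AE_S: "AE t in \<nu> u. t \<in> S"
      using S by (intro AE_I[of _ _ "- S"]) auto
    have "integrable (\<nu> u) (\<lambda>t. t\<^sup>2)"
    proof (rule integrable_const_bound)
      have "t\<^sup>2 \<le> (real n + \<bar>c\<bar>)\<^sup>2" if "t \<in> S" for t
      proof -
        have "\<bar>t\<bar> \<le> real n + \<bar>c\<bar>" using that by (auto simp: S_def)
        then show ?thesis by (metis abs_ge_zero power2_abs power_mono)
      qed
      then show "AE t in \<nu> u. norm (t\<^sup>2) \<le> (real n + \<bar>c\<bar>)\<^sup>2" using AE_S by auto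
    qed (rule measurable_\<nu>, simp)
    then have ud: "u \<in> spectral_integral_dom M E (\<lambda>t. t)" using u by (simp add: spectral_integral_dom_def)
    then obtain g where g: "(u, g) \<in> spectral_integral M E (\<lambda>t. t)"
      using spectral_integral_total[of u "\<lambda>t. t"] by auto
    have iu: "integrable (\<nu> u) (\<lambda>t. t)"
      by (rule integrable_of_square[OF u]) (use ud in \<open>simp_all add: spectral_integral_dom_def\<close>)
    have uD: "u \<in> Dom (\<lambda>t. t)" unfolding Dom_def using u iu by (intro CollectI conjI)
    have id_m: "(\<lambda>t::real. t) \<in> borel_measurable borel" by measurable
    have "l2_inner M u g = form (\<lambda>t. t) u u" using g ud by (simp add: spectral_integral_def)
    then have ug: "l2_inner M u g = complex_of_real (LINT t|\<nu> u. t)"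
      unfolding form_sesquilinear(4)[OF id_m uD uD] .
    have "c * (l2_norm M u)\<^sup>2 \<le> (LINT t|\<nu> u. t)" using lower[OF g] unfolding ug by simp
    moreover have "(LINT t|\<nu> u. c - t) = c * (l2_norm M u)\<^sup>2 - (LINT t|\<nu> u. t)"
      using iu measure_\<nu>_UNIV[OF u] by (simp add: mult.commute)
    moreover have AE_pos: "AE t in \<nu> u. 0 \<le> c - t" using AE_S by eventually_elim (simp add: S_def)
    then have "(LINT t|\<nu> u. c - t) \<ge> 0" by (rule integral_nonneg_AE)
    ultimately have "(LINT t|\<nu> u. c - t) = 0" by linarith
    then have "AE t in \<nu> u. c - t = 0"
      using integral_nonneg_eq_0_iff_AE[OF _ AE_pos] iu by simp
    then have "AE t in \<nu> u. False" using AE_S by eventually_elim (simp add: S_def)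
    then have "emeasure (\<nu> u) UNIV = 0"
      using AE_iff_measurable[of UNIV "\<nu> u" "\<lambda>_. False"] by simp
    then have "measure (\<nu> u) UNIV = 0" by (simp add: measure_def)
    then have "l2_norm M u = 0" using measure_\<nu>_UNIV[OF u] by simp
    then show ?thesis using emeasure_\<nu>[OF f S] by (simp add: u_def S_def)
  qed
  have "emeasure (\<nu> f) (\<Union>n. {- real n..<c}) = 0" by (rule emeasure_UN_eq_0) (use zero in auto)
  moreover have "{t. \<not> c \<le> t} \<subseteq> (\<Union>n. {- real n..<c})"
  proof
    fix t assume "t \<in> {t. \<not> c \<le> t}"
    moreover obtain n where "- t \<le> real n" using real_arch_simple by blast
    ultimately show "t \<in> (\<Union>n. {- real n..<c})" by (intro UN_I[of n]) auto
  qed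
  ultimately show ?thesis by (intro AE_I[of _ _ "\<Union>n. {- real n..<c}"]) auto
qed

text \<open>Closedness of the form \<open>\<integral> |\<phi>| d\<nu> u\<close>: for \<open>L\<^sup>2\<close>-convergent sequences, bounds on the differences
  \<open>u n - u m\<close> pass to the limit in \<open>m\<close>, because each \<open>Phi (s k)\<close> is bounded.\<close>
lemma Dom_complete:
  assumes \<phi>: "\<phi> \<in> borel_measurable borel" and u: "\<And>n. u n \<in> Dom \<phi>" and l: "l \<in> L2 M" "L2sp.converges_to M u l"
    and c: "\<And>e. e > 0 \<Longrightarrow> \<exists>N. \<forall>m\<ge>N. \<forall>n\<ge>N. (LINT t|\<nu> (u m - u n). \<bar>\<phi> t\<bar>) < e"
  shows "l \<in> Dom \<phi>" "(\<lambda>n. LINT t|\<nu> (u n - l). \<bar>\<phi> t\<bar>) \<longlonglongrightarrow> 0"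
proof -
  have "(\<lambda>t. sqrt \<bar>\<phi> t\<bar>) \<in> borel_measurable borel" using \<phi> by measurable
  then obtain s where s: "approx (\<lambda>t. sqrt \<bar>\<phi> t\<bar>) s" using approx_exists by blast
  note ss = approxD(1)[OF s]
  note uL = Dom_L2[OF u]
  have dD: "u m - u n \<in> Dom \<phi>" for m n using fun_vs.subspace_diff[OF Dom_subspace[OF \<phi>]] u by blast
  have main: "\<exists>N. \<forall>n\<ge>N. (\<integral>\<^sup>+t. ennreal \<bar>\<phi> t\<bar> \<partial>\<nu> (u n - l)) \<le> ennreal (4 * e)" if e: "e > 0" for e
  proof -
    obtain N where N: "\<And>m n. m \<ge> N \<Longrightarrow> n \<ge> N \<Longrightarrow> (LINT t|\<nu> (u m - u n). \<bar>\<phi> t\<bar>) < e"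
      using c[OF e] by blast
    have "(\<integral>\<^sup>+t. ennreal \<bar>\<phi> t\<bar> \<partial>\<nu> (u n - l)) \<le> ennreal (4 * e)" if n: "n \<ge> N" for n
    proof -
      have "(l2_norm M (Phi (s k) (u n - l)))\<^sup>2 \<le> 4 * e" for k
      proof (rule LIMSEQ_le_const2)
        have cv: "L2sp.converges_to M (\<lambda>m. u n - u m) (u n - l)"
        proof -
          have "(u n - u m) - (u n - l) = l - u m" for m by simp
          then show ?thesis using l(2) L2sp.nrm_diff_commute[OF l(1) uL] by (simp only: L2sp.converges_to_def)
        qed
        show "(\<lambda>m. (l2_norm M (Phi (s k) (u n - u m)))\<^sup>2) \<longlonglongrightarrow> (l2_norm M (Phi (s k) (u n - l)))\<^sup>2"
          by (rule tendsto_power, rule L2sp.nrm_tendsto[OF _ _ Phi_converges[OF _ _ cv ss]])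
            (intro Phi_L2 ss L2sp.H_closed uL l)+
        show "\<exists>N. \<forall>m\<ge>N. (l2_norm M (Phi (s k) (u n - u m)))\<^sup>2 \<le> 4 * e"
        proof (intro exI allI impI)
          fix m assume m: "m \<ge> N"
          have int: "integrable (\<nu> (u n - u m)) (\<lambda>t. \<bar>\<phi> t\<bar>)" using dD[of n m] by (simp only: Dom_def mem_Collect_eq integrable_abs)
          show "(l2_norm M (Phi (s k) (u n - u m)))\<^sup>2 \<le> 4 * e"
          proof (rule approx_norm_le[OF s Dom_L2[OF dD]])
            have "(\<integral>\<^sup>+t. ennreal ((sqrt \<bar>\<phi> t\<bar>)\<^sup>2) \<partial>\<nu> (u n - u m)) = ennreal (LINT t|\<nu> (u n - u m). \<bar>\<phi> t\<bar>)"
              using nn_integral_eq_integral[OF int] by (simp only: real_sqrt_pow2[OF abs_ge_zero]) simp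
            also have "\<dots> \<le> ennreal e" using N[OF n m] by (intro ennreal_leI) simp
            finally show "(\<integral>\<^sup>+t. ennreal ((sqrt \<bar>\<phi> t\<bar>)\<^sup>2) \<partial>\<nu> (u n - u m)) \<le> ennreal e" .
          qed (use e \<phi> in auto)
        qed
      qed
      then have "(\<integral>\<^sup>+t. ennreal ((sqrt \<bar>\<phi> t\<bar>)\<^sup>2) \<partial>\<nu> (u n - l)) \<le> ennreal (4 * e)"
        by (rule approx_norm_ge[OF s L2sp.H_closed(4)[OF uL l(1)]])
      then show ?thesis by (simp only: real_sqrt_pow2[OF abs_ge_zero])
    qed
    then show ?thesis by blast
  qed
  have dom: "u n - l \<in> Dom \<phi>" if "(\<integral>\<^sup>+t. ennreal \<bar>\<phi> t\<bar> \<partial>\<nu> (u n - l)) \<le> ennreal K" for n K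
    using le_less_trans[OF that ennreal_less_top] measurable_\<nu>[OF \<phi>] L2sp.H_closed(4)[OF uL l(1)]
    by (simp only: Dom_def mem_Collect_eq integrable_iff_bounded real_norm_def infinity_ennreal_def)
  obtain N where "(\<integral>\<^sup>+t. ennreal \<bar>\<phi> t\<bar> \<partial>\<nu> (u N - l)) \<le> ennreal (4 * 1)" using main[of 1] by auto
  then have "u N - (u N - l) \<in> Dom \<phi>"
    using fun_vs.subspace_diff[OF Dom_subspace[OF \<phi>] u dom] by blast
  then show "l \<in> Dom \<phi>" by simp
  show "(\<lambda>n. LINT t|\<nu> (u n - l). \<bar>\<phi> t\<bar>) \<longlonglongrightarrow> 0"
  proof (rule LIMSEQ_I)
    fix e :: real assume e: "e > 0"
    obtain N where N: "\<And>n. n \<ge> N \<Longrightarrow> (\<integral>\<^sup>+t. ennreal \<bar>\<phi> t\<bar> \<partial>\<nu> (u n - l)) \<le> ennreal (4 * (e / 8))"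
      using main[of "e / 8"] e by auto
    have "norm ((LINT t|\<nu> (u n - l). \<bar>\<phi> t\<bar>) - 0) < e" if n: "n \<ge> N" for n
    proof -
      have "integrable (\<nu> (u n - l)) (\<lambda>t. \<bar>\<phi> t\<bar>)"
        using dom[OF N[OF n]] by (simp only: Dom_def mem_Collect_eq integrable_abs)
      then have "ennreal (LINT t|\<nu> (u n - l). \<bar>\<phi> t\<bar>) \<le> ennreal (4 * (e / 8))"
        using nn_integral_eq_integral[of "\<nu> (u n - l)" "\<lambda>t. \<bar>\<phi> t\<bar>"] N[OF n] by simp
      then have "(LINT t|\<nu> (u n - l). \<bar>\<phi> t\<bar>) \<le> 4 * (e / 8)" using e by (subst (asm) ennreal_le_iff) auto
      moreover have "0 \<le> (LINT t|\<nu> (u n - l). \<bar>\<phi> t\<bar>)" by (rule integral_nonneg_AE) simp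
      ultimately show ?thesis using e by simp
    qed
    then show "\<exists>no. \<forall>n\<ge>no. norm ((LINT t|\<nu> (u n - l). \<bar>\<phi> t\<bar>) - 0) < e" by blast
  qed
qed

end

section \<open>Compactness of spectral cut-offs on sets of finite measure\<close>

definition restr :: "'a set \<Rightarrow> ('a \<Rightarrow> complex) \<Rightarrow> 'a \<Rightarrow> complex" where
  "restr F f = (\<lambda>x. indicator F x * f x)"

lemma norm_restr: "norm (restr F f x) = indicator F x * norm (f x)"
  by (simp add: restr_def norm_mult indicator_def)

lemma norm_restr_sq: "(norm (restr F f x))\<^sup>2 = indicator F x * (norm (f x))\<^sup>2"
  by (simp add: norm_restr power_mult_distrib indicator_def)

lemma restr_L2:
  assumes F: "F \<in> sets M" and f: "f \<in> L2 M"
  shows "restr F f \<in> L2 M"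
proof (rule L2_I)
  note [measurable] = F L2_measurable[OF f]
  show m: "restr F f \<in> borel_measurable M" unfolding restr_def by measurable
  show "integrable M (\<lambda>x. (norm (restr F f x))\<^sup>2)"
    by (rule Bochner_Integration.integrable_bound[OF L2_integrable[OF f]])
      (use m in \<open>simp_all add: norm_restr_sq indicator_def\<close>)
qed

lemma restr_norm_le: "F \<in> sets M \<Longrightarrow> f \<in> L2 M \<Longrightarrow> l2_norm M (restr F f) \<le> l2_norm M f"
  unfolding l2_norm_def
  using L2_integrable[of f M] L2_integrable[OF restr_L2[of F M f]]
  by (intro real_sqrt_le_mono integral_mono) (auto simp: norm_restr_sq indicator_def)

lemma restr_add: "restr F (f + g) = restr F f + restr F g"
  by (simp add: restr_def fun_eq_iff distrib_left)

lemma restr_scale: "restr F (cscale a f) = cscale a (restr F f)"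
  by (simp add: restr_def fun_eq_iff)

lemma norm_sq_add_le:
  assumes "f \<in> L2 M" "g \<in> L2 M"
  shows "(l2_norm M (f + g))\<^sup>2 \<le> 2 * (l2_norm M f)\<^sup>2 + 2 * (l2_norm M g)\<^sup>2"
  using L2sp.parallelogram[OF assms] zero_le_power2[of "l2_norm M (f - g)"] by linarith

definition orthonormal :: "'a measure \<Rightarrow> ('a \<Rightarrow> complex) set \<Rightarrow> bool" where
  "orthonormal M S \<longleftrightarrow> finite S \<and> S \<subseteq> L2 M \<and> (\<forall>e\<in>S. \<forall>e'\<in>S. l2_inner M e e' = (if e = e' then 1 else 0))"

lemma le_sq_of_le_mult_sqrt:
  fixes T C :: real assumes "T \<le> C * sqrt T" "0 \<le> T" shows "T \<le> C\<^sup>2"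
proof (cases "T = 0")
  case False
  then have pos: "sqrt T > 0" using assms(2) by simp
  have "sqrt T * sqrt T \<le> C * sqrt T" using assms by simp
  then have "sqrt T \<le> C" by (rule mult_right_le_imp_le[OF _ pos])
  then have "(sqrt T)\<^sup>2 \<le> C\<^sup>2" using pos by (intro power_mono) auto
  then show ?thesis using assms(2) by simp
qed simp

context pvm
begin

text \<open>Vectors of bounded energy lie in the range of the heat operator: on the half-line \<open>t \<le> \<Lambda>\<close> the
  function \<open>\<phi> t = exp (s t)\<close> is bounded since \<open>s > 0\<close>, so \<open>h = (\<integral> \<phi> dE) f\<close> exists, and the heat operator
  maps \<open>h\<close> to the cut-off \<open>E {..\<Lambda>} f\<close>.\<close>
lemma heat_range:
  assumes tot: "L2 M \<subseteq> Domain (spectral_integral M E (\<lambda>t. exp (- s * t)))" and s: "s > 0" and f: "f \<in> L2 M"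
  shows "\<exists>h g. (h, g) \<in> spectral_integral M E (\<lambda>t. exp (- s * t)) \<and> (AE x in M. Phi (indicator {..\<Lambda>}) f x = g x)"
proof -
  define \<psi> :: "real \<Rightarrow> real" where "\<psi> t = exp (- s * t)" for t
  define \<phi> :: "real \<Rightarrow> real" where "\<phi> t = exp (s * t) * indicator {..\<Lambda>} t" for t
  have \<psi>m: "\<psi> \<in> borel_measurable borel" unfolding \<psi>_def[abs_def] by measurable
  have \<phi>m: "\<phi> \<in> borel_measurable borel" unfolding \<phi>_def[abs_def] by measurable
  have \<sigma>: "simple_function borel (indicator {..\<Lambda>} :: real \<Rightarrow> real)" by (rule simple_function_indicator) simp
  have \<psi>\<phi>: "\<psi> t * \<phi> t = indicator {..\<Lambda>} t" for t
    by (simp add: \<psi>_def \<phi>_def mult.assoc[symmetric] flip: exp_add)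
  have "\<bar>\<phi> t\<bar> \<le> exp (s * \<Lambda>)" for t
    using s by (auto simp: \<phi>_def indicator_def)
  then have b: "\<bar>(\<phi> t)\<^sup>2\<bar> \<le> (exp (s * \<Lambda>))\<^sup>2" for t
    by (metis abs_ge_zero abs_of_nonneg power2_abs power_mono zero_le_power2)
  have \<phi>2: "integrable (\<nu> f) (\<lambda>t. (\<phi> t)\<^sup>2)"
    by (rule bounded_integrable[OF f _ b]) (use \<phi>m in measurable)
  obtain h where h: "is_fc f \<phi> h" using is_fc_exists[OF f \<phi>m \<phi>2] by blast
  have hL: "h \<in> L2 M" using h by (simp add: is_fc_def)
  have dom: "u \<in> spectral_integral_dom M E \<psi>" if "u \<in> L2 M" for u
    using tot that unfolding spectral_integral_def \<psi>_def by blast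
  have D: "u \<in> Dom \<psi>" if u: "u \<in> L2 M" for u
    using integrable_of_square[OF u \<psi>m] dom[OF u] u by (simp add: Dom_def spectral_integral_dom_def)
  obtain g where hg: "(h, g) \<in> spectral_integral M E \<psi>"
    using tot hL unfolding \<psi>_def by blast
  have gL: "g \<in> L2 M" using hg by (simp add: spectral_integral_def)
  obtain r where r: "approx \<psi> r" using approx_exists[OF \<psi>m] by blast
  note rs = approxD(1)[OF r]
  have rL: "Phi (r n) h \<in> L2 M" for n using hL rs by simp
  have PL: "Phi (indicator {..\<Lambda>}) f \<in> L2 M" using f \<sigma> by simp
  \<comment> \<open>With \<open>r n\<close> approximating \<open>exp (- s t)\<close>, the product \<open>r n t * \<phi> t\<close> stays bounded by 2.\<close>
  have conv: "L2sp.converges_to M (\<lambda>n. Phi (r n) h) (Phi (indicator {..\<Lambda>}) f)"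
  proof -
    have sq: "(l2_norm M (Phi (indicator {..\<Lambda>}) f - Phi (r n) h))\<^sup>2 = (LINT t|\<nu> f. (r n t * \<phi> t - indicator {..\<Lambda>} t)\<^sup>2)" for n
      using is_fc_Phi[OF h f \<phi>m \<phi>2 rs[of n]] \<sigma> unfolding is_fc_def by blast
    have "(\<lambda>n. LINT t|\<nu> f. (r n t * \<phi> t - indicator {..\<Lambda>} t)\<^sup>2) \<longlonglongrightarrow> (LINT t|\<nu> f. 0)"
    proof (rule integral_dominated_convergence[where w = "\<lambda>_. 9"])
      show "(\<lambda>t. (r n t * \<phi> t - indicator {..\<Lambda>} t)\<^sup>2) \<in> borel_measurable (\<nu> f)" for n
        by (rule measurable_\<nu>) (use borel_measurable_simple_function[OF rs[of n]] \<phi>m in measurable)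
      show "integrable (\<nu> f) (\<lambda>_. 9::real)"
        by (rule finite_measure.integrable_const[OF finite_measure_\<nu>[OF f]])
      show "AE t in \<nu> f. (\<lambda>n. (r n t * \<phi> t - indicator {..\<Lambda>} t)\<^sup>2) \<longlonglongrightarrow> 0"
      proof (rule AE_I2)
        fix t
        have "(\<lambda>n. (r n t * \<phi> t - indicator {..\<Lambda>} t)\<^sup>2) \<longlonglongrightarrow> (\<psi> t * \<phi> t - indicator {..\<Lambda>} t)\<^sup>2"
          by (intro tendsto_power tendsto_diff tendsto_mult tendsto_const approxD(2)[OF r])
        then show "(\<lambda>n. (r n t * \<phi> t - indicator {..\<Lambda>} t)\<^sup>2) \<longlonglongrightarrow> 0" by (simp add: \<psi>\<phi>)
      qed
      have "norm ((r n t * \<phi> t - indicator {..\<Lambda>} t)\<^sup>2) \<le> 9" for n t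
      proof -
        have "\<bar>r n t * \<phi> t\<bar> \<le> 2 * \<bar>\<psi> t * \<phi> t\<bar>"
          using mult_right_mono[OF approxD(3)[OF r, of n t], of "\<bar>\<phi> t\<bar>"] by (simp add: abs_mult)
        then have "\<bar>r n t * \<phi> t\<bar> \<le> 2" unfolding \<psi>\<phi> by (cases "t \<le> \<Lambda>") auto
        then have "\<bar>r n t * \<phi> t - indicator {..\<Lambda>} t\<bar> \<le> 3" by (auto simp: indicator_def)
        then have "\<bar>r n t * \<phi> t - indicator {..\<Lambda>} t\<bar>\<^sup>2 \<le> 3\<^sup>2" by (intro power_mono) auto
        then show ?thesis by simp
      qed
      then show "AE t in \<nu> f. norm ((r n t * \<phi> t - indicator {..\<Lambda>} t)\<^sup>2) \<le> 9" for n by simp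
    qed simp
    then have "(\<lambda>n. sqrt ((l2_norm M (Phi (indicator {..\<Lambda>}) f - Phi (r n) h))\<^sup>2)) \<longlonglongrightarrow> sqrt 0"
      unfolding sq by (intro tendsto_real_sqrt) simp
    then show ?thesis
      using L2sp.nrm_diff_commute[OF PL rL] by (simp add: L2sp.converges_to_def)
  qed
  have "AE x in M. Phi (indicator {..\<Lambda>}) f x = g x"
  proof (rule L2_AE_eqI[OF PL gL])
    fix u assume u: "u \<in> L2 M"
    have "l2_inner M u g = form \<psi> u h" using hg dom[OF u] by (simp add: spectral_integral_def)
    moreover have "form \<psi> u h = l2_inner M u (Phi (indicator {..\<Lambda>}) f)"
      by (rule LIMSEQ_unique[OF form_limit[OF \<psi>m r D[OF u] D[OF hL]] L2sp.ip_tendsto_right[OF rL PL u conv]])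
    ultimately show "l2_inner M u (Phi (indicator {..\<Lambda>}) f) = l2_inner M u g" by simp
  qed
  then show ?thesis using hg unfolding \<psi>_def by blast
qed

text \<open>The closed graph theorem for maps from \<open>L\<^sup>2\<close> to \<open>L\<^sup>\<infinity>\<close>: the sets of vectors whose image is bounded
  by \<open>n\<close> are closed and cover, so one of them contains a ball, and scaling does the rest.\<close>
lemma Phi_Linf_bounded:
  assumes s: "simple_function borel \<sigma>" and inf: "\<And>f. f \<in> L2 M \<Longrightarrow> Phi \<sigma> f \<in> Linf M"
  shows "\<exists>C. \<forall>f\<in>L2 M. AE x in M. norm (Phi \<sigma> f x) \<le> C * l2_norm M f"
proof -
  define B where "B n = {f \<in> L2 M. AE x in M. norm (Phi \<sigma> f x) \<le> real n}" for n
  have "\<exists>n. \<exists>x\<in>L2 M. \<exists>r>0. \<forall>y\<in>L2 M. l2_norm M (y - x) < r \<longrightarrow> y \<in> B n"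
  proof (rule L2sp.Baire_ball)
    show "B n \<subseteq> L2 M" for n by (auto simp: B_def)
    show "L2 M \<subseteq> (\<Union>n. B n)"
    proof
      fix f assume f: "f \<in> L2 M"
      then obtain C where C: "AE x in M. norm (Phi \<sigma> f x) \<le> C" using inf by (auto simp: Linf_def)
      obtain n where "C \<le> real n" using real_arch_simple by blast
      then have "AE x in M. norm (Phi \<sigma> f x) \<le> real n" using C by (auto elim: eventually_mono)
      then show "f \<in> (\<Union>n. B n)" using f by (auto simp: B_def)
    qed
    fix n f l assume f: "\<And>k::nat. f k \<in> B n" and l: "l \<in> L2 M" "L2sp.converges_to M f l"
    have fL: "f k \<in> L2 M" for k using f by (simp add: B_def)
    have "(\<lambda>k. l2_norm M (Phi \<sigma> (f k) - Phi \<sigma> l)) \<longlonglongrightarrow> 0"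
      using Phi_converges[OF fL l s] by (simp add: L2sp.converges_to_def)
    then obtain r :: "nat \<Rightarrow> nat" where r: "AE x in M. (\<lambda>k. Phi \<sigma> (f (r k)) x) \<longlonglongrightarrow> Phi \<sigma> l x"
      using L2_limit_AE_subseq[of "\<lambda>k. Phi \<sigma> (f k)" M "Phi \<sigma> l"] fL l(1) s by auto
    have "AE x in M. \<forall>k. norm (Phi \<sigma> (f (r k)) x) \<le> real n"
      using f by (simp add: AE_all_countable B_def)
    then have "AE x in M. norm (Phi \<sigma> l x) \<le> real n" using r
    proof eventually_elim
      case (elim x)
      show ?case by (rule LIMSEQ_le_const2[OF tendsto_norm[OF elim(2)]]) (use elim(1) in blast)
    qed
    then show "l \<in> B n" using l by (simp add: B_def)
  qed
  then obtain n x0 r where x0: "x0 \<in> L2 M" and r: "r > 0"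
    and ball: "\<And>y. y \<in> L2 M \<Longrightarrow> l2_norm M (y - x0) < r \<Longrightarrow> y \<in> B n" by blast
  have "AE x in M. norm (Phi \<sigma> f x) \<le> (4 * real n / r) * l2_norm M f" if f: "f \<in> L2 M" for f
  proof (cases "l2_norm M f = 0")
    case True
    obtain b where b: "\<And>t. \<bar>\<sigma> t\<bar> \<le> b" using simple_bounded[OF s] by blast
    have "l2_norm M (Phi \<sigma> f) \<le> 0" using Phi_bounded[OF f s b] True by simp
    then have "l2_norm M (Phi \<sigma> f) = 0" using l2_norm_nonneg[of M "Phi \<sigma> f"] by linarith
    then have "AE x in M. Phi \<sigma> f x = 0" using l2_norm_zero_iff[OF Phi_L2[OF f s]] by blast
    then show ?thesis using True by (auto elim: eventually_mono)
  next
    case False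
    then have pos: "l2_norm M f > 0" by (simp add: less_le)
    define a where "a = r / (2 * l2_norm M f)"
    have a: "a > 0" using r pos by (simp add: a_def)
    define g where "g = cscale (complex_of_real a) f"
    have g: "g \<in> L2 M" using f by (simp add: g_def L2_cscale)
    have "l2_norm M g = a * l2_norm M f"
      using L2sp.nrm_scale[OF f, of "complex_of_real a"] a by (simp only: g_def norm_of_real abs_of_pos)
    then have "l2_norm M g = r / 2" using pos by (simp add: a_def)
    then have "x0 + g \<in> B n" using ball[OF L2_add[OF x0 g]] r by simp
    moreover have "x0 \<in> B n" using ball[OF x0] r by (simp add: L2sp.nrm_zero)
    ultimately have bd: "AE x in M. norm (Phi \<sigma> (x0 + g) x) \<le> real n" "AE x in M. norm (Phi \<sigma> x0 x) \<le> real n"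
      by (auto simp: B_def)
    show ?thesis
      using bd Phi_add_AE[OF x0 g s] Phi_scale_AE[OF f s, of "complex_of_real a"]
    proof eventually_elim
      case (elim x)
      have "Phi \<sigma> (x0 + g) x - Phi \<sigma> x0 x = complex_of_real a * Phi \<sigma> f x"
        using elim(3,4) by (simp add: g_def)
      then have "a * norm (Phi \<sigma> f x) \<le> norm (Phi \<sigma> (x0 + g) x) + norm (Phi \<sigma> x0 x)"
        using norm_triangle_ineq4[of "Phi \<sigma> (x0 + g) x" "Phi \<sigma> x0 x"] a by (simp add: norm_mult)
      also have "\<dots> \<le> 2 * real n" using elim(1,2) by simp
      finally have "norm (Phi \<sigma> f x) \<le> 2 * real n / a" using a by (simp add: field_simps)
      also have "\<dots> = (4 * real n / r) * l2_norm M f" using r pos by (simp add: a_def)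
      finally show ?case .
    qed
  qed
  then show ?thesis by blast
qed

lemma Phi_sum_AE:
  assumes S: "finite S" "S \<subseteq> L2 M" and s: "simple_function borel \<sigma>"
  shows "AE x in M. Phi \<sigma> (\<Sum>e\<in>S. cscale (a e) e) x = (\<Sum>e\<in>S. a e * Phi \<sigma> e x)"
proof -
  have sumL: "(\<Sum>e\<in>S. cscale (a e) e) \<in> L2 M" "(\<Sum>e\<in>S. cscale (a e) (Phi \<sigma> e)) \<in> L2 M"
    using S s by (auto intro!: L2sp.H_sum L2_cscale)
  have "AE x in M. Phi \<sigma> (\<Sum>e\<in>S. cscale (a e) e) x = (\<Sum>e\<in>S. cscale (a e) (Phi \<sigma> e)) x"
  proof (rule L2_AE_eqI[OF Phi_L2[OF sumL(1) s] sumL(2)])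
    fix h assume h: "h \<in> L2 M"
    have "l2_inner M h (Phi \<sigma> (\<Sum>e\<in>S. cscale (a e) e)) = (\<Sum>e\<in>S. a e * l2_inner M (Phi \<sigma> h) e)"
      unfolding Phi_sym[OF h sumL(1) s] using S h s
      by (subst L2sp.ip_sum_right) (auto simp: L2sp.ip_scale_right L2_cscale intro!: sum.cong)
    also have "\<dots> = l2_inner M h (\<Sum>e\<in>S. cscale (a e) (Phi \<sigma> e))"
      using S h s by (subst L2sp.ip_sum_right) (auto simp: L2sp.ip_scale_right L2_cscale Phi_sym intro!: sum.cong)
    finally show "l2_inner M h (Phi \<sigma> (\<Sum>e\<in>S. cscale (a e) e)) = l2_inner M h (\<Sum>e\<in>S. cscale (a e) (Phi \<sigma> e))" .
  qed
  then show ?thesis by (simp add: sum_fun_apply)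
qed

text \<open>For fixed coefficients, \<open>|\<Sum>e. a e * Phi \<sigma> e x| \<le> C \<parallel>a\<parallel>\<close> off a null set. Countably many coefficient vectors
  share one null set, and off it the bound extends by continuity to all of them, in particular to the
  choice \<open>a e = cnj (Phi \<sigma> e x)\<close> that depends on \<open>x\<close>.\<close>
lemma pointwise_Bessel:
  assumes s: "simple_function borel \<sigma>" and S: "orthonormal M S"
    and C: "\<And>f. f \<in> L2 M \<Longrightarrow> AE x in M. norm (Phi \<sigma> f x) \<le> C * l2_norm M f"
  shows "AE x in M. (\<Sum>e\<in>S. (norm (Phi \<sigma> e x))\<^sup>2) \<le> C\<^sup>2"
proof -
  have fin: "finite S" and SL: "S \<subseteq> L2 M"
    and on: "\<And>e e'. e \<in> S \<Longrightarrow> e' \<in> S \<Longrightarrow> l2_inner M e e' = (if e = e' then 1 else 0)"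
    using S by (auto simp: orthonormal_def)
  obtain D :: "complex set" where D: "countable D" "\<And>X. open X \<Longrightarrow> X \<noteq> {} \<Longrightarrow> \<exists>d\<in>D. d \<in> X"
    by (erule countable_dense_setE)
  define A where "A = (\<Pi>\<^sub>E e\<in>S. D)"
  have cA: "countable A" unfolding A_def using fin D(1) by (intro countable_PiE) auto
  have "AE x in M. norm (\<Sum>e\<in>S. a e * Phi \<sigma> e x) \<le> C * sqrt (\<Sum>e\<in>S. (cmod (a e))\<^sup>2)" for a
  proof -
    have L: "(\<Sum>e\<in>S. cscale (a e) e) \<in> L2 M" using SL by (auto intro!: L2sp.H_sum L2_cscale)
    have "(l2_norm M (\<Sum>e\<in>S. cscale (a e) e))\<^sup>2 = (\<Sum>e\<in>S. (cmod (a e))\<^sup>2)"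
      using fin SL on by (intro L2sp.nrm_sq_sum_orthonormal) auto
    then have "l2_norm M (\<Sum>e\<in>S. cscale (a e) e) = sqrt (\<Sum>e\<in>S. (cmod (a e))\<^sup>2)"
      using l2_norm_nonneg real_sqrt_unique by metis
    then show ?thesis using C[OF L] Phi_sum_AE[OF fin SL s, of a] by (auto elim: eventually_elim2)
  qed
  then have "AE x in M. \<forall>a\<in>A. norm (\<Sum>e\<in>S. a e * Phi \<sigma> e x) \<le> C * sqrt (\<Sum>e\<in>S. (cmod (a e))\<^sup>2)"
    unfolding AE_ball_countable[OF cA] by blast
  then show ?thesis
  proof eventually_elim
    case (elim x)
    define v where "v e = cnj (Phi \<sigma> e x)" for e
    have "\<exists>a\<in>A. \<forall>e\<in>S. dist (a e) (v e) < inverse (real (Suc n))" for n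
    proof -
      have "\<exists>d\<in>D. d \<in> ball (v e) (inverse (real (Suc n)))" for e
        by (intro D(2)) auto
      then obtain d where d: "\<And>e. d e \<in> D" "\<And>e. d e \<in> ball (v e) (inverse (real (Suc n)))" by metis
      have "restrict d S \<in> A" using d(1) by (auto simp: A_def)
      then show ?thesis using d(2) by (intro bexI[of _ "restrict d S"]) (auto simp: dist_commute)
    qed
    then obtain a where a: "\<And>n. a n \<in> A" "\<And>n e. e \<in> S \<Longrightarrow> dist (a n e) (v e) < inverse (real (Suc n))"
      by metis
    have lim: "(\<lambda>n. a n e) \<longlonglongrightarrow> v e" if e: "e \<in> S" for e
    proof (rule tendsto_dist_iff[THEN iffD2], rule Lim_null_comparison[OF _ LIMSEQ_inverse_real_of_nat])
      show "\<forall>\<^sub>F n in sequentially. norm (dist (a n e) (v e)) \<le> inverse (real (Suc n))"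
        using a(2)[OF e] by (intro always_eventually allI) (simp add: less_imp_le)
    qed
    define T where "T = (\<Sum>e\<in>S. (norm (Phi \<sigma> e x))\<^sup>2)"
    have T: "T \<ge> 0" by (simp add: T_def sum_nonneg)
    have "(\<lambda>n. norm (\<Sum>e\<in>S. a n e * Phi \<sigma> e x)) \<longlonglongrightarrow> norm (\<Sum>e\<in>S. v e * Phi \<sigma> e x)"
      by (intro tendsto_norm tendsto_sum tendsto_mult tendsto_const lim)
    moreover have "(\<lambda>n. C * sqrt (\<Sum>e\<in>S. (cmod (a n e))\<^sup>2)) \<longlonglongrightarrow> C * sqrt (\<Sum>e\<in>S. (cmod (v e))\<^sup>2)"
      by (intro tendsto_real_sqrt tendsto_norm tendsto_sum tendsto_mult tendsto_power tendsto_const lim)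
    ultimately have "norm (\<Sum>e\<in>S. v e * Phi \<sigma> e x) \<le> C * sqrt (\<Sum>e\<in>S. (cmod (v e))\<^sup>2)"
      by (rule LIMSEQ_le) (use elim a(1) in blast)
    moreover have "(\<Sum>e\<in>S. v e * Phi \<sigma> e x) = complex_of_real T"
    proof -
      have "v e * Phi \<sigma> e x = complex_of_real ((norm (Phi \<sigma> e x))\<^sup>2)" for e
        by (simp add: v_def complex_norm_square mult.commute del: of_real_power)
      then show ?thesis by (simp only: T_def of_real_sum)
    qed
    moreover have "(\<Sum>e\<in>S. (cmod (v e))\<^sup>2) = T" by (simp add: v_def T_def)
    ultimately have "T \<le> C * sqrt T" using T by (simp only: norm_of_real abs_of_nonneg)
    then show ?case using T le_sq_of_le_mult_sqrt unfolding T_def by blast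
  qed
qed

text \<open>Integrating the pointwise bound over a set of finite measure bounds the Hilbert-Schmidt norm of
  the cut-off followed by restriction to \<open>F\<close>.\<close>
lemma Hilbert_Schmidt_bound:
  assumes s: "simple_function borel \<sigma>" and S: "orthonormal M S"
    and C: "\<And>f. f \<in> L2 M \<Longrightarrow> AE x in M. norm (Phi \<sigma> f x) \<le> C * l2_norm M f"
    and F: "F \<in> sets M" "emeasure M F < \<infinity>"
  shows "(\<Sum>e\<in>S. (l2_norm M (restr F (Phi \<sigma> e)))\<^sup>2) \<le> C\<^sup>2 * measure M F"
proof -
  have SL: "S \<subseteq> L2 M" using S by (simp add: orthonormal_def)
  have int: "integrable M (\<lambda>x. (norm (restr F (Phi \<sigma> e) x))\<^sup>2)" if "e \<in> S" for e
    using that SL s F(1) by (intro L2_integrable restr_L2 Phi_L2) auto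
  have "(\<Sum>e\<in>S. (l2_norm M (restr F (Phi \<sigma> e)))\<^sup>2) = (LINT x|M. (\<Sum>e\<in>S. (norm (restr F (Phi \<sigma> e) x))\<^sup>2))"
    unfolding l2_norm_sq using int by (rule Bochner_Integration.integral_sum[symmetric])
  also have "\<dots> \<le> (LINT x|M. C\<^sup>2 * indicator F x)"
  proof (rule integral_mono_AE)
    show "integrable M (\<lambda>x. \<Sum>e\<in>S. (norm (restr F (Phi \<sigma> e) x))\<^sup>2)"
      using int by (rule Bochner_Integration.integrable_sum)
    show "integrable M (\<lambda>x. C\<^sup>2 * indicator F x)" using F by simp
    show "AE x in M. (\<Sum>e\<in>S. (norm (restr F (Phi \<sigma> e) x))\<^sup>2) \<le> C\<^sup>2 * indicator F x"
    proof -
      have "AE x in M. (\<Sum>e\<in>S. (norm (Phi \<sigma> e x))\<^sup>2) \<le> C\<^sup>2" by (rule pointwise_Bessel[OF s S C])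
      then show ?thesis by eventually_elim (simp add: norm_restr_sq indicator_def)
    qed
  qed
  also have "\<dots> = C\<^sup>2 * measure M F" using F by simp
  finally show ?thesis .
qed

text \<open>Choose a finite orthonormal set \<open>S\<close> whose Hilbert-Schmidt sum is within \<open>\<epsilon> / 2\<close> of the supremum over
  all such sets. A unit vector orthogonal to \<open>S\<close> can be added to it, so it contributes at most \<open>\<epsilon> / 2\<close>:
  up to a small error, the operator only depends on the coefficients with respect to \<open>S\<close>.\<close>
lemma compact_cutoff:
  assumes s: "simple_function borel \<sigma>" and \<sigma>1: "\<And>t. \<bar>\<sigma> t\<bar> \<le> 1"
    and inf: "\<And>f. f \<in> L2 M \<Longrightarrow> Phi \<sigma> f \<in> Linf M"
    and F: "F \<in> sets M" "emeasure M F < \<infinity>" and \<epsilon>: "\<epsilon> > 0"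
  shows "\<exists>S. finite S \<and> S \<subseteq> L2 M \<and> (\<forall>f\<in>L2 M.
    (l2_norm M (restr F (Phi \<sigma> f)))\<^sup>2 \<le> \<epsilon> * (l2_norm M f)\<^sup>2 + 2 * (\<Sum>e\<in>S. (cmod (l2_inner M e f))\<^sup>2))"
proof -
  obtain C where C: "\<And>f. f \<in> L2 M \<Longrightarrow> AE x in M. norm (Phi \<sigma> f x) \<le> C * l2_norm M f"
    using Phi_Linf_bounded[OF s inf] by blast
  define w where "w f = (l2_norm M (restr F (Phi \<sigma> f)))\<^sup>2" for f
  define W where "W = (\<lambda>S. \<Sum>e\<in>S. w e) ` {S. orthonormal M S}"
  have bdd: "bdd_above W"
    unfolding W_def w_def using Hilbert_Schmidt_bound[OF s _ C F] by (intro bdd_aboveI2) auto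
  have "orthonormal M {}" by (simp add: orthonormal_def)
  then have "W \<noteq> {}" by (auto simp: W_def)
  then obtain y where y: "y \<in> W" "Sup W - \<epsilon> / 2 < y"
    using less_cSupD[of W "Sup W - \<epsilon> / 2"] \<epsilon> by auto
  then obtain S where S: "orthonormal M S" "Sup W - \<epsilon> / 2 < (\<Sum>e\<in>S. w e)" by (auto simp: W_def)
  have fin: "finite S" and SL: "S \<subseteq> L2 M"
    and on: "\<And>e e'. e \<in> S \<Longrightarrow> e' \<in> S \<Longrightarrow> l2_inner M e e' = (if e = e' then 1 else 0)"
    using S(1) by (auto simp: orthonormal_def)
  have w_scale: "w (cscale a f) = (cmod a)\<^sup>2 * w f" if f: "f \<in> L2 M" for a f
  proof -
    have L: "Phi \<sigma> f \<in> L2 M" "cscale a f \<in> L2 M" using f s by (simp_all add: L2_cscale)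
    have ae: "AE x in M. restr F (Phi \<sigma> (cscale a f)) x = restr F (cscale a (Phi \<sigma> f)) x"
      using Phi_scale_AE[OF f s, of a] by eventually_elim (simp add: restr_def)
    have "l2_norm M (restr F (Phi \<sigma> (cscale a f))) = l2_norm M (restr F (cscale a (Phi \<sigma> f)))"
      by (rule l2_norm_cong_AE[OF ae]) (intro restr_L2 F(1) Phi_L2 L2_cscale f s)+
    also have "\<dots> = cmod a * l2_norm M (restr F (Phi \<sigma> f))"
      unfolding restr_scale by (rule L2sp.nrm_scale[OF restr_L2[OF F(1) L(1)]])
    finally show ?thesis by (simp add: w_def power_mult_distrib)
  qed
  have unit: "w u \<le> \<epsilon> / 2" if u: "u \<in> L2 M" "l2_norm M u = 1" and orth: "\<And>e. e \<in> S \<Longrightarrow> l2_inner M e u = 0" for u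
  proof -
    have uu: "l2_inner M u u = 1" using L2sp.ip_self[OF u(1)] u(2) by simp
    have uS: "u \<notin> S" using orth[of u] uu by auto
    have "l2_inner M u e = 0" if "e \<in> S" for e
      using orth[OF that] L2sp.ip_commute[of e M u] that SL u(1) by auto
    then have "orthonormal M (insert u S)"
      using fin SL on u(1) uu orth uS by (auto simp: orthonormal_def)
    then have "(\<Sum>e\<in>insert u S. w e) \<le> Sup W" using bdd by (intro cSup_upper) (auto simp: W_def)
    then show ?thesis using S(2) fin uS by simp
  qed
  have perp: "w g \<le> \<epsilon> / 2 * (l2_norm M g)\<^sup>2" if g: "g \<in> L2 M" and orth: "\<And>e. e \<in> S \<Longrightarrow> l2_inner M e g = 0" for g
  proof (cases "l2_norm M g = 0")
    case True
    have "l2_norm M (restr F (Phi \<sigma> g)) \<le> 1 * l2_norm M g"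
      by (rule order_trans[OF restr_norm_le[OF F(1) Phi_L2[OF g s]] Phi_bounded[OF g s \<sigma>1]])
    then have "l2_norm M (restr F (Phi \<sigma> g)) = 0" using True l2_norm_nonneg[of M "restr F (Phi \<sigma> g)"] by linarith
    then show ?thesis using True by (simp add: w_def)
  next
    case False
    define a where "a = complex_of_real (1 / l2_norm M g)"
    have "w (cscale a g) \<le> \<epsilon> / 2"
    proof (rule unit)
      show "l2_norm M (cscale a g) = 1" using False L2sp.nrm_scale[OF g, of a] by (simp add: a_def norm_divide)
      show "l2_inner M e (cscale a g) = 0" if "e \<in> S" for e
        using orth[OF that] that SL g by (auto simp: L2sp.ip_scale_right)
    qed (rule L2_cscale[OF g])
    then have "w g / (l2_norm M g)\<^sup>2 \<le> \<epsilon> / 2"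
      unfolding w_scale[OF g] by (simp add: a_def norm_divide power_divide)
    moreover have "(l2_norm M g)\<^sup>2 > 0" using False by simp
    ultimately show ?thesis by (simp only: pos_divide_le_eq)
  qed
  have "w f \<le> \<epsilon> * (l2_norm M f)\<^sup>2 + 2 * (\<Sum>e\<in>S. (cmod (l2_inner M e f))\<^sup>2)" if f: "f \<in> L2 M" for f
  proof -
    define p where "p = (\<Sum>e\<in>S. cscale (l2_inner M e f) e)"
    have p: "p \<in> L2 M" unfolding p_def using SL by (auto intro!: L2sp.H_sum L2_cscale)
    have p_sq: "(l2_norm M p)\<^sup>2 = (\<Sum>e\<in>S. (cmod (l2_inner M e f))\<^sup>2)"
      unfolding p_def using fin SL on by (intro L2sp.nrm_sq_sum_orthonormal) auto
    define g where "g = f - p"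
    have g: "g \<in> L2 M" using f p by (simp add: g_def)
    have orth: "l2_inner M e g = 0" if e: "e \<in> S" for e
    proof -
      have "l2_inner M e p = l2_inner M e f"
        unfolding p_def using fin SL on e by (intro L2sp.ip_sum_orthonormal) auto
      then show ?thesis using e SL f p by (auto simp: g_def L2sp.ip_diff_right)
    qed
    have "l2_inner M p g = (\<Sum>e\<in>S. cnj (l2_inner M e f) * l2_inner M e g)"
      unfolding p_def using SL g by (subst L2sp.ip_sum_left) (auto simp: L2sp.ip_scale_left L2_cscale intro!: sum.cong)
    then have "l2_inner M p g = 0" using orth by simp
    then have "(l2_norm M (p + g))\<^sup>2 = (l2_norm M p)\<^sup>2 + (l2_norm M g)\<^sup>2" using L2sp.nrm_sq_add[OF p g] by simp
    moreover have fpg: "f = p + g" by (simp add: g_def)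
    ultimately have g_le: "(l2_norm M g)\<^sup>2 \<le> (l2_norm M f)\<^sup>2" by simp
    have L: "Phi \<sigma> p \<in> L2 M" "Phi \<sigma> g \<in> L2 M" using p g s by auto
    have ae: "AE x in M. restr F (Phi \<sigma> f) x = restr F (Phi \<sigma> p + Phi \<sigma> g) x"
      unfolding fpg using Phi_add_AE[OF p g s] by eventually_elim (simp add: restr_def)
    have "w f = (l2_norm M (restr F (Phi \<sigma> p + Phi \<sigma> g)))\<^sup>2"
      unfolding w_def by (rule arg_cong[where f = "\<lambda>x. x\<^sup>2"], rule l2_norm_cong_AE[OF ae])
        (intro restr_L2 F(1) Phi_L2 L2_add f p g s)+
    also have "\<dots> \<le> 2 * w p + 2 * w g"
      unfolding restr_add w_def using L F(1) by (intro norm_sq_add_le restr_L2)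
    also have "w p \<le> (1 * l2_norm M p)\<^sup>2"
      unfolding w_def
      by (rule power_mono[OF order_trans[OF restr_norm_le[OF F(1) L(1)] Phi_bounded[OF p s \<sigma>1]]]) simp
    also have "w g \<le> \<epsilon> / 2 * (l2_norm M g)\<^sup>2" using g orth by (rule perp)
    also have "\<epsilon> / 2 * (l2_norm M g)\<^sup>2 \<le> \<epsilon> / 2 * (l2_norm M f)\<^sup>2" using g_le \<epsilon> by (intro mult_left_mono) auto
    finally show ?thesis by (simp add: p_sq)
  qed
  then show ?thesis using fin SL unfolding w_def by blast
qed

end

section \<open>Confining potentials\<close>

lemma polarize_plus: "polarize (\<lambda>u. q1 u + q2 u) h f = polarize q1 h f + polarize q2 h f"
  by (simp add: polarize_def sum.distrib distrib_left add_divide_distrib)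

lemma Linf_cong_AE:
  assumes "g \<in> Linf M" "f \<in> borel_measurable M" "AE x in M. f x = g x"
  shows "f \<in> Linf M"
proof -
  obtain C where "AE x in M. norm (g x) \<le> C" using assms(1) by (auto simp: Linf_def)
  with assms(3) have "AE x in M. norm (f x) \<le> C" by eventually_elim simp
  then show ?thesis using assms(2) by (auto simp: Linf_def)
qed

text \<open>The situation of the theorem in terms of the spectral measure: \<open>c\<close> is a lower bound of the
  unperturbed operator, and the spectral cut-offs map \<open>L\<^sup>2\<close> into \<open>L\<^sup>\<infinity>\<close>.\<close>
locale confined_form = pvm M E
  for M :: "'a measure" and E +
  fixes V :: "'a \<Rightarrow> real" and c :: real
  assumes support: "f \<in> L2 M \<Longrightarrow> AE t in spectral_dist M E f. c \<le> t"
    and V_meas [measurable]: "V \<in> borel_measurable M"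
    and V_nonneg: "x \<in> space M \<Longrightarrow> 0 \<le> V x"
    and V_confining: "emeasure M {x \<in> space M. V x < R} < \<infinity>"
    and smoothing: "f \<in> L2 M \<Longrightarrow> Phi (indicator {..\<Lambda>}) f \<in> Linf M"
begin

text \<open>The potential energy is the square of the \<open>L\<^sup>2\<close>-norm for the measure with density \<open>V\<close>. The results
  on \<open>L\<^sup>2\<close> thus provide its sesquilinear form and its completeness.\<close>
abbreviation "MV \<equiv> density M (\<lambda>x. ennreal (V x))"

abbreviation "Q \<equiv> Dom (\<lambda>t. t) \<inter> L2 MV"

definition q :: "('a \<Rightarrow> complex) \<Rightarrow> real" where
  "q f = (LINT t|\<nu> f. t) + (LINT x|M. V x * (norm (f x))\<^sup>2)"

lemma V_AE: "AE x in M. 0 \<le> V x"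
  using V_nonneg by (intro AE_I2)

lemma L2_MV_iff: "f \<in> L2 M \<Longrightarrow> f \<in> L2 MV \<longleftrightarrow> integrable M (\<lambda>x. V x * (norm (f x))\<^sup>2)"
proof -
  assume f: "f \<in> L2 M"
  have m: "(\<lambda>x. (norm (f x))\<^sup>2) \<in> borel_measurable M" using L2_measurable[OF f] by measurable
  have "f \<in> L2 MV \<longleftrightarrow> integrable MV (\<lambda>x. (norm (f x))\<^sup>2)"
    using L2_measurable[OF f] by (simp add: L2_def)
  also have "\<dots> \<longleftrightarrow> integrable M (\<lambda>x. V x * (norm (f x))\<^sup>2)"
    unfolding integrable_density[OF m V_meas V_AE] real_scaleR_def ..
  finally show ?thesis .
qed

lemma MV_norm_sq: "f \<in> L2 M \<Longrightarrow> (l2_norm MV f)\<^sup>2 = (LINT x|M. V x * (norm (f x))\<^sup>2)"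
proof -
  assume f: "f \<in> L2 M"
  have m: "(\<lambda>x. (norm (f x))\<^sup>2) \<in> borel_measurable M" using L2_measurable[OF f] by measurable
  show ?thesis
    unfolding l2_norm_sq integral_density[OF m V_meas V_AE] real_scaleR_def ..
qed

lemma AE_MV: "AE x in M. P x \<Longrightarrow> AE x in MV. P x"
  by (simp add: AE_density) (auto elim: eventually_mono)

lemma id_measurable: "(\<lambda>t::real. t) \<in> borel_measurable borel"
  by measurable

lemma Q_subspace: "fun_vs.subspace Q"
  by (intro fun_vs.subspace_inter Dom_subspace id_measurable L2_subspace)

lemma Q_in_L2: "f \<in> Q \<Longrightarrow> f \<in> L2 M"
  using Dom_L2 by blast

lemma q_eq: "f \<in> Q \<Longrightarrow> q f = (LINT t|\<nu> f. t) + (l2_norm MV f)\<^sup>2"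
  by (simp add: q_def MV_norm_sq Q_in_L2)

lemma polarize_q:
  assumes h: "h \<in> Q" and f: "f \<in> Q"
  shows "polarize q h f = form (\<lambda>t. t) h f + l2_inner MV h f"
proof -
  have "polarize (\<lambda>u. LINT x|M. V x * (norm (u x))\<^sup>2) h f = l2_inner MV h f"
  proof (rule polarize_eq_sesquilinear[OF Q_subspace h f])
    fix u v w :: "'a \<Rightarrow> complex" and a assume u: "u \<in> Q" and v: "v \<in> Q"
    show "l2_inner MV u (cscale a v) = a * l2_inner MV u v"
      using u v by (intro L2sp.ip_scale_right) auto
    show "l2_inner MV v u = cnj (l2_inner MV u v)"
      using u v by (intro L2sp.ip_commute) auto
    show "l2_inner MV u u = complex_of_real (LINT x|M. V x * (norm (u x))\<^sup>2)"
      using MV_norm_sq[OF Q_in_L2[OF u]] L2sp.ip_self[of u MV] u by simp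
    assume w: "w \<in> Q"
    show "l2_inner MV u (v + w) = l2_inner MV u v + l2_inner MV u w"
      using u v w by (intro L2sp.ip_add_right) auto
  qed
  then show ?thesis unfolding q_def[abs_def] polarize_plus by simp
qed

lemma energy:
  assumes f: "f \<in> Dom (\<lambda>t. t)"
  shows "(LINT t|\<nu> f. \<bar>t - c\<bar>) = (LINT t|\<nu> f. t) - c * (l2_norm M f)\<^sup>2"
    and "f \<in> Dom (\<lambda>t. t - c)"
    and "0 \<le> (LINT t|\<nu> f. t) - c * (l2_norm M f)\<^sup>2"
proof -
  have fL: "f \<in> L2 M" and int: "integrable (\<nu> f) (\<lambda>t. t)" using f by (auto simp: Dom_def)
  have c_int: "integrable (\<nu> f) (\<lambda>_. c)" by (rule finite_measure.integrable_const[OF finite_measure_\<nu>[OF fL]])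
  show "f \<in> Dom (\<lambda>t. t - c)" using fL int c_int by (simp add: Dom_def)
  have "(LINT t|\<nu> f. \<bar>t - c\<bar>) = (LINT t|\<nu> f. t - c)"
  proof (rule integral_cong_AE)
    show "AE t in \<nu> f. \<bar>t - c\<bar> = t - c" using support[OF fL] by eventually_elim simp
  qed (rule measurable_\<nu>, measurable)+
  also have "\<dots> = (LINT t|\<nu> f. t) - c * (l2_norm M f)\<^sup>2"
    using int c_int measure_\<nu>_UNIV[OF fL] by (simp add: mult.commute)
  finally show eq: "(LINT t|\<nu> f. \<bar>t - c\<bar>) = (LINT t|\<nu> f. t) - c * (l2_norm M f)\<^sup>2" .
  show "0 \<le> (LINT t|\<nu> f. t) - c * (l2_norm M f)\<^sup>2"
    unfolding eq[symmetric] by (rule integral_nonneg_AE) simp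
qed

lemma Dom_shift: "f \<in> Dom (\<lambda>t. t - c) \<Longrightarrow> f \<in> Dom (\<lambda>t. t)"
proof -
  assume f: "f \<in> Dom (\<lambda>t. t - c)"
  then have fL: "f \<in> L2 M" by (rule Dom_L2)
  have "integrable (\<nu> f) (\<lambda>t. (t - c) + c)"
    using f finite_measure.integrable_const[OF finite_measure_\<nu>[OF fL]]
    by (intro Bochner_Integration.integrable_add) (auto simp: Dom_def)
  then show "f \<in> Dom (\<lambda>t. t)" using fL by (simp add: Dom_def)
qed

lemma form_norm_eq:
  "f \<in> Q \<Longrightarrow> q f + (1 - c) * (l2_norm M f)\<^sup>2 = (LINT t|\<nu> f. \<bar>t - c\<bar>) + (l2_norm MV f)\<^sup>2 + (l2_norm M f)\<^sup>2"
  using energy(1)[of f] by (simp add: q_eq algebra_simps)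

lemma energy_nonneg: "0 \<le> (LINT t|\<nu> f. \<bar>t - c\<bar>)"
  by (rule integral_nonneg_AE) simp

lemma null_sq:
  fixes x :: "nat \<Rightarrow> real" assumes "x \<longlonglongrightarrow> 0" shows "(\<lambda>n. (x n)\<^sup>2) \<longlonglongrightarrow> 0"
  using tendsto_power[OF assms, of 2] by simp

text \<open>The form norm splits into three nonnegative parts, so a Cauchy sequence is Cauchy for each of
  them. Its limits in \<open>L\<^sup>2(M)\<close> and \<open>L\<^sup>2(MV)\<close> agree where \<open>V > 0\<close>, by passing to subsequences that
  converge almost everywhere.\<close>
lemma form_complete:
  assumes u: "\<And>n. u n \<in> Q"
    and c: "\<And>e. e > 0 \<Longrightarrow> \<exists>N. \<forall>m\<ge>N. \<forall>n\<ge>N. q (u m - u n) + (1 - c) * (l2_norm M (u m - u n))\<^sup>2 < e"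
  shows "\<exists>l\<in>Q. (\<lambda>n. q (u n - l) + (1 - c) * (l2_norm M (u n - l))\<^sup>2) \<longlonglongrightarrow> 0"
proof -
  have dQ: "u m - u n \<in> Q" for m n using fun_vs.subspace_diff[OF Q_subspace u u] .
  have uL: "u n \<in> L2 M" and uV: "u n \<in> L2 MV" and uD: "u n \<in> Dom (\<lambda>t. t)" for n
    using u Q_in_L2 by auto
  have parts: "\<exists>N. \<forall>m\<ge>N. \<forall>n\<ge>N. (LINT t|\<nu> (u m - u n). \<bar>t - c\<bar>) < e \<and> (l2_norm MV (u m - u n))\<^sup>2 < e \<and> (l2_norm M (u m - u n))\<^sup>2 < e"
    if e: "e > 0" for e
  proof -
    obtain N where N: "\<And>m n. m \<ge> N \<Longrightarrow> n \<ge> N \<Longrightarrow> q (u m - u n) + (1 - c) * (l2_norm M (u m - u n))\<^sup>2 < e"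
      using c[OF e] by blast
    have "(LINT t|\<nu> (u m - u n). \<bar>t - c\<bar>) < e \<and> (l2_norm MV (u m - u n))\<^sup>2 < e \<and> (l2_norm M (u m - u n))\<^sup>2 < e"
      if "m \<ge> N" "n \<ge> N" for m n
      using N[OF that] energy_nonneg[of "u m - u n"] zero_le_power2[of "l2_norm MV (u m - u n)"]
        zero_le_power2[of "l2_norm M (u m - u n)"] unfolding form_norm_eq[OF dQ] by linarith
    then show ?thesis by blast
  qed
  have root: "\<exists>N. \<forall>m\<ge>N. \<forall>n\<ge>N. x m n < e"
    if x: "\<And>e. e > 0 \<Longrightarrow> \<exists>N. \<forall>m\<ge>N. \<forall>n\<ge>N. (x m n)\<^sup>2 < e" and e: "e > 0" for x :: "nat \<Rightarrow> nat \<Rightarrow> real" and e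
  proof -
    obtain N where N: "\<And>m n. m \<ge> N \<Longrightarrow> n \<ge> N \<Longrightarrow> (x m n)\<^sup>2 < e\<^sup>2"
      using x[of "e\<^sup>2"] e by auto
    have "x m n < e" if "m \<ge> N" "n \<ge> N" for m n
      using N[OF that] e by (auto intro: power_less_imp_less_base)
    then show ?thesis by blast
  qed
  have cauchy: "\<exists>N. \<forall>m\<ge>N. \<forall>n\<ge>N. l2_norm M (u m - u n) < e" if "e > 0" for e
    by (rule root[OF _ that]) (use parts in meson)
  obtain l where l: "l \<in> L2 M" "(\<lambda>n. l2_norm M (u n - l)) \<longlonglongrightarrow> 0"
    using L2_complete[OF uL cauchy] by blast
  have cauchyV: "\<exists>N. \<forall>m\<ge>N. \<forall>n\<ge>N. l2_norm MV (u m - u n) < e" if "e > 0" for e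
    by (rule root[OF _ that]) (use parts in meson)
  obtain l' where l': "l' \<in> L2 MV" "(\<lambda>n. l2_norm MV (u n - l')) \<longlonglongrightarrow> 0"
    using L2_complete[OF uV cauchyV] by blast
  obtain r where r: "strict_mono (r :: nat \<Rightarrow> nat)" "AE x in M. (\<lambda>n. u (r n) x) \<longlonglongrightarrow> l x"
    using L2_limit_AE_subseq[OF uL l] by blast
  have "(\<lambda>n. l2_norm MV (u (r n) - l')) \<longlonglongrightarrow> 0"
    using LIMSEQ_subseq_LIMSEQ[OF l'(2) r(1)] by (simp add: comp_def)
  then obtain r' where r': "strict_mono (r' :: nat \<Rightarrow> nat)" "AE x in MV. (\<lambda>n. u (r (r' n)) x) \<longlonglongrightarrow> l' x"
    using L2_limit_AE_subseq[of "\<lambda>n. u (r n)", OF uV l'(1)] by blast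
  have ll': "AE x in MV. l x = l' x"
    using AE_MV[OF r(2)] r'(2)
  proof eventually_elim
    case (elim x)
    have "(\<lambda>n. u (r (r' n)) x) \<longlonglongrightarrow> l x"
      using LIMSEQ_subseq_LIMSEQ[OF elim(1) r'(1)] by (simp add: comp_def)
    then show ?case using elim(2) LIMSEQ_unique by blast
  qed
  have lV: "l \<in> L2 MV"
  proof (rule L2_I)
    show m: "l \<in> borel_measurable MV" using L2_measurable[OF l(1)] by simp
    show "integrable MV (\<lambda>x. (norm (l x))\<^sup>2)"
    proof (rule Bochner_Integration.integrable_cong_AE_imp[OF L2_integrable[OF l'(1)]])
      show "(\<lambda>x. (norm (l x))\<^sup>2) \<in> borel_measurable MV" using m by measurable
      show "AE x in MV. (norm (l' x))\<^sup>2 = (norm (l x))\<^sup>2" using ll' by eventually_elim simp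
    qed
  qed
  have V_lim: "(\<lambda>n. l2_norm MV (u n - l)) \<longlonglongrightarrow> 0"
  proof -
    have "l2_norm MV (u n - l) = l2_norm MV (u n - l')" for n
    proof (rule l2_norm_cong_AE)
      show "AE x in MV. (u n - l) x = (u n - l') x" using ll' by eventually_elim simp
    qed (intro L2sp.H_closed uV lV l'(1))+
    then show ?thesis using l'(2) by simp
  qed
  have conv: "L2sp.converges_to M u l" using l(2) by (simp add: L2sp.converges_to_def)
  have tc: "(\<lambda>t. t - c) \<in> borel_measurable borel" by measurable
  have cE: "\<exists>N. \<forall>m\<ge>N. \<forall>n\<ge>N. (LINT t|\<nu> (u m - u n). \<bar>t - c\<bar>) < e" if "e > 0" for e
    using parts[OF that] by meson
  note DC = Dom_complete[OF tc energy(2)[OF uD] l(1) conv cE]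
  have lQ: "l \<in> Q" using Dom_shift[OF DC(1)] lV by blast
  have "(\<lambda>n. (LINT t|\<nu> (u n - l). \<bar>t - c\<bar>) + (l2_norm MV (u n - l))\<^sup>2 + (l2_norm M (u n - l))\<^sup>2) \<longlonglongrightarrow> 0 + 0 + 0"
    by (intro tendsto_add DC(2) null_sq V_lim l(2))
  then have "(\<lambda>n. q (u n - l) + (1 - c) * (l2_norm M (u n - l))\<^sup>2) \<longlonglongrightarrow> 0"
    unfolding form_norm_eq[OF fun_vs.subspace_diff[OF Q_subspace u lQ]] by simp
  then show ?thesis using lQ by blast
qed

lemma potential_tail:
  assumes f: "f \<in> Q" and R: "R > 0"
  shows "(l2_norm M f)\<^sup>2 \<le> (l2_norm M (restr {x \<in> space M. V x < R} f))\<^sup>2 + (l2_norm MV f)\<^sup>2 / R"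
proof -
  let ?F = "{x \<in> space M. V x < R}"
  note fL = Q_in_L2[OF f]
  have F: "?F \<in> sets M" by measurable
  have i1: "integrable M (\<lambda>x. (norm (restr ?F f x))\<^sup>2)" by (rule L2_integrable[OF restr_L2[OF F fL]])
  have i2: "integrable M (\<lambda>x. V x * (norm (f x))\<^sup>2)" using f L2_MV_iff[OF fL] by simp
  have "(l2_norm M f)\<^sup>2 \<le> (LINT x|M. (norm (restr ?F f x))\<^sup>2 + V x * (norm (f x))\<^sup>2 / R)"
    unfolding l2_norm_sq
  proof (rule integral_mono)
    fix x assume x: "x \<in> space M"
    show "(norm (f x))\<^sup>2 \<le> (norm (restr ?F f x))\<^sup>2 + V x * (norm (f x))\<^sup>2 / R"
    proof (cases "V x < R")
      case True
      then show ?thesis using x V_nonneg[OF x] R by (simp add: norm_restr_sq indicator_def)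
    next
      case False
      then have "R * (norm (f x))\<^sup>2 \<le> V x * (norm (f x))\<^sup>2" by (intro mult_right_mono) auto
      then show ?thesis using R False by (simp add: norm_restr_sq indicator_def pos_le_divide_eq mult.commute)
    qed
  qed (use i1 i2 L2_integrable[OF fL] in auto)
  also have "\<dots> = (l2_norm M (restr ?F f))\<^sup>2 + (l2_norm MV f)\<^sup>2 / R"
    unfolding MV_norm_sq[OF fL] l2_norm_sq[of M] using i1 i2 by simp
  finally show ?thesis .
qed

lemma spectral_tail:
  assumes f: "f \<in> Q" and \<Lambda>: "c < \<Lambda>"
  shows "(l2_norm M (f - Phi (indicator {..\<Lambda>}) f))\<^sup>2 \<le> (LINT t|\<nu> f. \<bar>t - c\<bar>) / (\<Lambda> - c)"
proof -
  note fL = Q_in_L2[OF f]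
  have \<sigma>: "simple_function borel (indicator {..\<Lambda>} :: real \<Rightarrow> real)" by (rule simple_function_indicator) simp
  have one: "simple_function borel (\<lambda>_::real. 1::real)" by simp
  have "Phi (\<lambda>_. 1) f = E UNIV f" by (simp add: Phi_def vimage_def)
  then have ae: "AE x in M. f x = Phi (\<lambda>_. 1) f x" using E_UNIV[OF fL] by (auto elim: eventually_mono)
  have ae': "AE x in M. (f - Phi (indicator {..\<Lambda>}) f) x = (Phi (\<lambda>_. 1) f - Phi (indicator {..\<Lambda>}) f) x"
    using ae by eventually_elim simp
  have "l2_norm M (f - Phi (indicator {..\<Lambda>}) f) = l2_norm M (Phi (\<lambda>_. 1) f - Phi (indicator {..\<Lambda>}) f)"
    by (rule l2_norm_cong_AE[OF ae']) (intro L2sp.H_closed Phi_L2 fL one \<sigma>)+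
  then have "(l2_norm M (f - Phi (indicator {..\<Lambda>}) f))\<^sup>2 = (LINT t|\<nu> f. (1 - indicator {..\<Lambda>} t)\<^sup>2)"
    using Phi_isometry[OF fL one \<sigma>] by simp
  also have "\<dots> \<le> (LINT t|\<nu> f. \<bar>t - c\<bar> / (\<Lambda> - c))"
  proof (rule integral_mono)
    have "integrable (\<nu> f) (\<lambda>t. \<bar>t - c\<bar>)" using energy(2)[of f] f by (simp add: Dom_def)
    then show "integrable (\<nu> f) (\<lambda>t. \<bar>t - c\<bar> / (\<Lambda> - c))" by simp
    show "integrable (\<nu> f) (\<lambda>t. (1 - indicator {..\<Lambda>} t)\<^sup>2 :: real)"
      by (rule simple_integrable[OF fL]) (intro simple_function_compose1[of _ _ "\<lambda>x. (1 - x)\<^sup>2"] \<sigma>)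
    show "(1 - indicator {..\<Lambda>} t)\<^sup>2 \<le> \<bar>t - c\<bar> / (\<Lambda> - c)" for t
      using \<Lambda> by (cases "t \<le> \<Lambda>") (auto simp: pos_le_divide_eq)
  qed
  finally show ?thesis by simp
qed

text \<open>The norm of \<open>f\<close> is split into the part where \<open>V \<ge> R\<close>, controlled by the potential energy; the
  part of spectral energy above \<open>\<Lambda>\<close>, controlled by the kinetic energy; and the cut-off restricted to
  \<open>{V < R}\<close>, which is compact because this set has finite measure. The choices \<open>\<Lambda> = c + 2 R\<close> and
  \<open>\<epsilon> = 1 / (2 R)\<close> give both energies the weight \<open>1 / R\<close> and the compact part the error \<open>\<parallel>f\<parallel>\<^sup>2 / R\<close>; after
  multiplication by \<open>R\<close>, the form and the finitely many coefficients together dominate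
  \<open>(R + c - 1) \<parallel>f\<parallel>\<^sup>2\<close>, and \<open>R\<close> can be taken large.\<close>
lemma compact_embedding:
  "\<exists>S C. finite S \<and> S \<subseteq> L2 M \<and> 0 \<le> C \<and>
    (\<forall>f\<in>Q. \<mu> * (l2_norm M f)\<^sup>2 \<le> q f + C * (\<Sum>s\<in>S. (cmod (l2_inner M s f))\<^sup>2))"
proof -
  define R where "R = max 1 (\<mu> - c + 1)"
  have R: "R \<ge> 1" "\<mu> \<le> R + c - 1" by (auto simp: R_def)
  define \<Lambda> where "\<Lambda> = c + 2 * R"
  define \<sigma> :: "real \<Rightarrow> real" where "\<sigma> = indicator {..\<Lambda>}"
  have \<sigma>: "simple_function borel \<sigma>" unfolding \<sigma>_def by (rule simple_function_indicator) simp
  define F where "F = {x \<in> space M. V x < R}"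
  have F: "F \<in> sets M" "emeasure M F < \<infinity>" using V_confining by (auto simp: F_def)
  have "\<exists>S. finite S \<and> S \<subseteq> L2 M \<and> (\<forall>f\<in>L2 M.
    (l2_norm M (restr F (Phi \<sigma> f)))\<^sup>2 \<le> (1 / (2 * R)) * (l2_norm M f)\<^sup>2 + 2 * (\<Sum>e\<in>S. (cmod (l2_inner M e f))\<^sup>2))"
    using R smoothing by (intro compact_cutoff \<sigma> F) (auto simp: \<sigma>_def indicator_def)
  then obtain S where S: "finite S" "S \<subseteq> L2 M" and cut: "\<And>f. f \<in> L2 M \<Longrightarrow>
    (l2_norm M (restr F (Phi \<sigma> f)))\<^sup>2 \<le> (1 / (2 * R)) * (l2_norm M f)\<^sup>2 + 2 * (\<Sum>e\<in>S. (cmod (l2_inner M e f))\<^sup>2)"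
    by blast
  have "\<mu> * (l2_norm M f)\<^sup>2 \<le> q f + (4 * R) * (\<Sum>s\<in>S. (cmod (l2_inner M s f))\<^sup>2)" if f: "f \<in> Q" for f
  proof -
    note fL = Q_in_L2[OF f]
    define \<Sigma> where "\<Sigma> = (\<Sum>s\<in>S. (cmod (l2_inner M s f))\<^sup>2)"
    define T where "T = (LINT t|\<nu> f. \<bar>t - c\<bar>)"
    define P where "P = Phi \<sigma> f"
    have PL: "P \<in> L2 M" "f - P \<in> L2 M" using fL \<sigma> by (auto simp: P_def)
    have "(l2_norm M (restr F f))\<^sup>2 = (l2_norm M (restr F P + restr F (f - P)))\<^sup>2"
      by (simp flip: restr_add)
    also have "\<dots> \<le> 2 * (l2_norm M (restr F P))\<^sup>2 + 2 * (l2_norm M (restr F (f - P)))\<^sup>2"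
      by (intro norm_sq_add_le restr_L2 F PL)
    also have "(l2_norm M (restr F (f - P)))\<^sup>2 \<le> (l2_norm M (f - P))\<^sup>2"
      using restr_norm_le[OF F(1) PL(2)] by (intro power_mono) auto
    also have "(l2_norm M (f - P))\<^sup>2 \<le> T / (2 * R)"
      using spectral_tail[OF f, of \<Lambda>] R by (simp add: P_def T_def \<sigma>_def \<Lambda>_def)
    also have "(l2_norm M (restr F P))\<^sup>2 \<le> (1 / (2 * R)) * (l2_norm M f)\<^sup>2 + 2 * \<Sigma>"
      unfolding P_def \<Sigma>_def by (rule cut[OF fL])
    finally have 1: "(l2_norm M (restr F f))\<^sup>2 \<le> 2 * ((1 / (2 * R)) * (l2_norm M f)\<^sup>2 + 2 * \<Sigma>) + 2 * (T / (2 * R))"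
      by simp
    have "(l2_norm M f)\<^sup>2 \<le> (l2_norm M (restr F f))\<^sup>2 + (l2_norm MV f)\<^sup>2 / R"
      using potential_tail[OF f, of R] R by (simp add: F_def)
    then have "(l2_norm M f)\<^sup>2 \<le> (1 / R) * (l2_norm M f)\<^sup>2 + 4 * \<Sigma> + T / R + (l2_norm MV f)\<^sup>2 / R"
      using 1 by simp
    then have "R * (l2_norm M f)\<^sup>2 \<le> R * ((1 / R) * (l2_norm M f)\<^sup>2 + 4 * \<Sigma> + T / R + (l2_norm MV f)\<^sup>2 / R)"
      using R by (intro mult_left_mono) auto
    also have "\<dots> = (l2_norm M f)\<^sup>2 + 4 * R * \<Sigma> + T + (l2_norm MV f)\<^sup>2"
      using R by (simp add: distrib_left)
    also have "T = (LINT t|\<nu> f. t) - c * (l2_norm M f)\<^sup>2" using energy(1)[of f] f by (simp add: T_def)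
    finally have "(R + c - 1) * (l2_norm M f)\<^sup>2 \<le> q f + 4 * R * \<Sigma>"
      by (simp add: q_eq[OF f] algebra_simps)
    moreover have "\<mu> * (l2_norm M f)\<^sup>2 \<le> (R + c - 1) * (l2_norm M f)\<^sup>2" using R(2) by (intro mult_right_mono) auto
    ultimately show ?thesis by (simp add: \<Sigma>_def)
  qed
  then show ?thesis using S R(1) by (intro exI[of _ S] exI[of _ "4 * R"]) auto
qed

sublocale discrete_form M Q q "1 - c"
proof unfold_locales
  show "fun_vs.subspace Q" by (rule Q_subspace)
  show "Q \<subseteq> L2 M" using Q_in_L2 by blast
  fix f g h :: "'a \<Rightarrow> complex" and a assume f: "f \<in> Q"
  have fD: "f \<in> Dom (\<lambda>t. t)" and fV: "f \<in> L2 MV" using f by auto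
  note sesq = form_sesquilinear[OF id_measurable]
  have sc: "cscale a f \<in> Q" using fun_vs.subspace_scale[OF Q_subspace f] .
  show "g \<in> Q" if g: "g \<in> L2 M" and gf: "AE x in M. g x = f x"
  proof -
    have "integrable M (\<lambda>x. V x * (norm (g x))\<^sup>2)"
    proof (rule Bochner_Integration.integrable_cong_AE_imp)
      show "integrable M (\<lambda>x. V x * (norm (f x))\<^sup>2)" using fV L2_MV_iff[OF Q_in_L2[OF f]] by simp
      show "(\<lambda>x. V x * (norm (g x))\<^sup>2) \<in> borel_measurable M" using L2_measurable[OF g] by measurable
      show "AE x in M. V x * (norm (f x))\<^sup>2 = V x * (norm (g x))\<^sup>2" using gf by eventually_elim simp
    qed
    then show ?thesis using Dom_cong_AE[OF fD g gf] L2_MV_iff[OF g] by simp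
  qed
  show "polarize q f f = complex_of_real (q f)"
    using polarize_q[OF f f] sesq(4)[OF fD fD] L2sp.ip_self[OF fV] by (simp add: q_eq[OF f])
  show "(l2_norm M f)\<^sup>2 \<le> q f + (1 - c) * (l2_norm M f)\<^sup>2"
    unfolding form_norm_eq[OF f] using energy_nonneg[of f] by simp
  assume h: "h \<in> Q"
  have hD: "h \<in> Dom (\<lambda>t. t)" and hV: "h \<in> L2 MV" using h by auto
  show "polarize q h (cscale a f) = a * polarize q h f"
    unfolding polarize_q[OF h f] polarize_q[OF h sc] sesq(2)[OF hD fD] L2sp.ip_scale_right[OF hV fV]
    by (simp add: distrib_left)
  show "polarize q f h = cnj (polarize q h f)"
    unfolding polarize_q[OF h f] polarize_q[OF f h] sesq(3)[OF hD fD] L2sp.ip_commute[OF hV fV] by simp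
  assume g: "g \<in> Q"
  have gD: "g \<in> Dom (\<lambda>t. t)" and gV: "g \<in> L2 MV" using g by auto
  show "polarize q h (f + g) = polarize q h f + polarize q h g"
    unfolding polarize_q[OF h f] polarize_q[OF h g] polarize_q[OF h fun_vs.subspace_add[OF Q_subspace f g]]
      sesq(1)[OF hD fD gD] L2sp.ip_add_right[OF hV fV gV] by simp
next
  fix u :: "nat \<Rightarrow> 'a \<Rightarrow> complex"
  assume "\<And>n. u n \<in> Q" and "\<And>e. e > 0 \<Longrightarrow> \<exists>N. \<forall>m\<ge>N. \<forall>n\<ge>N. q (u m - u n) + (1 - c) * (l2_norm M (u m - u n))\<^sup>2 < e"
  then show "\<exists>l\<in>Q. (\<lambda>n. q (u n - l) + (1 - c) * (l2_norm M (u n - l))\<^sup>2) \<longlonglongrightarrow> 0"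
    by (rule form_complete)
qed (rule compact_embedding)

end

theorem theorem2:
  fixes X :: "'a topology" and M :: "'a measure" and L0 :: "'a l2_op" and V :: "'a \<Rightarrow> real"
  assumes "locally_compact_space X"
    and "space M = topspace X"
    and "\<And>U. openin X U \<Longrightarrow> U \<in> sets M"
    and "l2_separable M"
    and "selfadjoint M L0"
    and "bounded_from_below M L0"
    and "\<exists>s>0. maps_L2_to_Linf M (exp_op M s L0)"
    and "V \<in> borel_measurable M"
    and "\<And>x. x \<in> space M \<Longrightarrow> 0 \<le> V x"
    and "\<And>R::real. emeasure M {x \<in> space M. 0 \<le> V x \<and> V x < R} < \<infinity>"
  shows "purely_discrete_spectrum M (form_sum_space M L0 V) (form_sum M L0 V)"
proof -
  define E where "E = spectral_measure M L0"
  \<comment> \<open>The heat operator is everywhere defined, so its graph is not the empty default: \<open>E\<close> is a genuine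
    spectral measure of \<open>L0\<close>.\<close>
  obtain s where s: "s > 0" and heat: "L2 M \<subseteq> Domain (exp_op M s L0)" "Range (exp_op M s L0) \<subseteq> Linf M"
    using assms(7) by (auto simp: maps_L2_to_Linf_def)
  have "0 \<in> Domain (exp_op M s L0)" using heat(1) L2sp.H_closed(1) by blast
  then have spec: "is_spectral_measure M L0 E"
    by (auto simp: exp_op_def functional_calculus_def E_def)
  then have fc: "functional_calculus M L0 \<phi> = spectral_integral M E \<phi>" for \<phi>
    by (simp add: functional_calculus_def flip: E_def)
  have L0: "L0 = spectral_integral M E (\<lambda>t. t)" and pvmE: "projection_valued_measure M E"
    using spec by (auto simp: is_spectral_measure_def)
  interpret pvm M E using pvmE by (rule pvm.intro)
  obtain c where lower: "\<And>f g. (f, g) \<in> L0 \<Longrightarrow> c * (l2_norm M f)\<^sup>2 \<le> Re (l2_inner M f g)"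
    using assms(6) by (auto simp: bounded_from_below_def)
  interpret confined_form M E V c
  proof
    show "AE t in \<nu> f. c \<le> t" if "f \<in> L2 M" for f
      using lower that unfolding L0 by (rule spectral_support)
    show "emeasure M {x \<in> space M. V x < R} < \<infinity>" for R
    proof -
      have "{x \<in> space M. V x < R} = {x \<in> space M. 0 \<le> V x \<and> V x < R}" using assms(9) by auto
      then show ?thesis using assms(10) by simp
    qed
    show "Phi (indicator {..\<Lambda>}) f \<in> Linf M" if f: "f \<in> L2 M" for f \<Lambda>
    proof -
      have tot: "L2 M \<subseteq> Domain (spectral_integral M E (\<lambda>t. exp (- s * t)))"
        using heat(1) by (simp add: exp_op_def fc)
      obtain h g where hg: "(h, g) \<in> spectral_integral M E (\<lambda>t. exp (- s * t))"
        "AE x in M. Phi (indicator {..\<Lambda>}) f x = g x"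
        using heat_range[OF tot s f] by blast
      have "g \<in> Linf M" using heat(2) hg(1) by (auto simp: exp_op_def fc)
      then show ?thesis
      proof (rule Linf_cong_AE[OF _ _ hg(2)])
        show "Phi (indicator {..\<Lambda>}) f \<in> borel_measurable M"
          using f by (intro L2_measurable Phi_L2 simple_function_indicator) auto
      qed
    qed
  qed (use assms(8,9) in auto)
  have opdom: "op_form_dom M L0 = Dom (\<lambda>t. t)"
  proof -
    have m: "(\<lambda>t::real. sqrt \<bar>t\<bar>) \<in> borel_measurable borel" by measurable
    have dom: "Domain (spectral_integral M E (\<lambda>t. sqrt \<bar>t\<bar>)) = spectral_integral_dom M E (\<lambda>t. sqrt \<bar>t\<bar>)"
      using spectral_integral_total[OF _ m] by (auto simp: spectral_integral_def)
    have abs: "integrable (\<nu> f) (\<lambda>t. \<bar>t\<bar>) \<longleftrightarrow> integrable (\<nu> f) (\<lambda>t. t)" for f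
      using integrable_abs_cancel[OF _ measurable_\<nu>[OF id_measurable], of f] integrable_abs[of "\<nu> f" "\<lambda>t. t"] by blast
    show ?thesis
      unfolding op_form_dom_def fc dom
      unfolding spectral_integral_dom_def Dom_def real_sqrt_pow2[OF abs_ge_zero] abs ..
  qed
  have "form_sum_dom M L0 V = Q"
  proof (rule set_eqI)
    fix f
    have "f \<in> Dom (\<lambda>t. t) \<Longrightarrow> f \<in> L2 MV \<longleftrightarrow> integrable M (\<lambda>x. V x * (norm (f x))\<^sup>2)"
      by (rule L2_MV_iff[OF Dom_L2])
    then show "f \<in> form_sum_dom M L0 V \<longleftrightarrow> f \<in> Q"
      unfolding form_sum_dom_def opdom mem_Collect_eq Int_iff by (rule conj_cong[OF refl, symmetric])
  qed
  moreover have "form_sum_form M L0 V = q"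
    unfolding form_sum_form_def[abs_def] q_def[abs_def] op_form_def E_def[symmetric] ..
  ultimately show ?thesis
    using purely_discrete unfolding form_sum_space_def form_sum_def by simp
qed

end
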